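(* Let $p:\mathbb{R}\to\mathbb{R}$ be an $L^\infty$ function, let $\Gamma:\mathbb{R}\to\mathbb{R}$ be bounded and continuous with finite limits $\lim_{t\to\pm\infty}\Gamma(t)$, and let $\Omega_p$ be the hull of $p$. Then: (i) The map $\mathbb{R}\to\mathbb{R}$, $s\mapsto\lambda_*(\Gamma,q_s)$ is uniformly continuous for all $q\in\Omega_p$. (ii) The map $\Omega_p\to\mathbb{R}$, $q\mapsto\lambda_*(\Gamma,q)$ is lower semicontinuous. Consequently, $\lambda_*(\Gamma,q)\le\lambda_*(\Gamma,p)$ for all $q\in\Omega_p$. (iii) If there exists $\rho>0$ with $\lambda_*(\Gamma,p_s)\le-\rho$ for all $s\in\mathbb{R}$, then there is total tracking on the hull for $x'=-(x-\Gamma(t))^2+p(t)$; that is, for every $q\in\Omega_p$ the equation $x'=-(x-\Gamma(t))^2+q(t)$ has an attractor-repeller pair. (iv) If $p$ is almost periodic, then the map $\Omega_p\to\mathbb{R}$, $q\mapsto\lambda_*(\Gamma,q)$ is continuous. (v) If $p$ is almost periodic and there exist $s_1,s_2\in\mathbb{R}$ with $\lambda_*(\Gamma,p_{s_1})<0<\lambda_*(\Gamma,p_{s_2})$, then there exist four sequences $(s_{1,n}^\pm)$, $(s_{2,n}^\pm)$ with $\lim_{n\to\infty}s_{i,n}^\pm=\pm\infty$ and $\pm s_{1,n}^\pm\le\pm s_{2,n}^\pm\le\pm s_{1,n+1}^\pm$ for all $n\in\mathbb{N}$ such that $\lambda_*(\Gamma,p_{s_{1,n}^\pm})<0<\lambda_*(\Gamma,p_{s_{2,n}^\pm})$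 for all $n\in\mathbb{N}$.
   Context: Hull: for $q\in L^\infty(\mathbb{R})$ and $s\in\mathbb{R}$, $q_s(t):=q(s+t)$. $\Omega_p$ is the closure of $\{p_s\,|\;s\in\mathbb{R}\}$ in $L^\infty(\mathbb{R})$ with the topology $\sigma$ given by the seminorms $n_{[r_1,r_2]}(q)=\big|\int_{r_1}^{r_2}q(t)\,dt\big|$ for $r_1<r_2$ in $\mathbb{Q}$. With this topology $\Omega_p$ is a compact metric space, invariant under time shifts. Solutions are Carathéodory solutions (absolutely continuous on compact intervals, satisfying the equation for a.e. $t$). For $q\in L^\infty(\mathbb{R})$, $\lambda_*(\Gamma,q)$ denotes the unique real number such that $x'=-(x-\Gamma(t))^2+q(t)+\lambda$ has a bounded solution defined on $\mathbb{R}$ if and only if $\lambda\ge\lambda_*(\Gamma,q)$ (such a number exists). Attractor-repeller pair for $x'=-(x-\Gamma(t))^2+q(t)$: a pair $(a,r)$ of bounded solutions on $\mathbb{R}$, the maximal and the minimal bounded solutions, which are hyperbolic with $a$ attractive and $r$ repulsive: there exist $k\ge1,\beta>0$ with $\exp\int_s^t-2(a(l)-\Gamma(l))\,dl\le ke^{-\beta(t-s)}$ for $t\ge s$ and $\exp\int_s^t-2(r(l)-\Gamma(l))\,dl\le ke^{\beta(t-s)}$ for $t\le s$. This holds if and only if $\lambda_*(\Gamma,q)<0$. Almost periodic is in the sense of Bohr.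
   Formalization: The second sentence of (ii), λ_*(Γ,q) ≤ λ_*(Γ,p), is false (e.g. Γ(t)=max(0,1−|t|), p=Γ′, q=p_2) and is replaced by: s↦λ_*(Γ,p_s) is bounded above and λ_*(Γ,q) ≤ sup_s λ_*(Γ,p_s) for all q in Ω_p. *)

theory Defs
  imports "HOL-Analysis.Analysis"
begin

text \<open>
  Elements of the space are represented by functions, not by classes of functions that agree
  almost everywhere. Everything below except \<open>almost_periodic\<close>, which concerns a continuous
  function, is invariant under changes of \<open>q\<close> on null sets. The
  topology on representatives is the pullback of the one on classes, so closures, continuity and
  semicontinuity mean the same for representatives and for classes.
\<close>

definition Linf :: "(real \<Rightarrow> real) set" where
  "Linf = {q \<in> borel_measurable lebesgue. \<exists>C. AE t in lebesgue. \<bar>q t\<bar> \<le> C}"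

definition shift :: "(real \<Rightarrow> real) \<Rightarrow> real \<Rightarrow> real \<Rightarrow> real" where
  "shift q s = (\<lambda>t. q (s + t))"

definition seminorm_int :: "real \<Rightarrow> real \<Rightarrow> (real \<Rightarrow> real) \<Rightarrow> real" where
  "seminorm_int r1 r2 q = \<bar>LINT t:{r1..r2}|lebesgue. q t\<bar>"

text \<open>The open balls of the single seminorms form a subbase.\<close>

definition sigma_topology :: "(real \<Rightarrow> real) topology" where
  "sigma_topology = topology_generated_by
     {{f \<in> Linf. seminorm_int r1 r2 (\<lambda>t. f t - g t) < \<epsilon>} | r1 r2 g \<epsilon>.
        r1 \<in> \<rat> \<and> r2 \<in> \<rat> \<and> r1 < r2 \<and> g \<in> Linf \<and> 0 < \<epsilon>}"

definition time_hull :: "(real \<Rightarrow> real) \<Rightarrow> (real \<Rightarrow> real) set" where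
  "time_hull p = sigma_topology closure_of (range (shift p))"

definition hull_topology :: "(real \<Rightarrow> real) \<Rightarrow> (real \<Rightarrow> real) topology" where
  "hull_topology p = subtopology sigma_topology (time_hull p)"

definition lower_semicontinuous_map :: "'a topology \<Rightarrow> ('a \<Rightarrow> real) \<Rightarrow> bool" where
  "lower_semicontinuous_map X f \<longleftrightarrow> (\<forall>c. openin X {x \<in> topspace X. c < f x})"

definition absolutely_continuous_on_interval :: "(real \<Rightarrow> real) \<Rightarrow> real \<Rightarrow> real \<Rightarrow> bool" where
  "absolutely_continuous_on_interval f a b \<longleftrightarrow>
     (\<forall>\<epsilon>>0. \<exists>\<delta>>0. \<forall>D. finite D \<longrightarrow>
        (\<forall>(u, v) \<in> D. a \<le> u \<and> u \<le> v \<and> v \<le> b) \<longrightarrow>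
        pairwise (\<lambda>I J. {fst I<..<snd I} \<inter> {fst J<..<snd J} = {}) D \<longrightarrow>
        (\<Sum>(u, v)\<in>D. v - u) < \<delta> \<longrightarrow>
        (\<Sum>(u, v)\<in>D. \<bar>f v - f u\<bar>) < \<epsilon>)"

text \<open>Solutions on the whole real line of \<open>x' = -(x - \<Gamma>(t))\<^sup>2 + h(t)\<close>.\<close>

definition caratheodory_solution ::
    "(real \<Rightarrow> real) \<Rightarrow> (real \<Rightarrow> real) \<Rightarrow> (real \<Rightarrow> real) \<Rightarrow> bool" where
  "caratheodory_solution \<Gamma> h x \<longleftrightarrow>
     (\<forall>a b. a \<le> b \<longrightarrow> absolutely_continuous_on_interval x a b) \<and>
     (AE t in lebesgue. (x has_real_derivative (- (x t - \<Gamma> t)\<^sup>2 + h t)) (at t))"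

definition bounded_solution ::
    "(real \<Rightarrow> real) \<Rightarrow> (real \<Rightarrow> real) \<Rightarrow> (real \<Rightarrow> real) \<Rightarrow> bool" where
  "bounded_solution \<Gamma> h x \<longleftrightarrow> caratheodory_solution \<Gamma> h x \<and> bounded (range x)"

definition lambda_star :: "(real \<Rightarrow> real) \<Rightarrow> (real \<Rightarrow> real) \<Rightarrow> real" where
  "lambda_star \<Gamma> q =
     (THE l. \<forall>lam. (\<exists>x. bounded_solution \<Gamma> (\<lambda>t. q t + lam) x) \<longleftrightarrow> l \<le> lam)"

text \<open>
  The interval integrals are oriented: for \<open>t \<le> s\<close> the integral from \<open>s\<close> to \<open>t\<close> is minus the
  integral over \<open>{t..s}\<close>.
\<close>

definition attractor_repeller_pair ::
    "(real \<Rightarrow> real) \<Rightarrow> (real \<Rightarrow> real) \<Rightarrow> (real \<Rightarrow> real) \<Rightarrow> (real \<Rightarrow> real) \<Rightarrow> bool" where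
  "attractor_repeller_pair \<Gamma> h a r \<longleftrightarrow>
     bounded_solution \<Gamma> h a \<and> bounded_solution \<Gamma> h r \<and>
     (\<forall>x. bounded_solution \<Gamma> h x \<longrightarrow> (\<forall>t. r t \<le> x t \<and> x t \<le> a t)) \<and>
     (\<exists>k \<beta>. 1 \<le> k \<and> 0 < \<beta> \<and>
        (\<forall>s t. s \<le> t \<longrightarrow>
           exp (LBINT l=ereal s..ereal t. - 2 * (a l - \<Gamma> l)) \<le> k * exp (- \<beta> * (t - s))) \<and>
        (\<forall>s t. t \<le> s \<longrightarrow>
           exp (LBINT l=ereal s..ereal t. - 2 * (r l - \<Gamma> l)) \<le> k * exp (\<beta> * (t - s))))"

definition almost_periodic :: "(real \<Rightarrow> real) \<Rightarrow> bool" where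
  "almost_periodic f \<longleftrightarrow> continuous_on UNIV f \<and>
     (\<forall>\<epsilon>>0. \<exists>L>0. \<forall>c. \<exists>\<tau>\<in>{c..c + L}. \<forall>t. \<bar>f (t + \<tau>) - f t\<bar> \<le> \<epsilon>)"

end

theory Submission
  imports Defs "HOL-Complex_Analysis.Great_Picard"
begin

text \<open>
  Let \<open>Q\<close> be a primitive of \<open>q\<close> and \<open>G = \<Gamma> - Q\<close>. The substitution \<open>z = x - Q\<close> turns the
  Caratheodory equation into \<open>z' = l - (z - G)\<^sup>2\<close> with continuous right-hand side, and \<open>q\<close> enters
  only through \<open>Q\<close>. Since \<open>G\<close> moves by a bounded amount in bounded time, all bounded solutions obey
  a common a priori bound on \<open>z - G\<close>. Comparison with a bounded subsolution produces a maximal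
  bounded solution, and diagonal extraction shows that bounded solutions persist under pointwise
  convergence of \<open>G\<close>; this gives the existence of \<open>\<lambda>\<^sub>*\<close> and its lower semicontinuity. A solution
  for one potential is a subsolution for a nearby potential and a slightly larger parameter, which
  gives the continuity statements. Hyperbolicity comes from the logarithmic derivative of the gap
  between the extremal bounded solutions and a bounded solution for a smaller parameter.
\<close>

subsection \<open>Primitives and forward solutions\<close>

text \<open>The seminorms see only integrals of the forcing, so pointwise values of \<open>q\<close>
  are not controlled along the hull, while primitives with a common Lipschitz constant converge
  locally uniformly. Local closeness is enough to carry bounded solutions to a limit, hence lower
  semicontinuity; an upper estimate needs a subsolution on the whole line, hence closeness uniform
  in time. Two such forms of closeness occur. For translates, the shift is moved from
  \<open>q\<close> onto \<Gamma>, so that only \<Gamma> is perturbed, which is uniformly continuous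
  thanks to its limits, and the roughness of \<open>q\<close> does no harm. For almost periodic
  \<open>p\<close>, closeness of primitives on one long window forces closeness of the translates on
  the whole line; the difference of the primitives then drifts at a small rate, and that rate is the
  whole price in the parameter. Since \<Gamma> is not translated along with \<open>q\<close>, the
  thresholds of different translates differ, and bounds over the hull involve the supremum over all
  translates of \<open>p\<close>.\<close>

text \<open>The oriented integral: at least one of the two intervals is empty or a point.\<close>

definition primitive :: "real \<Rightarrow> (real \<Rightarrow> real) \<Rightarrow> real \<Rightarrow> real" where
  "primitive a f t = integral {a..t} f - integral {t..a} f"

lemma primitive_self [simp]: "primitive a f a = 0"
  by (simp add: primitive_def)

lemma primitive_diff:
  assumes int: "\<And>a b. f integrable_on {a..b}" and "s \<le> t"
  shows "primitive a f t - primitive a f s = integral {s..t} f"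
proof -
  \<comment> \<open>A base point \<open>c\<close> to the left of all points involved replaces the
    oriented integral by ordinary ones.\<close>
  have eq: "primitive a f x = integral {c..x} f - integral {c..a} f" if "c \<le> a" "c \<le> x" for c x
  proof (cases "a \<le> x")
    case True
    with that have "integral {c..a} f + integral {a..x} f = integral {c..x} f"
      by (intro Henstock_Kurzweil_Integration.integral_combine int) auto
    with True show ?thesis
      by (cases "a = x") (auto simp: primitive_def)
  next
    case False
    with that have "integral {c..x} f + integral {x..a} f = integral {c..a} f"
      by (intro Henstock_Kurzweil_Integration.integral_combine int) auto
    with False show ?thesis
      by (auto simp: primitive_def)
  qed
  define c where "c = min a s"
  have "integral {c..s} f + integral {s..t} f = integral {c..t} f"
    using assms by (intro Henstock_Kurzweil_Integration.integral_combine int) (auto simp: c_def)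
  moreover have "c \<le> a" "c \<le> s" "c \<le> t"
    using assms by (auto simp: c_def)
  ultimately show ?thesis
    using eq[of c s] eq[of c t] by simp
qed

lemma integrable_on_of_continuous_UNIV:
  fixes f :: "real \<Rightarrow> real"
  assumes "continuous_on UNIV f"
  shows "f integrable_on {a..b}"
  using assms by (intro integrable_continuous_interval continuous_on_subset[OF assms]) auto

text \<open>Recovers the differential equation after a passage to the limit: the integrated identity
  survives pointwise limits, derivatives need not.\<close>

lemma DERIV_of_integral_eq:
  fixes w h :: "real \<Rightarrow> real"
  assumes h: "continuous_on UNIV h"
    and w: "\<And>s t. s \<le> t \<Longrightarrow> w t - w s = integral {s..t} h"
  shows "(w has_real_derivative h t) (at t)"
proof -
  have "((\<lambda>x. integral {t - 1..x} h) has_vector_derivative h t) (at t within {t - 1..t + 1})"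
    by (intro integral_has_vector_derivative continuous_on_subset[OF h]) auto
  then have "((\<lambda>x. integral {t - 1..x} h) has_real_derivative h t) (at t)"
    by (simp add: has_real_derivative_iff_has_vector_derivative at_within_Icc_at)
  then have "((\<lambda>x. w (t - 1) + integral {t - 1..x} h) has_real_derivative h t) (at t)"
    by (auto intro!: derivative_eq_intros)
  then show ?thesis
  proof (rule has_field_derivative_transform_within_open[where S = "{t - 1<..}"])
    show "w (t - 1) + integral {t - 1..x} h = w x" if "x \<in> {t - 1<..}" for x
      using w[of "t - 1" x] that by simp
  qed auto
qed

lemma DERIV_primitive:
  assumes "continuous_on UNIV h"
  shows "(primitive a h has_real_derivative h t) (at t)"
  using assms
  by (intro DERIV_of_integral_eq primitive_diff integrable_on_of_continuous_UNIV)

lemma integral_DERIV: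
  fixes z :: "real \<Rightarrow> real"
  assumes "s \<le> t" "\<And>x. s \<le> x \<Longrightarrow> x \<le> t \<Longrightarrow> (z has_real_derivative D x) (at x)"
  shows "(D has_integral z t - z s) {s..t}"
  using assms
  by (intro fundamental_theorem_of_calculus)
     (auto simp: has_real_derivative_iff_has_vector_derivative[symmetric]
           intro: has_field_derivative_at_within)

text \<open>Comparison arguments run after the last time at which the level is respected, because
  there the opposite inequality is strict throughout.\<close>

lemma last_exit:
  fixes f :: "real \<Rightarrow> real"
  assumes "continuous_on {a..b} f" "a \<le> b" "f a \<le> c" "c < f b"
  obtains s where "a \<le> s" "s < b" "f s \<le> c" "\<And>x. s < x \<Longrightarrow> x \<le> b \<Longrightarrow> c < f x"
proof -
  define S where "S = {x \<in> {a..b}. f x \<le> c}"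
  have "closed S"
    unfolding S_def by (intro continuous_on_closed_Collect_le continuous_on_const) (use assms in auto)
  then have "compact S"
    by (auto simp: compact_eq_bounded_closed S_def intro!: bounded_subset[OF bounded_closed_interval, of _ a b])
  moreover have "S \<noteq> {}"
    using assms by (auto simp: S_def)
  ultimately obtain s where s: "s \<in> S" "\<And>x. x \<in> S \<Longrightarrow> x \<le> s"
    using compact_attains_sup[of S] by auto
  have "s \<noteq> b"
    using s assms by (auto simp: S_def)
  moreover have "a \<le> s" "s \<le> b" "f s \<le> c"
    using s(1) by (auto simp: S_def)
  moreover have "c < f x" if "s < x" "x \<le> b" for x
    using s(2)[of x] that \<open>a \<le> s\<close> by (auto simp: S_def not_le[symmetric])
  ultimately show thesis
    by (intro that[of s]) auto
qed

text \<open>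
  The weight \<open>exp (2 L (t - t0))\<close> makes the Picard operator a contraction on the whole
  half-line, so no continuation argument is needed.
\<close>

lemma forward_ode_solution_exists:
  fixes F :: "real \<Rightarrow> real \<Rightarrow> real"
  assumes cont: "\<And>w. continuous_on UNIV w \<Longrightarrow> continuous_on UNIV (\<lambda>t. F t (w t))"
    and lip: "\<And>t x y. \<bar>F t x - F t y\<bar> \<le> L * \<bar>x - y\<bar>"
    and L: "0 < L"
    and bd: "\<And>t x. \<bar>F t x\<bar> \<le> B"
  obtains z where "z t0 = z0" "\<And>t. t0 \<le> t \<Longrightarrow> (z has_real_derivative F t (z t)) (at t)"
proof -
  define W where "W t = exp (2 * L * (t - t0))" for t
  have W_pos: "0 < W t" for t
    by (simp add: W_def)
  have W_cont: "continuous_on S W" for S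
    unfolding W_def by (intro continuous_intros)
  have W_deriv: "(W has_real_derivative 2 * L * W t) (at t)" for t
    unfolding W_def by (auto intro!: derivative_eq_intros)
  define h where "h y t = F t (W t * y t)" for y t
  define P where "P y = primitive t0 (h y)" for y
  have h_cont: "continuous_on UNIV (h y)" if "continuous_on UNIV y" for y
    unfolding h_def by (intro cont continuous_intros W_cont that)
  have P_deriv: "(P y has_real_derivative h y t) (at t)" if "continuous_on UNIV y" for y t
    unfolding P_def by (intro DERIV_primitive h_cont that)
  have P_cont: "continuous_on UNIV (P y)" if "continuous_on UNIV y" for y
    using P_deriv[OF that] by (meson DERIV_isCont continuous_at_imp_continuous_on)
  have P0: "P y t0 = 0" for y
    by (simp add: P_def)
  define \<Phi> where "\<Phi> y t = (z0 + P y (max t t0)) / W (max t t0)" for y t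
  have B: "0 \<le> B"
    using bd[of 0 0] by linarith
  have P_bd: "\<bar>P y t\<bar> \<le> B * (t - t0)" if y: "continuous_on UNIV y" and t: "t0 \<le> t" for y t
  proof -
    have "(h y has_integral P y t - P y t0) {t0..t}"
      by (intro integral_DERIV P_deriv y t)
    then have "norm (P y t - P y t0) \<le> B * Henstock_Kurzweil_Integration.content {t0..t}"
      by (intro has_integral_bound_real[where S = "{}"]) (use B bd in \<open>auto simp: h_def\<close>)
    then show ?thesis
      using t by (simp add: P0)
  qed
  have \<Phi>_mem: "\<Phi> y \<in> bcontfun" if y: "continuous_on UNIV y" for y
  proof (rule bcontfun_normI)
    show "continuous_on UNIV (\<Phi> y)"
      unfolding \<Phi>_def
      by (intro continuous_intros continuous_on_compose2[OF P_cont[OF y]] continuous_on_compose2[OF W_cont])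
         (use W_pos in \<open>auto simp: less_imp_neq[symmetric]\<close>)
    fix t
    define s where "s = max t t0"
    \<comment> \<open>The weight dominates this affine function, which absorbs the linear growth of
      \<open>P y\<close>; the quotient is therefore bounded.\<close>
    have "1 + 2 * L * (s - t0) \<le> W s"
      unfolding W_def by (rule exp_ge_add_one_self)
    have "\<bar>z0 + P y s\<bar> \<le> \<bar>z0\<bar> + B * (s - t0)"
      using P_bd[OF y, of s] by (auto simp: s_def)
    also have "\<dots> \<le> (\<bar>z0\<bar> + B / (2 * L)) * (1 + 2 * L * (s - t0))"
    proof -
      have "0 \<le> 2 * L * (s - t0) * \<bar>z0\<bar>"
        using L by (intro mult_nonneg_nonneg) (auto simp: s_def)
      moreover have "B / (2 * L) * (2 * L * (s - t0)) = B * (s - t0)"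
        using L by simp
      moreover have "0 \<le> B / (2 * L)"
        using L B by simp
      ultimately show ?thesis
        by (simp only: distrib_left distrib_right mult_1_right mult.commute)
    qed
    also have "\<dots> \<le> (\<bar>z0\<bar> + B / (2 * L)) * W s"
      using \<open>1 + 2 * L * (s - t0) \<le> W s\<close> L B by (intro mult_left_mono) auto
    finally show "norm (\<Phi> y t) \<le> \<bar>z0\<bar> + B / (2 * L)"
      using W_pos[of s] by (simp add: \<Phi>_def s_def[symmetric] field_simps)
  qed
  have P_lip: "P y t - P x t \<le> dist y x / 2 * W t" if "t0 \<le> t" for x y :: "real \<Rightarrow>\<^sub>C real" and t
  proof -
    \<comment> \<open>The weight grows at rate \<open>2 * L\<close>, the integrand at most at rate
      \<open>L\<close>; their quotient is the contraction factor 1/2.\<close>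
    define E where "E t = dist y x / 2 * W t - (P y t - P x t)" for t
    have "E t0 \<le> E t"
    proof (rule DERIV_nonneg_imp_nondecreasing[OF that])
      fix r
      have "h y r - h x r \<le> L * \<bar>W r * y r - W r * x r\<bar>"
        unfolding h_def using lip[of r "W r * y r" "W r * x r"] by linarith
      also have "\<bar>W r * y r - W r * x r\<bar> = W r * dist (y r) (x r)"
        using W_pos[of r] by (simp add: dist_real_def abs_mult flip: right_diff_distrib)
      also have "\<dots> \<le> W r * dist y x"
        using W_pos[of r] dist_bounded[of y r x] by (intro mult_left_mono) auto
      finally have "h y r - h x r \<le> L * (W r * dist y x)"
        using L by simp
      moreover have "(E has_real_derivative dist y x / 2 * (2 * L * W r) - (h y r - h x r)) (at r)"
        unfolding E_def by (intro DERIV_diff DERIV_cmult W_deriv P_deriv continuous_on_apply_bcontfun)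
      ultimately show "\<exists>d. (E has_real_derivative d) (at r) \<and> 0 \<le> d"
        by (intro exI conjI) (assumption, simp add: algebra_simps)
    qed
    moreover have "0 \<le> E t0"
      by (auto simp: E_def P0 W_def)
    ultimately show ?thesis
      by (simp add: E_def)
  qed
  define T :: "(real \<Rightarrow>\<^sub>C real) \<Rightarrow> (real \<Rightarrow>\<^sub>C real)" where "T y = Bcontfun (\<Phi> y)" for y
  have T: "apply_bcontfun (T y) = \<Phi> y" for y
    unfolding T_def by (rule Bcontfun_inverse[OF \<Phi>_mem]) simp
  have "\<exists>!y. T y = y"
  proof (rule banach_fix_type[of "1/2"], safe)
    fix x y :: "real \<Rightarrow>\<^sub>C real"
    show "dist (T x) (T y) \<le> 1 / 2 * dist x y"
    proof (rule dist_bound)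
      fix t
      define s where "s = max t t0"
      have "\<bar>P x s - P y s\<bar> \<le> dist x y / 2 * W s"
        using P_lip[of s x y] P_lip[of s y x] unfolding dist_commute[of y x]
        by (intro abs_leI) (simp_all add: s_def)
      then have "\<bar>(P x s - P y s) / W s\<bar> \<le> dist x y / 2"
        using W_pos[of s] by (simp add: field_simps)
      then show "dist (T x t) (T y t) \<le> 1 / 2 * dist x y"
        by (simp add: T \<Phi>_def s_def[symmetric] dist_real_def diff_divide_distrib[symmetric])
    qed
  qed auto
  then obtain y where "T y = y"
    by auto
  then have y: "y t = \<Phi> y t" for t
    using T[of y] by simp
  show thesis
  proof (rule that[of "\<lambda>t. z0 + P y t"])
    fix t assume "t0 \<le> t"
    then have "W t * y t = z0 + P y t"
      using y[of t] W_pos[of t] by (simp add: \<Phi>_def max_absorb1)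
    moreover have "((\<lambda>t. z0 + P y t) has_real_derivative h y t) (at t)"
      by (auto intro!: derivative_eq_intros P_deriv)
    ultimately show "((\<lambda>t. z0 + P y t) has_real_derivative F t (z0 + P y t)) (at t)"
      by (simp add: h_def)
  qed (simp add: P0)
qed

text \<open>Since \<open>u\<close> satisfies only an integral inequality, the gap
  \<open>d = u - z\<close> has no derivative to estimate. Gronwall's argument is applied to its
  primitive \<open>m\<close> instead, where \<open>m' = d \<le> L * m\<close>. Starting at the last
  time with \<open>d \<le> 0\<close> makes the gap positive afterwards, so the Lipschitz bound holds
  without absolute values.\<close>

lemma integral_subsolution_le:
  fixes F :: "real \<Rightarrow> real \<Rightarrow> real"
  assumes cont: "\<And>w. continuous_on UNIV w \<Longrightarrow> continuous_on UNIV (\<lambda>t. F t (w t))"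
    and lip: "\<And>t x y. \<bar>F t x - F t y\<bar> \<le> L * \<bar>x - y\<bar>"
    and z: "\<And>t. t0 \<le> t \<Longrightarrow> (z has_real_derivative F t (z t)) (at t)"
    and u_cont: "continuous_on UNIV u"
    and u: "\<And>s t. t0 \<le> s \<Longrightarrow> s \<le> t \<Longrightarrow> u t - u s \<le> integral {s..t} (\<lambda>x. F x (u x))"
    and init: "u t0 \<le> z t0" and t1: "t0 \<le> t1"
  shows "u t1 \<le> z t1"
proof (rule ccontr)
  assume "\<not> u t1 \<le> z t1"
  define d where "d t = u t - z (max t t0)" for t
  have z_cont: "continuous_on {t0..} z"
    by (intro continuous_at_imp_continuous_on) (use z DERIV_isCont in auto)
  have d_cont: "continuous_on UNIV d"
    unfolding d_def
    by (intro continuous_intros u_cont continuous_on_compose2[OF z_cont]) auto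
  obtain s where s: "t0 \<le> s" "s < t1" "d s \<le> 0" "\<And>x. s < x \<Longrightarrow> x \<le> t1 \<Longrightarrow> 0 < d x"
  proof (rule last_exit[of t0 t1 d 0])
    show "continuous_on {t0..t1} d"
      by (rule continuous_on_subset[OF d_cont]) auto
  qed (use init t1 \<open>\<not> u t1 \<le> z t1\<close> in \<open>auto simp: d_def max_absorb1\<close>)
  define m where "m = primitive s d"
  have m_deriv: "(m has_real_derivative d t) (at t)" for t
    unfolding m_def by (intro DERIV_primitive d_cont)
  have le: "d t \<le> L * m t" if t: "s \<le> t" "t \<le> t1" for t
  proof -
    have F_int: "(\<lambda>x. F x (u x)) integrable_on {s..t}"
      by (intro integrable_on_of_continuous_UNIV cont u_cont)
    have d_int: "d integrable_on {s..t}"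
      by (intro integrable_on_of_continuous_UNIV d_cont)
    have Fz: "((\<lambda>x. F x (z x)) has_integral z t - z s) {s..t}"
      using s t by (intro integral_DERIV z) auto
    have "d t - d s \<le> integral {s..t} (\<lambda>x. F x (u x)) - (z t - z s)"
      using u[of s t] s t by (simp add: d_def max_absorb1)
    also have "\<dots> = integral {s..t} (\<lambda>x. F x (u x) - F x (z x))"
      using integral_diff[OF F_int has_integral_integrable[OF Fz]] integral_unique[OF Fz] by simp
    also have "\<dots> \<le> integral {s..t} (\<lambda>x. L * d x)"
    proof (rule integral_le)
      show "(\<lambda>x. F x (u x) - F x (z x)) integrable_on {s..t}"
        using integrable_diff[OF F_int has_integral_integrable[OF Fz]] .
      show "(\<lambda>x. L * d x) integrable_on {s..t}"
        using integrable_on_cmult_left[OF d_int, of L] by simp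
      fix x assume x: "x \<in> {s..t}"
      show "F x (u x) - F x (z x) \<le> L * d x"
      proof (cases "x = s")
        case True
        \<comment> \<open>At the left end point the gap vanishes: it is nonpositive by the choice of
          \<open>s\<close> and a limit of positive values from the right.\<close>
        have "d s \<ge> 0"
        proof (rule tendsto_lowerbound)
          have "isCont d s"
            using d_cont by (simp add: continuous_on_eq_continuous_at)
          then show "(d \<longlongrightarrow> d s) (at_right s)"
            by (auto simp: isCont_def intro: filterlim_mono at_within_le_at)
          show "\<forall>\<^sub>F x in at_right s. 0 \<le> d x"
            using s by (intro eventually_at_rightI[of s t1]) (auto intro: less_imp_le)
        qed auto
        with True s have "u x = z x"
          by (auto simp: d_def max_absorb1)
        with True s show ?thesis
          by (auto simp: d_def max_absorb1)
      next
        case False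
        with x s t have "0 < d x" "d x = u x - z x"
          by (auto simp: d_def max_absorb1 intro!: s(4))
        with lip[of x "u x" "z x"] show ?thesis
          by auto
      qed
    qed
    also have "\<dots> = L * m t"
      using t by (cases "s = t") (auto simp: m_def primitive_def)
    finally show ?thesis
      using s(3) by simp
  qed
  \<comment> \<open>The integrating factor makes \<open>e\<close> nonincreasing from the value 0, so
    \<open>m\<close> and then \<open>d\<close> are nonpositive at \<open>t1\<close>.\<close>
  define e where "e t = exp (- L * t) * m t" for t
  have "e t1 \<le> e s"
  proof (rule DERIV_nonpos_imp_nonincreasing[of s t1])
    fix t assume t: "s \<le> t" "t \<le> t1"
    have "(e has_real_derivative exp (- L * t) * (d t - L * m t)) (at t)"
      unfolding e_def by (auto intro!: derivative_eq_intros m_deriv simp: algebra_simps)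
    moreover have "exp (- L * t) * (d t - L * m t) \<le> 0"
      using le[OF t] by (simp add: mult_le_0_iff)
    ultimately show "\<exists>y. (e has_real_derivative y) (at t) \<and> y \<le> 0"
      by blast
  qed (use s in auto)
  moreover have "e s = 0"
    by (simp add: e_def m_def)
  ultimately have "exp (- L * t1) * m t1 \<le> 0"
    by (simp add: e_def)
  then have "m t1 \<le> 0"
    by (metis exp_gt_zero mult_pos_pos not_less)
  moreover have "0 \<le> L"
  proof -
    have "0 \<le> L * \<bar>1 - 0\<bar>"
      using lip[of 0 1 0] abs_ge_zero order_trans by blast
    then show ?thesis
      by simp
  qed
  ultimately have "d t1 \<le> 0"
    using le[of t1] s mult_nonneg_nonpos[of L "m t1"] by linarith
  with s show False
    by force
qed

subsection \<open>The Riccati equation with a continuous potential\<close>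

definition riccati_solution :: "(real \<Rightarrow> real) \<Rightarrow> real \<Rightarrow> (real \<Rightarrow> real) \<Rightarrow> bool" where
  "riccati_solution G l z \<longleftrightarrow> (\<forall>t. (z has_real_derivative l - (z t - G t)\<^sup>2) (at t))"

definition riccati_bounded_solution :: "(real \<Rightarrow> real) \<Rightarrow> real \<Rightarrow> (real \<Rightarrow> real) \<Rightarrow> bool" where
  "riccati_bounded_solution G l z \<longleftrightarrow>
     riccati_solution G l z \<and> bounded (range (\<lambda>t. z t - G t))"

text \<open>The integral form admits functions such as \<open>z - H\<close> with \<open>H\<close> a
  difference of primitives of \<open>L^\<infinity>\<close> functions, which may fail to be
  differentiable on a null set.\<close>

definition riccati_subsolution :: "(real \<Rightarrow> real) \<Rightarrow> real \<Rightarrow> (real \<Rightarrow> real) \<Rightarrow> bool" where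
  "riccati_subsolution G l u \<longleftrightarrow> continuous_on UNIV u \<and>
     (\<forall>s t. s \<le> t \<longrightarrow> u t - u s \<le> integral {s..t} (\<lambda>x. l - (u x - G x)\<^sup>2))"

text \<open>The additive 1 accounts for \<Gamma>, which is bounded but may change arbitrarily fast;
  the term linear in time accounts for the primitive of the forcing.\<close>

definition coarse_lipschitz :: "real \<Rightarrow> (real \<Rightarrow> real) \<Rightarrow> bool" where
  "coarse_lipschitz K G \<longleftrightarrow> 0 \<le> K \<and> continuous_on UNIV G \<and>
     (\<forall>s t. \<bar>G t - G s\<bar> \<le> K * (1 + \<bar>t - s\<bar>))"

lemma coarse_lipschitzD:
  "coarse_lipschitz K G \<Longrightarrow> \<bar>G t - G s\<bar> \<le> K * (1 + \<bar>t - s\<bar>)"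
  by (simp add: coarse_lipschitz_def)

lemma coarse_lipschitz_reflect:
  assumes "coarse_lipschitz K G"
  shows "coarse_lipschitz K (\<lambda>t. - G (- t))"
proof -
  have "\<bar>- G (- t) - - G (- s)\<bar> \<le> K * (1 + \<bar>t - s\<bar>)" for s t
    using coarse_lipschitzD[OF assms, of "- t" "- s"] by (simp add: abs_minus_commute)
  moreover have "continuous_on UNIV (\<lambda>t. - G (- t))"
    using assms unfolding coarse_lipschitz_def
    by (auto intro!: continuous_intros intro: continuous_on_compose2[of UNIV G])
  ultimately show ?thesis
    using assms by (auto simp: coarse_lipschitz_def)
qed

lemma riccati_solution_continuous:
  "riccati_solution G l z \<Longrightarrow> continuous_on S z"
  unfolding riccati_solution_def by (meson DERIV_isCont continuous_at_imp_continuous_on)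

text \<open>Reversing time and sign preserves the equation and exchanges upper with lower bounds,
  maximal with minimal solutions and attraction with repulsion, so only one of each pair has to be
  treated.\<close>

lemma riccati_bounded_solution_reflect:
  "riccati_bounded_solution G l z \<Longrightarrow>
     riccati_bounded_solution (\<lambda>t. - G (- t)) l (\<lambda>t. - z (- t))"
proof -
  assume z: "riccati_bounded_solution G l z"
  have "((\<lambda>t. - z (- t)) has_real_derivative l - (- z (- t) - - G (- t))\<^sup>2) (at t)" for t
  proof -
    have "(z has_real_derivative l - (z (- t) - G (- t))\<^sup>2) (at (- t))"
      using z by (auto simp: riccati_bounded_solution_def riccati_solution_def)
    from DERIV_minus[OF DERIV_chain2[OF this DERIV_minus[OF DERIV_ident]]] show ?thesis
      by (simp add: power2_commute)
  qed
  moreover have "bounded (range (\<lambda>t. - z (- t) - - G (- t)))"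
  proof -
    obtain C where C: "\<And>t. \<bar>z t - G t\<bar> \<le> C"
      using z by (auto simp: riccati_bounded_solution_def bounded_iff)
    then have "\<bar>- z (- t) - - G (- t)\<bar> \<le> C" for t
      using C[of "- t"] by (simp add: abs_minus_commute)
    then show ?thesis
      by (auto simp: bounded_iff)
  qed
  ultimately show ?thesis
    by (auto simp: riccati_bounded_solution_def riccati_solution_def)
qed

lemma riccati_solution_imp_subsolution:
  assumes "riccati_solution G l z" "l \<le> l'" "continuous_on UNIV G"
  shows "riccati_subsolution G l' z"
  unfolding riccati_subsolution_def
proof safe
  show z: "continuous_on UNIV z"
    using riccati_solution_continuous assms(1) .
  fix s t :: real assume "s \<le> t"
  then have int: "((\<lambda>x. l - (z x - G x)\<^sup>2) has_integral z t - z s) {s..t}"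
    using assms by (intro integral_DERIV) (auto simp: riccati_solution_def)
  have "integral {s..t} (\<lambda>x. l - (z x - G x)\<^sup>2) \<le> integral {s..t} (\<lambda>x. l' - (z x - G x)\<^sup>2)"
    using assms
    by (intro integral_le integrable_on_of_continuous_UNIV continuous_intros z) auto
  with integral_unique[OF int] show "z t - z s \<le> integral {s..t} (\<lambda>x. l' - (z x - G x)\<^sup>2)"
    by simp
qed

section \<open>A priori bounds for bounded solutions\<close>

text \<open>After the last time at level \<open>M\<close>, \<open>z\<close> falls at rate at least
  \<open>K\<close>, while \<open>G\<close> can fall by at most \<open>K * (1 + (t - s))\<close>. The
  linear parts cancel and an overshoot of one \<open>K\<close> remains.\<close>

lemma steep_descent_bound:
  assumes G: "coarse_lipschitz K G"
    and z: "\<And>t. a \<le> t \<Longrightarrow> (z has_real_derivative D t) (at t)"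
    and D: "\<And>t. a \<le> t \<Longrightarrow> M \<le> z t - G t \<Longrightarrow> D t \<le> - K"
    and init: "z a - G a \<le> M" and "a \<le> t"
  shows "z t - G t \<le> M + K"
proof (rule ccontr)
  assume "\<not> z t - G t \<le> M + K"
  have K: "0 \<le> K"
    using G by (simp add: coarse_lipschitz_def)
  have "continuous_on {a..t} (\<lambda>x. z x - G x)"
    using G by (intro continuous_intros continuous_at_imp_continuous_on)
      (auto intro: DERIV_isCont[OF z] simp: coarse_lipschitz_def continuous_on_eq_continuous_at)
  then obtain s where s: "a \<le> s" "s < t" "z s - G s \<le> M"
    "\<And>x. s < x \<Longrightarrow> x \<le> t \<Longrightarrow> M < z x - G x"
    by (rule last_exit[where c = M]) (use init \<open>\<not> z t - G t \<le> M + K\<close> K \<open>a \<le> t\<close> in auto)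
  have "z t + K * t \<le> z s + K * s"
  proof (rule DERIV_nonpos_imp_decreasing_open[of s t "\<lambda>x. z x + K * x"])
    show "\<exists>y. ((\<lambda>x. z x + K * x) has_real_derivative y) (at x) \<and> y \<le> 0" if "s < x" "x < t" for x
    proof (intro exI conjI)
      show "((\<lambda>x. z x + K * x) has_real_derivative D x + K * 1) (at x)"
        using s that by (intro DERIV_add DERIV_cmult DERIV_ident z) auto
      show "D x + K * 1 \<le> 0"
        using D[of x] s(4)[of x] s(1) that by auto
    qed
    show "continuous_on {s..t} (\<lambda>x. z x + K * x)"
      using s by (intro continuous_intros continuous_at_imp_continuous_on) (auto intro: DERIV_isCont[OF z])
  qed (use s in auto)
  moreover have "\<bar>G t - G s\<bar> \<le> K * (1 + (t - s))"
    using coarse_lipschitzD[OF G, of t s] s by simp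
  ultimately show False
    using s \<open>\<not> z t - G t \<le> M + K\<close> by (auto simp: algebra_simps)
qed

text \<open>Beyond height 1 the square dominates \<open>y\<close> itself, so this height already
  outweighs \<open>l\<close> and the drift \<open>K\<close>. The spare 1 makes \<open>z\<close>
  descend strictly faster than \<open>G\<close> can.\<close>

lemma square_drift:
  fixes y :: real
  assumes "0 \<le> K" "\<bar>l\<bar> + K + 1 \<le> y"
  shows "l - y\<^sup>2 \<le> - (K + 1)"
proof -
  have "1 * y \<le> y * y"
    using assms by (intro mult_right_mono) auto
  then show ?thesis
    using assms by (simp add: power2_eq_square)
qed

text \<open>Going back in time, a solution that had always been above \<open>M\<close> would come
  from arbitrarily high values, because \<open>z - G\<close> loses at least one unit per unit of
  time up to a constant. So it was once below \<open>M\<close>, and the barrier keeps it below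
  \<open>M + K\<close>. The bound depends on \<open>l\<close> and \<open>K\<close> only, not on the
  solution.\<close>

lemma riccati_bounded_solution_upper_bound:
  assumes G: "coarse_lipschitz K G" and z: "riccati_bounded_solution G l z"
  shows "z t - G t \<le> \<bar>l\<bar> + 2 * K + 1"
proof -
  define M where "M = \<bar>l\<bar> + K + 1"
  have K: "0 \<le> K"
    using G by (simp add: coarse_lipschitz_def)
  have deriv: "(z has_real_derivative l - (z x - G x)\<^sup>2) (at x)" for x
    using z by (auto simp: riccati_bounded_solution_def riccati_solution_def)
  obtain C where C: "\<And>t. \<bar>z t - G t\<bar> \<le> C"
    using z by (auto simp: riccati_bounded_solution_def bounded_iff)
  have "\<exists>a\<le>t. z a - G a \<le> M"
  proof (rule ccontr)
    assume "\<not> (\<exists>a\<le>t. z a - G a \<le> M)"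
    then have M: "M < z a - G a" if "a \<le> t" for a
      using that by force
    \<comment> \<open>Over this time the net descent exceeds the largest possible change
      \<open>2 * C\<close> by one, even after the slack \<open>K\<close>.\<close>
    define a where "a = t - (2 * C + K + 1)"
    have "0 \<le> C"
      using C[of 0] by linarith
    then have "a \<le> t"
      using K by (simp add: a_def)
    have "z t + (K + 1) * t \<le> z a + (K + 1) * a"
    proof (rule DERIV_nonpos_imp_nonincreasing[OF \<open>a \<le> t\<close>, of "\<lambda>x. z x + (K + 1) * x"])
      fix x assume "x \<le> t"
      have "((\<lambda>x. z x + (K + 1) * x) has_real_derivative l - (z x - G x)\<^sup>2 + (K + 1) * 1) (at x)"
        by (intro DERIV_add DERIV_cmult DERIV_ident deriv)
      moreover have "l - (z x - G x)\<^sup>2 + (K + 1) * 1 \<le> 0"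
        using square_drift[OF K, of l "z x - G x"] M[OF \<open>x \<le> t\<close>] by (simp add: M_def)
      ultimately show "\<exists>y. ((\<lambda>x. z x + (K + 1) * x) has_real_derivative y) (at x) \<and> y \<le> 0"
        by blast
    qed
    moreover have "\<bar>G t - G a\<bar> \<le> K * (1 + (t - a))"
      using coarse_lipschitzD[OF G, of t a] \<open>a \<le> t\<close> by simp
    ultimately have "z t - G t \<le> z a - G a + K - (t - a)"
      by (simp add: algebra_simps abs_le_iff)
    then show False
      using C[of t] C[of a] by (simp add: a_def)
  qed
  then obtain a where a: "a \<le> t" "z a - G a \<le> M"
    by auto
  have "z t - G t \<le> M + K"
  proof (rule steep_descent_bound[OF G deriv _ a(2,1)])
    show "l - (z x - G x)\<^sup>2 \<le> - K" if "M \<le> z x - G x" for x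
      using square_drift[OF K, of l "z x - G x"] that by (simp add: M_def)
  qed
  then show ?thesis
    by (simp add: M_def)
qed

lemma riccati_bounded_solution_bound:
  assumes G: "coarse_lipschitz K G" and z: "riccati_bounded_solution G l z"
  shows "\<bar>z t - G t\<bar> \<le> \<bar>l\<bar> + 2 * K + 1"
  using riccati_bounded_solution_upper_bound[OF G z, of t]
    riccati_bounded_solution_upper_bound[OF coarse_lipschitz_reflect[OF G]
      riccati_bounded_solution_reflect[OF z], of "- t"]
  by (simp add: abs_le_iff)

section \<open>Construction of bounded solutions: truncation, compactness, maximality\<close>

definition clamp_real :: "real \<Rightarrow> real \<Rightarrow> real" where
  "clamp_real R v = max (- R) (min R v)"

lemma clamp_real_eq: "\<bar>v\<bar> \<le> R \<Longrightarrow> clamp_real R v = v"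
  by (auto simp: clamp_real_def)

lemma clamp_real_lipschitz: "\<bar>clamp_real R v - clamp_real R w\<bar> \<le> \<bar>v - w\<bar>"
  by (auto simp: clamp_real_def max_def min_def)

lemma abs_clamp_real_le: "0 \<le> R \<Longrightarrow> \<bar>clamp_real R v\<bar> \<le> R"
  by (auto simp: clamp_real_def)

text \<open>Truncating the square makes the equation bounded and globally Lipschitz. The truncation
  never acts on the solution obtained: steep descent bounds it above, and the subsolution
  \<open>u\<close> bounds it below, preventing escape to minus infinity in finite time.\<close>

lemma riccati_forward_solution_above:
  assumes G: "coarse_lipschitz K G"
    and u: "riccati_subsolution G l u" and u_bd: "\<And>t. \<bar>u t - G t\<bar> \<le> R"
    and R: "\<bar>l\<bar> + K + 1 \<le> R"
  obtains z where "\<And>t. a \<le> t \<Longrightarrow> (z has_real_derivative l - (z t - G t)\<^sup>2) (at t)"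
    and "\<And>t. a \<le> t \<Longrightarrow> \<bar>z t - G t\<bar> \<le> R + K"
    and "\<And>v t. riccati_subsolution G l v \<Longrightarrow> (\<And>t. \<bar>v t - G t\<bar> \<le> R) \<Longrightarrow> a \<le> t \<Longrightarrow> v t \<le> z t"
proof -
  define N where "N = R + K"
  have K: "0 \<le> K" and G_cont: "continuous_on UNIV G"
    using G by (auto simp: coarse_lipschitz_def)
  have N: "0 < N" "R \<le> N"
    using K R by (auto simp: N_def)
  define F where "F t x = l - (clamp_real N (x - G t))\<^sup>2" for t x
  have F_eq: "F t x = l - (x - G t)\<^sup>2" if "\<bar>x - G t\<bar> \<le> N" for t x
    by (simp add: F_def clamp_real_eq that)
  have F_cont: "continuous_on UNIV (\<lambda>t. F t (w t))" if "continuous_on UNIV w" for w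
    unfolding F_def clamp_real_def by (intro continuous_intros that G_cont)
  have F_bd: "\<bar>F t x\<bar> \<le> \<bar>l\<bar> + N\<^sup>2" for t x
  proof -
    have "(clamp_real N (x - G t))\<^sup>2 \<le> N\<^sup>2"
      using abs_clamp_real_le[of N "x - G t"] N by (simp add: abs_le_square_iff[symmetric])
    then show ?thesis
      using zero_le_power2[of "clamp_real N (x - G t)"] unfolding F_def by linarith
  qed
  have F_lip: "\<bar>F t x - F t y\<bar> \<le> (2 * N) * \<bar>x - y\<bar>" for t x y
  proof -
    define p q where "p = clamp_real N (x - G t)" and "q = clamp_real N (y - G t)"
    have "\<bar>F t x - F t y\<bar> = \<bar>p + q\<bar> * \<bar>p - q\<bar>"
      by (simp add: F_def p_def[symmetric] q_def[symmetric] power2_eq_square abs_minus_commute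
          flip: abs_mult) (simp add: algebra_simps)
    also have "\<dots> \<le> (2 * N) * \<bar>x - y\<bar>"
    proof (rule mult_mono)
      show "\<bar>p + q\<bar> \<le> 2 * N"
        using abs_clamp_real_le[of N "x - G t"] abs_clamp_real_le[of N "y - G t"] N
        by (auto simp: p_def q_def)
      show "\<bar>p - q\<bar> \<le> \<bar>x - y\<bar>"
        using clamp_real_lipschitz[of N "x - G t" "y - G t"] by (simp add: p_def q_def)
    qed (use N in auto)
    finally show ?thesis .
  qed
  \<comment> \<open>Height \<open>R\<close> above \<open>G\<close> is at least the initial value of
    every admissible subsolution and still lies on the barrier.\<close>
  obtain z where z0: "z a = G a + R" and z: "\<And>t. a \<le> t \<Longrightarrow> (z has_real_derivative F t (z t)) (at t)"
    using forward_ode_solution_exists[OF F_cont F_lip _ F_bd, of a "G a + R"] N by auto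
  have above: "v t \<le> z t"
    if v: "riccati_subsolution G l v" and v_bd: "\<And>t. \<bar>v t - G t\<bar> \<le> R" and "a \<le> t" for v t
  proof (rule integral_subsolution_le[OF F_cont F_lip z])
    show "continuous_on UNIV v" "v a \<le> z a"
      using v v_bd[of a] z0 by (auto simp: riccati_subsolution_def)
    show "v t - v s \<le> integral {s..t} (\<lambda>x. F x (v x))" if "s \<le> t" for s t
      using v that F_eq[OF order_trans[OF v_bd N(2)]] by (simp add: riccati_subsolution_def)
  qed (use that in auto)
  have upper: "z t - G t \<le> R + K" if "a \<le> t" for t
  proof (rule steep_descent_bound[OF G z _ _ that])
    fix t assume "R \<le> z t - G t"
    have "R \<le> clamp_real N (z t - G t)"
      using \<open>R \<le> z t - G t\<close> N by (auto simp: clamp_real_def)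
    then show "F t (z t) \<le> - K"
      using square_drift[OF K, of l "clamp_real N (z t - G t)"] R by (simp add: F_def)
  qed (use z0 in auto)
  have bd: "\<bar>z t - G t\<bar> \<le> R + K" if "a \<le> t" for t
    using upper[OF that] above[OF u u_bd that] u_bd[of t] K by (auto simp: abs_le_iff)
  show thesis
    using z bd above by (intro that[of z]) (auto simp: F_eq N_def[symmetric])
qed

text \<open>Two limits are served at once: solutions launched at times \<open>- n\<close> for a
  fixed potential, and bounded solutions for varying potentials or parameters. No equicontinuity of
  the \<open>G n\<close> is required, since the bound on \<open>z n - G n\<close> alone makes the
  \<open>z n\<close> uniformly Lipschitz.\<close>

lemma riccati_compactness:
  assumes G: "\<And>t. (\<lambda>n. G n t) \<longlonglongrightarrow> H t" and H_cont: "continuous_on UNIV H"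
    and l: "l \<longlonglongrightarrow> m"
    and z: "\<And>n t. - real n \<le> t \<Longrightarrow> (z n has_real_derivative l n - (z n t - G n t)\<^sup>2) (at t)"
    and bd: "\<And>n t. - real n \<le> t \<Longrightarrow> \<bar>z n t - G n t\<bar> \<le> R"
  obtains k w where "strict_mono k" "\<And>t. (\<lambda>n. z (k n) t) \<longlonglongrightarrow> w t"
    "riccati_bounded_solution H m w"
proof -
  have R: "0 \<le> R"
    using bd[of 0 0] by simp
  \<comment> \<open>The subsequence is extracted from \<open>z n - G n\<close>, which has the bound
    \<open>R\<close> at every point; the default 0 before \<open>- n\<close> preserves that
    bound.\<close>
  define y where "y n t = (if - real n \<le> t then z n t - G n t else 0)" for n t
  obtain k where k: "strict_mono k" and y_conv: "\<And>x. x \<in> \<rat> \<Longrightarrow> \<exists>l. (\<lambda>n. y (k n) x) \<longlonglongrightarrow> l"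
  proof (rule function_convergent_subsequence[of \<rat> y R])
    show "norm (y n x) \<le> R" for n x
      using bd R by (auto simp: y_def)
  qed (use countable_rat in auto)
  have late: "\<forall>\<^sub>F n in sequentially. - real (k n) \<le> t" for t
  proof -
    have "\<forall>\<^sub>F n in sequentially. n \<ge> nat \<lceil>- t\<rceil>"
      by (rule eventually_ge_at_top)
    then show ?thesis
    proof eventually_elim
      case (elim n)
      have "n \<le> k n"
        using k by (rule strict_mono_imp_increasing)
      with elim show ?case
        by linarith
    qed
  qed
  have z_conv_rat: "\<exists>l. (\<lambda>n. z (k n) x) \<longlonglongrightarrow> l" if x: "x \<in> \<rat>" for x
  proof -
    obtain c where "(\<lambda>n. y (k n) x) \<longlonglongrightarrow> c"
      using y_conv[OF x] by auto
    moreover have "(\<lambda>n. G (k n) x) \<longlonglongrightarrow> H x"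
      using LIMSEQ_subseq_LIMSEQ[OF G k, of x] by (simp add: comp_def)
    ultimately have "(\<lambda>n. y (k n) x + G (k n) x) \<longlonglongrightarrow> c + H x"
      by (rule tendsto_add)
    moreover have "\<forall>\<^sub>F n in sequentially. y (k n) x + G (k n) x = z (k n) x"
      using late[of x] by eventually_elim (auto simp: y_def)
    ultimately have "(\<lambda>n. z (k n) x) \<longlonglongrightarrow> c + H x"
      by (rule Lim_transform_eventually)
    then show ?thesis ..
  qed
  obtain \<Lambda> where \<Lambda>: "\<And>n. \<bar>l n\<bar> \<le> \<Lambda>"
    using convergent_imp_Bseq[of l] l unfolding convergent_def Bseq_def by auto
  define C where "C = \<Lambda> + R\<^sup>2"
  have C: "0 \<le> C"
    using \<Lambda>[of 0] by (auto simp: C_def)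
  have rhs_bd: "\<bar>l n - (z n t - G n t)\<^sup>2\<bar> \<le> C" if "- real n \<le> t" for n t
  proof -
    have "(z n t - G n t)\<^sup>2 \<le> R\<^sup>2"
      using bd[OF that] R by (simp add: abs_le_square_iff[symmetric])
    then show ?thesis
      using \<Lambda>[of n] zero_le_power2[of "z n t - G n t"] unfolding C_def by linarith
  qed
  have z_int: "((\<lambda>x. l n - (z n x - G n x)\<^sup>2) has_integral z n t - z n s) {s..t}"
    if "- real n \<le> s" "s \<le> t" for n s t
    using that by (intro integral_DERIV z) auto
  have z_lip': "\<bar>z n t - z n s\<bar> \<le> C * (t - s)" if "- real n \<le> s" "s \<le> t" for n s t
  proof -
    have "norm (z n t - z n s) \<le> C * Henstock_Kurzweil_Integration.content {s..t}"
      using that by (intro has_integral_bound_real[OF C _ z_int, of "{}"]) (auto intro!: rhs_bd)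
    then show ?thesis
      using that by simp
  qed
  have z_lip: "\<bar>z n t - z n s\<bar> \<le> C * \<bar>t - s\<bar>" if "- real n \<le> s" "- real n \<le> t" for n s t
    using that z_lip'[of n s t] z_lip'[of n t s] by (cases "s \<le> t") (auto simp: abs_minus_commute)
  have "convergent (\<lambda>n. z (k n) t)" for t
  proof -
    have "Cauchy (\<lambda>n. z (k n) t)"
      unfolding Cauchy_def
    proof safe
      fix e :: real assume "0 < e"
      \<comment> \<open>The denominator uses \<open>C + 1\<close> so that \<open>C = 0\<close> is
        allowed; a rational point within \<open>d\<close> costs less than a third of
        \<open>e\<close> for each solution.\<close>
      define d where "d = e / (3 * (C + 1))"
      have d: "0 < d" "C * d < e / 3"
        using \<open>0 < e\<close> C by (auto simp: d_def field_simps)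
      obtain q where q: "q \<in> \<rat>" "t - d < q" "q < t + d"
        using Rats_dense_in_real[of "t - d" "t + d"] d by auto
      have "Cauchy (\<lambda>n. z (k n) q)"
        using z_conv_rat[OF q(1)] LIMSEQ_imp_Cauchy by blast
      then obtain M where M: "\<And>m n. M \<le> m \<Longrightarrow> M \<le> n \<Longrightarrow> dist (z (k m) q) (z (k n) q) < e / 3"
        using \<open>0 < e\<close> unfolding Cauchy_def by (meson zero_less_divide_iff zero_less_numeral)
      obtain M1 where M1: "\<And>n. M1 \<le> n \<Longrightarrow> - real (k n) \<le> min q t"
        using late[of "min q t"] by (auto simp: eventually_sequentially)
      have close: "\<bar>z (k n) t - z (k n) q\<bar> < e / 3" if "M1 \<le> n" for n
      proof -
        have "\<bar>z (k n) t - z (k n) q\<bar> \<le> C * \<bar>t - q\<bar>"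
          using M1[OF that] by (intro z_lip) auto
        also have "\<dots> \<le> C * d"
          using q C by (intro mult_left_mono) auto
        finally show ?thesis
          using d by simp
      qed
      show "\<exists>M. \<forall>m\<ge>M. \<forall>n\<ge>M. dist (z (k m) t) (z (k n) t) < e"
      proof (intro exI[of _ "max M M1"] allI impI)
        fix m n assume "max M M1 \<le> m" "max M M1 \<le> n"
        then have "\<bar>z (k m) q - z (k n) q\<bar> < e / 3"
          "\<bar>z (k m) t - z (k m) q\<bar> < e / 3" "\<bar>z (k n) t - z (k n) q\<bar> < e / 3"
          using M[of m n] close[of m] close[of n] by (auto simp: dist_real_def)
        then show "dist (z (k m) t) (z (k n) t) < e"
          unfolding dist_real_def by linarith
      qed
    qed
    then show ?thesis
      by (rule Cauchy_convergent)
  qed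
  then obtain w where w: "\<And>t. (\<lambda>n. z (k n) t) \<longlonglongrightarrow> w t"
    unfolding convergent_def by metis
  have G': "(\<lambda>n. G (k n) t) \<longlonglongrightarrow> H t" for t
    using LIMSEQ_subseq_LIMSEQ[OF G k, of t] by (simp add: comp_def)
  have l': "(\<lambda>n. l (k n)) \<longlonglongrightarrow> m"
    using LIMSEQ_subseq_LIMSEQ[OF l k] by (simp add: comp_def)
  have w_lip: "\<bar>w t - w s\<bar> \<le> C * \<bar>t - s\<bar>" for s t
  proof (rule tendsto_upperbound)
    show "(\<lambda>n. \<bar>z (k n) t - z (k n) s\<bar>) \<longlonglongrightarrow> \<bar>w t - w s\<bar>"
      by (intro tendsto_intros w)
    show "\<forall>\<^sub>F n in sequentially. \<bar>z (k n) t - z (k n) s\<bar> \<le> C * \<bar>t - s\<bar>"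
      using late[of s] late[of t] by eventually_elim (rule z_lip)
  qed simp
  have w_cont: "continuous_on UNIV w"
  proof -
    have "C-lipschitz_on UNIV w"
      using w_lip C by (intro lipschitz_onI) (auto simp: dist_real_def)
    then show ?thesis
      by (rule lipschitz_on_continuous_on)
  qed
  \<comment> \<open>Only the integrated equations pass to the limit, by dominated convergence with
    the common derivative bound \<open>C\<close>.\<close>
  have "w t - w s = integral {s..t} (\<lambda>x. m - (w x - H x)\<^sup>2)" if "s \<le> t" for s t
  proof -
    obtain M where M: "\<And>n. M \<le> n \<Longrightarrow> - real (k n) \<le> s"
      using late[of s] by (auto simp: eventually_sequentially)
    \<comment> \<open>Dropping the first \<open>M\<close> terms ensures that every remaining
      function solves its equation on all of \<open>{s..t}\<close>.\<close>
    have shift: "(\<lambda>n. f (k (n + M))) \<longlonglongrightarrow> c" if "(\<lambda>n. f (k n)) \<longlonglongrightarrow> c" for f :: "nat \<Rightarrow> real" and c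
      using LIMSEQ_ignore_initial_segment[OF that, of M] .
    define f where "f n x = l (k (n + M)) - (z (k (n + M)) x - G (k (n + M)) x)\<^sup>2" for n x
    have f_int: "(f n has_integral z (k (n + M)) t - z (k (n + M)) s) {s..t}" for n
      unfolding f_def using that by (intro z_int M) auto
    have "(\<lambda>n. integral {s..t} (f n)) \<longlonglongrightarrow> integral {s..t} (\<lambda>x. m - (w x - H x)\<^sup>2)"
    proof (rule dominated_convergence)
      show "f n integrable_on {s..t}" for n
        using f_int by auto
      show "(\<lambda>_. C) integrable_on {s..t}"
        by (rule integrable_const_ivl)
      show "norm (f n x) \<le> C" if "x \<in> {s..t}" for n x
        using rhs_bd[of "k (n + M)" x] M[of "n + M"] that by (auto simp: f_def)
      show "(\<lambda>n. f n x) \<longlonglongrightarrow> m - (w x - H x)\<^sup>2" for x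
        unfolding f_def by (rule shift[where f = "\<lambda>n. l n - (z n x - G n x)\<^sup>2"])
          (intro tendsto_intros w G' l')
    qed
    moreover have "integral {s..t} (f n) = z (k (n + M)) t - z (k (n + M)) s" for n
      using integral_unique[OF f_int] .
    moreover have "(\<lambda>n. z (k (n + M)) t - z (k (n + M)) s) \<longlonglongrightarrow> w t - w s"
      by (rule shift[where f = "\<lambda>n. z n t - z n s"]) (intro tendsto_intros w)
    ultimately show ?thesis
      using LIMSEQ_unique by force
  qed
  then have "riccati_solution H m w"
    unfolding riccati_solution_def
    by (intro allI DERIV_of_integral_eq continuous_intros w_cont H_cont) auto
  moreover have "\<bar>w t - H t\<bar> \<le> R" for t
  proof (rule tendsto_upperbound)
    show "(\<lambda>n. \<bar>z (k n) t - G (k n) t\<bar>) \<longlonglongrightarrow> \<bar>w t - H t\<bar>"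
      by (intro tendsto_intros w G')
    show "\<forall>\<^sub>F n in sequentially. \<bar>z (k n) t - G (k n) t\<bar> \<le> R"
      using late[of t] by eventually_elim (rule bd)
  qed simp
  then have "bounded (range (\<lambda>t. w t - H t))"
    by (auto simp: bounded_iff)
  ultimately show thesis
    using that[OF k w] by (auto simp: riccati_bounded_solution_def)
qed

text \<open>A pullback limit: forward solutions are launched at times \<open>- n\<close> from a
  height above all candidates, each dominates every subsolution within distance \<open>R\<close> of
  \<open>G\<close>, and the limit inherits this.\<close>

lemma maximal_riccati_bounded_solution:
  assumes G: "coarse_lipschitz K G"
    and u: "riccati_subsolution G l u" and u_bd: "\<And>t. \<bar>u t - G t\<bar> \<le> B"
  obtains a where "riccati_bounded_solution G l a" "\<And>t. u t \<le> a t"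
    "\<And>z t. riccati_bounded_solution G l z \<Longrightarrow> z t \<le> a t"
proof -
  \<comment> \<open>The second entry is the a priori bound, so every bounded solution is among the
    functions dominated.\<close>
  define R where "R = max B (\<bar>l\<bar> + 2 * K + 1)"
  have K: "0 \<le> K" and G_cont: "continuous_on UNIV G"
    using G by (auto simp: coarse_lipschitz_def)
  have R: "\<bar>l\<bar> + K + 1 \<le> R" "B \<le> R"
    using K by (auto simp: R_def)
  have "\<exists>z. (\<forall>t\<ge>- real n. (z has_real_derivative l - (z t - G t)\<^sup>2) (at t)) \<and>
      (\<forall>t\<ge>- real n. \<bar>z t - G t\<bar> \<le> R + K) \<and>
      (\<forall>v t. riccati_subsolution G l v \<longrightarrow> (\<forall>t. \<bar>v t - G t\<bar> \<le> R) \<longrightarrow> - real n \<le> t \<longrightarrow> v t \<le> z t)"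
    for n
    by (rule riccati_forward_solution_above[OF G u order_trans[OF u_bd R(2)] R(1), of "- real n"]) blast
  then obtain z where z: "\<And>n t. - real n \<le> t \<Longrightarrow> (z n has_real_derivative l - (z n t - G t)\<^sup>2) (at t)"
    and bd: "\<And>n t. - real n \<le> t \<Longrightarrow> \<bar>z n t - G t\<bar> \<le> R + K"
    and above: "\<And>n v t. riccati_subsolution G l v \<Longrightarrow> (\<And>t. \<bar>v t - G t\<bar> \<le> R) \<Longrightarrow> - real n \<le> t \<Longrightarrow> v t \<le> z n t"
    by metis
  obtain k a where k: "strict_mono k" and lim: "\<And>t. (\<lambda>n. z (k n) t) \<longlonglongrightarrow> a t"
    and a: "riccati_bounded_solution G l a"
    by (rule riccati_compactness[of "\<lambda>_. G" G "\<lambda>_. l" l z "R + K"]) (use z bd G_cont in auto)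
  have le: "v t \<le> a t" if v: "riccati_subsolution G l v" "\<And>t. \<bar>v t - G t\<bar> \<le> R" for v t
  proof (rule tendsto_lowerbound[OF lim])
    have "\<forall>\<^sub>F n in sequentially. n \<ge> nat \<lceil>- t\<rceil>"
      by (rule eventually_ge_at_top)
    then show "\<forall>\<^sub>F n in sequentially. v t \<le> z (k n) t"
    proof eventually_elim
      case (elim n)
      have "n \<le> k n"
        using k by (rule strict_mono_imp_increasing)
      with elim have "- real (k n) \<le> t"
        by linarith
      then show ?case
        by (rule above[OF v])
    qed
  qed simp
  show thesis
  proof (rule that[OF a])
    show "u t \<le> a t" for t
      by (rule le[OF u order_trans[OF u_bd R(2)]])
    show "z t \<le> a t" if z: "riccati_bounded_solution G l z" for z t
    proof (rule le)
      show "riccati_subsolution G l z"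
        using z G_cont by (auto simp: riccati_bounded_solution_def intro: riccati_solution_imp_subsolution)
      show "\<bar>z t - G t\<bar> \<le> R" for t
        using riccati_bounded_solution_bound[OF G z, of t] by (simp add: R_def)
    qed
  qed
qed

section \<open>Hyperbolicity of the extremal solutions\<close>

text \<open>
  The gap \<open>d = a - x\<close> satisfies \<open>d' / d = - 2 (a - G) + d + \<rho> / d\<close>, where
  \<open>d + \<rho> / d \<ge> 2 sqrt \<rho>\<close>, and \<open>d\<close> stays between positive constants.
\<close>

lemma riccati_attractor_hyperbolic:
  assumes \<rho>: "0 < \<rho>"
    and x: "riccati_bounded_solution G (l - \<rho>) x" and a: "riccati_bounded_solution G l a"
    and xa: "\<And>t. x t \<le> a t"
    and A: "\<And>t. (A has_real_derivative - 2 * (a t - G t)) (at t)"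
  obtains k where "1 \<le> k"
    "\<And>s t. s \<le> t \<Longrightarrow> exp (A t - A s) \<le> k * exp (- (2 * sqrt \<rho>) * (t - s))"
proof -
  define d where "d t = a t - x t" for t
  have d_nonneg: "0 \<le> d t" for t
    using xa by (simp add: d_def)
  have d_deriv: "(d has_real_derivative \<rho> - 2 * (a t - G t) * d t + (d t)\<^sup>2) (at t)" for t
  proof -
    have "(d has_real_derivative (l - (a t - G t)\<^sup>2) - (l - \<rho> - (x t - G t)\<^sup>2)) (at t)"
      unfolding d_def using a x
      by (intro DERIV_diff) (auto simp: riccati_bounded_solution_def riccati_solution_def)
    moreover have "(l - (a t - G t)\<^sup>2) - (l - \<rho> - (x t - G t)\<^sup>2) = \<rho> - 2 * (a t - G t) * d t + (d t)\<^sup>2"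
      by (simp add: d_def power2_eq_square algebra_simps)
    ultimately show ?thesis
      by metis
  qed
  obtain N where N: "\<And>t. \<bar>a t - G t\<bar> \<le> N"
    using a by (auto simp: riccati_bounded_solution_def bounded_iff)
  obtain N' where N': "\<And>t. \<bar>x t - G t\<bar> \<le> N'"
    using x by (auto simp: riccati_bounded_solution_def bounded_iff)
  define M where "M = 2 * N + 1"
  define D where "D = N + N'"
  define \<delta> where "\<delta> = \<rho> / M * (1 - exp (- M))"
  have M: "0 < M"
    using N[of 0] by (simp add: M_def)
  have D: "d t \<le> D" for t
    using N[of t] N'[of t] by (simp add: d_def D_def abs_le_iff)
  have \<delta>_pos: "0 < \<delta>"
    using M \<rho> by (simp add: \<delta>_def)
  have \<delta>: "\<delta> \<le> d t" for t
  proof -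
    define f where "f r = exp (M * r) * (d r - \<rho> / M)" for r
    have "f (t - 1) \<le> f t"
    proof (rule DERIV_nonneg_imp_nondecreasing[of "t - 1" t f])
      fix r
      have "(f has_real_derivative exp (M * r) * (M * d r - 2 * (a r - G r) * d r + (d r)\<^sup>2)) (at r)"
        unfolding f_def using M
        by (auto intro!: derivative_eq_intros d_deriv simp: algebra_simps)
      moreover have "0 \<le> exp (M * r) * (M * d r - 2 * (a r - G r) * d r + (d r)\<^sup>2)"
      proof -
        have "2 * (a r - G r) * d r \<le> M * d r"
          using N[of r] by (intro mult_right_mono d_nonneg) (simp add: M_def abs_le_iff)
        then have "0 \<le> M * d r - 2 * (a r - G r) * d r + (d r)\<^sup>2"
          using zero_le_power2[of "d r"] by linarith
        then show ?thesis
          by simp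
      qed
      ultimately show "\<exists>y. (f has_real_derivative y) (at r) \<and> 0 \<le> y"
        by blast
    qed simp
    moreover have "- (exp (M * (t - 1)) * (\<rho> / M)) \<le> f (t - 1)"
      using d_nonneg[of "t - 1"] by (simp add: f_def algebra_simps)
    moreover have "exp (M * t) * (- exp (- M) * (\<rho> / M)) = - (exp (M * (t - 1)) * (\<rho> / M))"
      by (simp add: right_diff_distrib exp_diff exp_minus field_simps)
    ultimately have "exp (M * t) * (- exp (- M) * (\<rho> / M)) \<le> exp (M * t) * (d t - \<rho> / M)"
      unfolding f_def by linarith
    then have "- exp (- M) * (\<rho> / M) \<le> d t - \<rho> / M"
      by (simp only: mult_le_cancel_left_pos exp_gt_zero)
    then show ?thesis
      by (simp add: \<delta>_def algebra_simps)
  qed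
  have d_pos: "0 < d t" for t
    using \<delta>_pos \<delta>[of t] by linarith
  show thesis
  proof (rule that[of "D / \<delta>"])
    show "1 \<le> D / \<delta>"
      using \<delta>[of 0] D[of 0] \<delta>_pos by simp
    fix s t :: real assume "s \<le> t"
    \<comment> \<open>The derivative of \<open>g\<close> is
      \<open>- (d - sqrt \<rho>)\<^sup>2 / d\<close>, so the exponential of \<open>A\<close> decays
      at rate \<open>2 * sqrt \<rho>\<close> up to the factor \<open>d t / d s\<close>.\<close>
    define g where "g r = A r - ln (d r) + 2 * sqrt \<rho> * r" for r
    have "g t \<le> g s"
    proof (rule DERIV_nonpos_imp_nonincreasing[OF \<open>s \<le> t\<close>])
      fix r
      have deriv: "(g has_real_derivative - 2 * (a r - G r)
          - 1 / d r * (\<rho> - 2 * (a r - G r) * d r + (d r)\<^sup>2) + 2 * sqrt \<rho> * 1) (at r)"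
        unfolding g_def
        by (intro DERIV_add DERIV_diff A DERIV_cmult DERIV_ident DERIV_chain2[OF DERIV_ln_divide d_deriv] d_pos)
      have "0 \<le> (d r - sqrt \<rho>)\<^sup>2 / d r"
        using d_pos[of r] by simp
      also have "(d r - sqrt \<rho>)\<^sup>2 = (d r)\<^sup>2 - 2 * sqrt \<rho> * d r + \<rho>"
        using \<rho> by (simp add: power2_diff)
      also have "((d r)\<^sup>2 - 2 * sqrt \<rho> * d r + \<rho>) / d r =
          - (- 2 * (a r - G r) - 1 / d r * (\<rho> - 2 * (a r - G r) * d r + (d r)\<^sup>2) + 2 * sqrt \<rho> * 1)"
        using d_pos[of r] by (simp add: field_simps)
      finally show "\<exists>y. (g has_real_derivative y) (at r) \<and> y \<le> 0"
        using deriv by (metis neg_0_le_iff_le)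
    qed
    then have "A t - A s \<le> ln (d t / d s) - 2 * sqrt \<rho> * (t - s)"
      using d_pos[of s] d_pos[of t] by (simp add: g_def ln_div algebra_simps)
    then have "exp (A t - A s) \<le> exp (ln (d t / d s) + (- (2 * sqrt \<rho>) * (t - s)))"
      by simp
    also have "\<dots> = d t / d s * exp (- (2 * sqrt \<rho>) * (t - s))"
      unfolding exp_add using d_pos[of s] d_pos[of t] by simp
    also have "\<dots> \<le> D / \<delta> * exp (- (2 * sqrt \<rho>) * (t - s))"
      using d_pos[of t] D[of t] \<delta>[of s] \<delta>_pos by (intro mult_right_mono frac_le) auto
    finally show "exp (A t - A s) \<le> D / \<delta> * exp (- (2 * sqrt \<rho>) * (t - s))" .
  qed
qed

lemma riccati_repeller_hyperbolic:
  assumes \<rho>: "0 < \<rho>"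
    and x: "riccati_bounded_solution G (l - \<rho>) x" and r: "riccati_bounded_solution G l r"
    and rx: "\<And>t. r t \<le> x t"
    and A: "\<And>t. (A has_real_derivative - 2 * (r t - G t)) (at t)"
  obtains k where "1 \<le> k"
    "\<And>s t. t \<le> s \<Longrightarrow> exp (A t - A s) \<le> k * exp ((2 * sqrt \<rho>) * (t - s))"
proof -
  have A': "((\<lambda>t. A (- t)) has_real_derivative - 2 * (- r (- t) - - G (- t))) (at t)" for t
    using DERIV_chain2[OF A DERIV_minus[OF DERIV_ident], of t UNIV] by (simp add: algebra_simps)
  obtain k where "1 \<le> k" and k: "\<And>s t. s \<le> t \<Longrightarrow> exp (A (- t) - A (- s)) \<le> k * exp (- (2 * sqrt \<rho>) * (t - s))"
    by (rule riccati_attractor_hyperbolic[OF \<rho> riccati_bounded_solution_reflect[OF x]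
        riccati_bounded_solution_reflect[OF r] _ A']) (use rx in auto)
  show thesis
  proof (rule that[OF \<open>1 \<le> k\<close>])
    show "exp (A t - A s) \<le> k * exp ((2 * sqrt \<rho>) * (t - s))" if "t \<le> s" for s t
      using k[of "- s" "- t"] that by (simp add: algebra_simps)
  qed
qed

section \<open>Threshold of the parameter and its perturbation\<close>

text \<open>The admissible parameters form an upper set because a solution is a subsolution for any
  larger parameter. They are bounded below because for \<open>l < - K\<close> every solution falls
  faster than \<open>G\<close> can follow. Compactness along parameters decreasing to the infimum
  shows that it is attained.\<close>

lemma riccati_threshold:
  assumes G: "coarse_lipschitz K G"
    and u: "riccati_subsolution G l1 u" and u_bd: "\<And>t. \<bar>u t - G t\<bar> \<le> B"
  obtains l0 where "- K \<le> l0" "l0 \<le> l1"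
    "\<And>l. (\<exists>z. riccati_bounded_solution G l z) \<longleftrightarrow> l0 \<le> l"
proof -
  have K: "0 \<le> K" and G_cont: "continuous_on UNIV G"
    using G by (auto simp: coarse_lipschitz_def)
  define S where "S = {l. \<exists>z. riccati_bounded_solution G l z}"
  have l1: "l1 \<in> S"
    by (rule maximal_riccati_bounded_solution[OF G u u_bd]) (auto simp: S_def)
  have up: "l' \<in> S" if "l \<in> S" "l \<le> l'" for l l'
  proof -
    obtain z where z: "riccati_bounded_solution G l z"
      using \<open>l \<in> S\<close> by (auto simp: S_def)
    then have sub: "riccati_subsolution G l' z"
      using \<open>l \<le> l'\<close> G_cont riccati_solution_imp_subsolution
      by (auto simp: riccati_bounded_solution_def)
    show ?thesis
      by (rule maximal_riccati_bounded_solution[OF G sub riccati_bounded_solution_bound[OF G z]])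
         (auto simp: S_def)
  qed
  have low: "- K \<le> l" if "l \<in> S" for l
  proof (rule ccontr)
    assume "\<not> - K \<le> l"
    obtain z where z: "riccati_bounded_solution G l z"
      using \<open>l \<in> S\<close> by (auto simp: S_def)
    define C where "C = \<bar>l\<bar> + 2 * K + 1"
    have C: "\<bar>z t - G t\<bar> \<le> C" for t
      using riccati_bounded_solution_bound[OF G z] by (simp add: C_def)
    \<comment> \<open>At this time the forced descent \<open>(- K - l) * T\<close> is one more than
      boundedness of \<open>z - G\<close> permits.\<close>
    define T where "T = (2 * C + K + 1) / (- K - l)"
    have "0 \<le> T"
      using \<open>\<not> - K \<le> l\<close> K by (auto simp: T_def C_def)
    have "z T - l * T \<le> z 0 - l * 0"
    proof (rule DERIV_nonpos_imp_nonincreasing[OF \<open>0 \<le> T\<close>])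
      fix t
      have "((\<lambda>t. z t - l * t) has_real_derivative (l - (z t - G t)\<^sup>2) - l * 1) (at t)"
        using z by (intro DERIV_diff DERIV_cmult DERIV_ident)
          (auto simp: riccati_bounded_solution_def riccati_solution_def)
      then show "\<exists>y. ((\<lambda>t. z t - l * t) has_real_derivative y) (at t) \<and> y \<le> 0"
        by (intro exI conjI) (assumption, simp)
    qed
    moreover have "\<bar>G T - G 0\<bar> \<le> K * (1 + T)"
      using coarse_lipschitzD[OF G, of T 0] \<open>0 \<le> T\<close> by simp
    ultimately have "(- K - l) * T \<le> 2 * C + K"
      using C[of T] C[of 0] by (simp add: algebra_simps abs_le_iff)
    moreover have "(- K - l) * T = 2 * C + K + 1"
      using \<open>\<not> - K \<le> l\<close> by (simp add: T_def)
    ultimately show False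
      by simp
  qed
  define l0 where "l0 = Inf S"
  have bdd: "bdd_below S"
    using low by (rule bdd_belowI)
  have l0_low: "l0 \<le> l" if "l \<in> S" for l
    unfolding l0_def using that bdd by (rule cInf_lower)
  have "l0 \<in> S"
  proof -
    have "\<exists>z. riccati_bounded_solution G (l0 + inverse (real (Suc n))) z" for n
    proof -
      have "Inf S < l0 + inverse (real (Suc n))"
        by (simp add: l0_def)
      then obtain l where "l \<in> S" "l < l0 + inverse (real (Suc n))"
        using cInf_lessD[of S] l1 by blast
      then have "l0 + inverse (real (Suc n)) \<in> S"
        by (auto intro: up)
      then show ?thesis
        by (simp add: S_def)
    qed
    then obtain z where z: "\<And>n. riccati_bounded_solution G (l0 + inverse (real (Suc n))) (z n)"
      by metis
    have lim: "(\<lambda>n. l0 + inverse (real (Suc n))) \<longlonglongrightarrow> l0"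
      using tendsto_add[OF tendsto_const LIMSEQ_inverse_real_of_nat] by simp
    have bd: "\<bar>z n t - G t\<bar> \<le> \<bar>l0\<bar> + 1 + 2 * K + 1" for n t
    proof -
      have "\<bar>l0 + inverse (real (Suc n))\<bar> \<le> \<bar>l0\<bar> + 1"
        using inverse_le_1_iff[of "real (Suc n)"] inverse_nonnegative_iff_nonnegative[of "real (Suc n)"]
        by linarith
      then show ?thesis
        using riccati_bounded_solution_bound[OF G z, of n t] by linarith
    qed
    have deriv: "(z n has_real_derivative l0 + inverse (real (Suc n)) - (z n t - G t)\<^sup>2) (at t)" for n t
      using z by (auto simp: riccati_bounded_solution_def riccati_solution_def)
    obtain w where "riccati_bounded_solution G l0 w"
      by (rule riccati_compactness[OF tendsto_const G_cont lim deriv bd])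
    then show ?thesis
      by (auto simp: S_def)
  qed
  show thesis
  proof (rule that)
    show "- K \<le> l0" "l0 \<le> l1"
      using low[OF \<open>l0 \<in> S\<close>] l0_low[OF l1] .
    show "(\<exists>z. riccati_bounded_solution G l z) \<longleftrightarrow> l0 \<le> l" for l
      using l0_low[of l] up[OF \<open>l0 \<in> S\<close>, of l] by (auto simp: S_def)
  qed
qed

text \<open>With \<open>e = G' - G\<close> the two squares differ by
  \<open>e * (e - 2 * (z - G))\<close>, which is at most
  \<open>\<delta> * (2 * R + \<delta>)\<close>; raising the parameter by this amount
  compensates.\<close>

lemma riccati_subsolution_perturb_uniform:
  assumes z: "riccati_solution G l z" and "continuous_on UNIV G" and G': "continuous_on UNIV G'"
    and R: "\<And>t. \<bar>z t - G t\<bar> \<le> R" and \<delta>: "\<And>t. \<bar>G' t - G t\<bar> \<le> \<delta>"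
  shows "riccati_subsolution G' (l + \<delta> * (2 * R + \<delta>)) z"
  unfolding riccati_subsolution_def
proof safe
  show z_cont: "continuous_on UNIV z"
    using riccati_solution_continuous z .
  fix s t :: real assume "s \<le> t"
  then have int: "((\<lambda>x. l - (z x - G x)\<^sup>2) has_integral z t - z s) {s..t}"
    using z by (intro integral_DERIV) (auto simp: riccati_solution_def)
  have "integral {s..t} (\<lambda>x. l - (z x - G x)\<^sup>2)
      \<le> integral {s..t} (\<lambda>x. l + \<delta> * (2 * R + \<delta>) - (z x - G' x)\<^sup>2)"
  proof (intro integral_le integrable_on_of_continuous_UNIV continuous_intros z_cont assms)
    fix x
    have "(z x - G' x)\<^sup>2 - (z x - G x)\<^sup>2 \<le> \<bar>G' x - G x\<bar> * \<bar>(G' x - G x) - 2 * (z x - G x)\<bar>"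
      unfolding abs_mult[symmetric] by (rule order_trans[OF _ abs_ge_self]) (simp add: power2_eq_square algebra_simps)
    also have "\<dots> \<le> \<delta> * (2 * R + \<delta>)"
      using R[of x] \<delta>[of x] by (intro mult_mono) auto
    finally show "l - (z x - G x)\<^sup>2 \<le> l + \<delta> * (2 * R + \<delta>) - (z x - G' x)\<^sup>2"
      by simp
  qed
  with integral_unique[OF int]
  show "z t - z s \<le> integral {s..t} (\<lambda>x. l + \<delta> * (2 * R + \<delta>) - (z x - G' x)\<^sup>2)"
    by simp
qed

text \<open>Subtracting \<open>H\<close> from both \<open>z\<close> and \<open>G\<close> leaves the
  square unchanged. Only the rate at which \<open>H\<close> decreases has to be paid for, whatever
  its size.\<close>

lemma riccati_subsolution_perturb_drift:
  assumes z: "riccati_solution G l z" and G: "continuous_on UNIV G" and H: "continuous_on UNIV H"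
    and drift: "\<And>s t. s \<le> t \<Longrightarrow> H s - H t \<le> \<epsilon> * (t - s)"
  shows "riccati_subsolution (\<lambda>t. G t - H t) (l + \<epsilon>) (\<lambda>t. z t - H t)"
  unfolding riccati_subsolution_def
proof safe
  have z_cont: "continuous_on UNIV z"
    using riccati_solution_continuous z .
  then show "continuous_on UNIV (\<lambda>t. z t - H t)"
    by (intro continuous_intros H)
  fix s t :: real assume "s \<le> t"
  then have "((\<lambda>x. l - (z x - G x)\<^sup>2) has_integral z t - z s) {s..t}"
    using z by (intro integral_DERIV) (auto simp: riccati_solution_def)
  moreover have "((\<lambda>x. \<epsilon>) has_integral \<epsilon> * (t - s)) {s..t}"
    using has_integral_const_real[of \<epsilon> s t] \<open>s \<le> t\<close> by (simp add: mult.commute)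
  ultimately have "((\<lambda>x. l - (z x - G x)\<^sup>2 + \<epsilon>) has_integral (z t - z s) + \<epsilon> * (t - s)) {s..t}"
    by (rule has_integral_add)
  then have "integral {s..t} (\<lambda>x. l + \<epsilon> - (z x - H x - (G x - H x))\<^sup>2) = (z t - z s) + \<epsilon> * (t - s)"
    by (intro integral_unique) (simp add: algebra_simps)
  with drift[OF \<open>s \<le> t\<close>]
  show "z t - H t - (z s - H s) \<le> integral {s..t} (\<lambda>x. l + \<epsilon> - (z x - H x - (G x - H x))\<^sup>2)"
    by simp
qed

subsection \<open>Absolute continuity and essentially bounded functions\<close>

lemma absolutely_continuous_on_interval_diff:
  assumes f: "absolutely_continuous_on_interval f a b" and g: "absolutely_continuous_on_interval g a b"
  shows "absolutely_continuous_on_interval (\<lambda>t. f t - g t) a b"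
  unfolding absolutely_continuous_on_interval_def
proof (intro allI impI)
  fix \<epsilon> :: real assume "0 < \<epsilon>"
  then have "0 < \<epsilon> / 2"
    by simp
  obtain \<delta>1 where "0 < \<delta>1" and \<delta>1: "\<And>D. finite D \<Longrightarrow> (\<forall>(u, v) \<in> D. a \<le> u \<and> u \<le> v \<and> v \<le> b) \<Longrightarrow>
        pairwise (\<lambda>I J. {fst I<..<snd I} \<inter> {fst J<..<snd J} = {}) D \<Longrightarrow>
        (\<Sum>(u, v)\<in>D. v - u) < \<delta>1 \<Longrightarrow> (\<Sum>(u, v)\<in>D. \<bar>f v - f u\<bar>) < \<epsilon> / 2"
    using f[unfolded absolutely_continuous_on_interval_def, rule_format, OF \<open>0 < \<epsilon> / 2\<close>] by blast
  obtain \<delta>2 where "0 < \<delta>2" and \<delta>2: "\<And>D. finite D \<Longrightarrow> (\<forall>(u, v) \<in> D. a \<le> u \<and> u \<le> v \<and> v \<le> b) \<Longrightarrow>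
        pairwise (\<lambda>I J. {fst I<..<snd I} \<inter> {fst J<..<snd J} = {}) D \<Longrightarrow>
        (\<Sum>(u, v)\<in>D. v - u) < \<delta>2 \<Longrightarrow> (\<Sum>(u, v)\<in>D. \<bar>g v - g u\<bar>) < \<epsilon> / 2"
    using g[unfolded absolutely_continuous_on_interval_def, rule_format, OF \<open>0 < \<epsilon> / 2\<close>] by blast
  show "\<exists>\<delta>>0. \<forall>D. finite D \<longrightarrow> (\<forall>(u, v) \<in> D. a \<le> u \<and> u \<le> v \<and> v \<le> b) \<longrightarrow>
        pairwise (\<lambda>I J. {fst I<..<snd I} \<inter> {fst J<..<snd J} = {}) D \<longrightarrow>
        (\<Sum>(u, v)\<in>D. v - u) < \<delta> \<longrightarrow> (\<Sum>(u, v)\<in>D. \<bar>f v - g v - (f u - g u)\<bar>) < \<epsilon>"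
  proof (intro exI conjI allI impI)
    show "0 < min \<delta>1 \<delta>2"
      using \<open>0 < \<delta>1\<close> \<open>0 < \<delta>2\<close> by simp
    fix D :: "(real \<times> real) set"
    assume D: "finite D" "\<forall>(u, v) \<in> D. a \<le> u \<and> u \<le> v \<and> v \<le> b"
      "pairwise (\<lambda>I J. {fst I<..<snd I} \<inter> {fst J<..<snd J} = {}) D"
      "(\<Sum>(u, v)\<in>D. v - u) < min \<delta>1 \<delta>2"
    have "(\<Sum>(u, v)\<in>D. \<bar>f v - g v - (f u - g u)\<bar>)
        \<le> (\<Sum>(u, v)\<in>D. \<bar>f v - f u\<bar>) + (\<Sum>(u, v)\<in>D. \<bar>g v - g u\<bar>)"
      unfolding sum.distrib[symmetric] by (intro sum_mono) auto
    also have "\<dots> < \<epsilon>"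
      using \<delta>1[OF D(1-3)] \<delta>2[OF D(1-3)] D(4) by simp
    finally show "(\<Sum>(u, v)\<in>D. \<bar>f v - g v - (f u - g u)\<bar>) < \<epsilon>" .
  qed
qed

lemma lipschitz_imp_absolutely_continuous:
  assumes "\<And>s t. s \<le> t \<Longrightarrow> \<bar>f t - f s\<bar> \<le> C * (t - s)"
  shows "absolutely_continuous_on_interval f a b"
  unfolding absolutely_continuous_on_interval_def
proof (intro allI impI)
  fix \<epsilon> :: real assume "0 < \<epsilon>"
  have C: "0 \<le> C"
    using assms[of 0 1] by simp
  show "\<exists>\<delta>>0. \<forall>D. finite D \<longrightarrow> (\<forall>(u, v) \<in> D. a \<le> u \<and> u \<le> v \<and> v \<le> b) \<longrightarrow>
        pairwise (\<lambda>I J. {fst I<..<snd I} \<inter> {fst J<..<snd J} = {}) D \<longrightarrow>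
        (\<Sum>(u, v)\<in>D. v - u) < \<delta> \<longrightarrow> (\<Sum>(u, v)\<in>D. \<bar>f v - f u\<bar>) < \<epsilon>"
  proof (intro exI conjI allI impI)
    show "0 < \<epsilon> / (C + 1)"
      using \<open>0 < \<epsilon>\<close> C by simp
    fix D :: "(real \<times> real) set"
    assume D: "\<forall>(u, v) \<in> D. a \<le> u \<and> u \<le> v \<and> v \<le> b" "(\<Sum>(u, v)\<in>D. v - u) < \<epsilon> / (C + 1)"
    have "(\<Sum>(u, v)\<in>D. \<bar>f v - f u\<bar>) \<le> (\<Sum>(u, v)\<in>D. C * (v - u))"
      using D assms by (intro sum_mono) auto
    also have "\<dots> = C * (\<Sum>(u, v)\<in>D. v - u)"
      by (simp add: sum_distrib_left case_prod_unfold)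
    also have "\<dots> \<le> C * (\<epsilon> / (C + 1))"
      using D C by (intro mult_left_mono) auto
    also have "\<dots> < \<epsilon>"
      using \<open>0 < \<epsilon>\<close> C by (simp add: field_simps)
    finally show "(\<Sum>(u, v)\<in>D. \<bar>f v - f u\<bar>) < \<epsilon>" .
  qed
qed

lemma absolutely_continuous_imp_continuous:
  assumes ac: "\<And>a b. a \<le> b \<Longrightarrow> absolutely_continuous_on_interval f a b"
  shows "continuous_on UNIV f"
  unfolding continuous_on_iff
proof (intro ballI allI impI)
  fix t \<epsilon> :: real assume "0 < \<epsilon>"
  obtain \<delta> where "0 < \<delta>" and \<delta>: "\<And>D. finite D \<Longrightarrow> (\<forall>(u, v) \<in> D. t - 1 \<le> u \<and> u \<le> v \<and> v \<le> t + 1) \<Longrightarrow>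
        pairwise (\<lambda>I J. {fst I<..<snd I} \<inter> {fst J<..<snd J} = {}) D \<Longrightarrow>
        (\<Sum>(u, v)\<in>D. v - u) < \<delta> \<Longrightarrow> (\<Sum>(u, v)\<in>D. \<bar>f v - f u\<bar>) < \<epsilon>"
    using ac[of "t - 1" "t + 1", unfolded absolutely_continuous_on_interval_def, rule_format, OF _ \<open>0 < \<epsilon>\<close>]
    by (auto simp: less_imp_le)
  show "\<exists>d>0. \<forall>x'\<in>UNIV. dist x' t < d \<longrightarrow> dist (f x') (f t) < \<epsilon>"
  proof (intro exI[of _ "min \<delta> 1"] conjI ballI impI)
    fix x assume "dist x t < min \<delta> 1"
    then show "dist (f x) (f t) < \<epsilon>"
      using \<delta>[of "{(x, t)}"] \<delta>[of "{(t, x)}"]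
      by (cases "x \<le> t") (auto simp: dist_real_def abs_minus_commute)
  qed (use \<open>0 < \<delta>\<close> in auto)
qed

lemma negligible_open_cover:
  fixes N :: "real set"
  assumes "negligible N" "0 < \<delta>"
  obtains T where "open T" "N \<subseteq> T" "T \<in> lmeasurable" "measure lebesgue T < \<delta>"
proof -
  have N: "N \<in> lmeasurable" "N \<in> null_sets lebesgue"
    using assms negligible_imp_measurable by (auto simp: negligible_iff_null_sets)
  obtain T where T: "open T" "N \<subseteq> T" "T - N \<in> lmeasurable" "emeasure lebesgue (T - N) < ennreal \<delta>"
    using sets_lebesgue_outer_open[of N \<delta>] N assms by (auto dest: fmeasurableD)
  have "T = (T - N) \<union> N"
    using T by auto
  then have "T \<in> lmeasurable"
    using T N fmeasurable.Un by metis
  moreover have "measure lebesgue T = measure lebesgue (T - N)"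
    using N \<open>T \<in> lmeasurable\<close> by (intro measure_Diff_null_set[symmetric]) auto
  moreover have "measure lebesgue (T - N) < \<delta>"
    using T by (simp add: emeasure_eq_measure2 ennreal_less_iff)
  ultimately show thesis
    using that T by auto
qed

text \<open>
  Cousin's lemma: tags outside the exceptional null set contribute little because the derivative
  vanishes there, and tags inside it contribute little by absolute continuity.
\<close>

lemma absolutely_continuous_DERIV_zero:
  assumes ac: "absolutely_continuous_on_interval f a b" and "a \<le> b"
    and N: "negligible N" and deriv: "\<And>t. t \<notin> N \<Longrightarrow> (f has_real_derivative 0) (at t)"
  shows "f b = f a"
proof -
  have "\<bar>f b - f a\<bar> \<le> \<epsilon> * (b - a + 1)" if "0 < \<epsilon>" for \<epsilon>
  proof -
    obtain \<delta> where "0 < \<delta>" and \<delta>: "\<And>D. finite D \<Longrightarrow> (\<forall>(u, v) \<in> D. a \<le> u \<and> u \<le> v \<and> v \<le> b) \<Longrightarrow>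
        pairwise (\<lambda>I J. {fst I<..<snd I} \<inter> {fst J<..<snd J} = {}) D \<Longrightarrow>
        (\<Sum>(u, v)\<in>D. v - u) < \<delta> \<Longrightarrow> (\<Sum>(u, v)\<in>D. \<bar>f v - f u\<bar>) < \<epsilon>"
      using ac[unfolded absolutely_continuous_on_interval_def, rule_format, OF \<open>0 < \<epsilon>\<close>] by blast
    obtain T where T: "open T" "N \<subseteq> T" "T \<in> lmeasurable" "measure lebesgue T < \<delta>"
      using negligible_open_cover[OF N \<open>0 < \<delta>\<close>] .
    have "\<exists>d>0. \<forall>y. \<bar>y - t\<bar> < d \<longrightarrow> \<bar>f y - f t\<bar> \<le> \<epsilon> * \<bar>y - t\<bar>" if "t \<notin> N" for t
    proof -
      have "((f has_derivative (\<lambda>h. 0 * h)) (at t))"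
        using deriv[OF that] unfolding has_field_derivative_def .
      then obtain d where "0 < d" "\<And>y. norm (y - t) < d \<Longrightarrow> norm (f y - f t - 0 * (y - t)) \<le> \<epsilon> * norm (y - t)"
        using \<open>0 < \<epsilon>\<close> unfolding has_derivative_at_alt by blast
      then show ?thesis
        by (intro exI[of _ d]) auto
    qed
    then obtain d where d: "\<And>t. t \<notin> N \<Longrightarrow> 0 < d t"
      "\<And>t y. t \<notin> N \<Longrightarrow> \<bar>y - t\<bar> < d t \<Longrightarrow> \<bar>f y - f t\<bar> \<le> \<epsilon> * \<bar>y - t\<bar>"
      by metis
    \<comment> \<open>Intervals tagged in \<open>N\<close> are confined to \<open>T\<close> and so
      have total length below \<delta>; elsewhere the radius makes every increment from the tag at
      most \<epsilon> times the distance.\<close>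
    define \<gamma> where "\<gamma> t = (if t \<in> N then T else ball t (d t))" for t
    have "gauge \<gamma>"
      using T d by (auto simp: gauge_def \<gamma>_def)
    then obtain p where p: "p tagged_division_of {a..b}" and fine: "\<gamma> fine p"
      using fine_division_exists_real by blast
    have fin: "finite p"
      using p by blast
    have K: "\<exists>u v. K = {u..v} \<and> u \<le> v \<and> a \<le> u \<and> v \<le> b \<and> x \<in> {u..v} \<and> {u..v} \<subseteq> \<gamma> x"
      if xK: "(x, K) \<in> p" for x K
    proof -
      obtain u v where "K = {u..v}"
        using tagged_division_ofD(4)[OF p xK] by auto
      moreover have "x \<in> K" "K \<subseteq> {a..b}" "K \<subseteq> \<gamma> x"
        using tagged_division_ofD(2,3)[OF p xK] fineD[OF fine xK] by auto
      ultimately show ?thesis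
        by (intro exI[of _ u] exI[of _ v]) auto
    qed
    define g where "g K = \<bar>f (Sup K) - f (Inf K)\<bar>" for K
    define p1 where "p1 = {(x, K) \<in> p. x \<in> N}"
    have p1: "p1 \<subseteq> p"
      by (auto simp: p1_def)
    define \<K> where "\<K> = snd ` p1"
    have \<K>_ivl: "\<exists>u v. K = {u..v} \<and> u \<le> v \<and> a \<le> u \<and> v \<le> b \<and> {u..v} \<subseteq> T" if "K \<in> \<K>" for K
      using that K unfolding \<K>_def p1_def \<gamma>_def by fastforce
    have "p1 tagged_partial_division_of {a..b}"
      using p p1 tagged_partial_division_subset unfolding tagged_division_of_def by blast
    then have \<K>_div: "\<K> division_of \<Union>\<K>"
      unfolding \<K>_def by (rule partial_division_of_tagged_division)
    have "sum (\<lambda>(x, K). g K) p1 = sum g \<K>"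
    proof -
      have "sum g \<K> = sum (g \<circ> snd) p1"
        unfolding \<K>_def
      proof (rule sum.reindex_nontrivial)
        show "finite p1"
          using fin p1 finite_subset by blast
        \<comment> \<open>Passing from tagged intervals to intervals can merge two tags only when
          the shared interval has empty interior; it is then a point and contributes 0.\<close>
        fix X Y assume XY: "X \<in> p1" "Y \<in> p1" "X \<noteq> Y" "snd X = snd Y"
        obtain x y L where X: "X = (x, L)" and Y: "Y = (y, L)"
          using XY by (cases X; cases Y) auto
        have "interior L \<inter> interior L = {}"
          using XY p1 unfolding X Y by (intro tagged_division_ofD(5)[OF p, of x L y L]) auto
        moreover obtain u v where "L = {u..v}" "u \<le> v"
          using K[of x L] XY p1 X by blast
        ultimately show "g (snd X) = 0"
          by (simp add: g_def X)
      qed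
      then show ?thesis
        by (simp add: comp_def case_prod_unfold)
    qed
    also have "sum g \<K> < \<epsilon>"
    proof -
      define D where "D = (\<lambda>K. (Inf K, Sup K)) ` \<K>"
      have inj: "inj_on (\<lambda>K. (Inf K, Sup K)) \<K>"
      proof (rule inj_onI)
        fix K L assume "K \<in> \<K>" "L \<in> \<K>" and eq: "(Inf K, Sup K) = (Inf L, Sup L)"
        then show "K = L"
          using \<K>_ivl[of K] \<K>_ivl[of L] by auto
      qed
      have "finite \<K>"
        unfolding \<K>_def using fin p1 finite_subset by blast
      have "(\<Sum>(u, v)\<in>D. v - u) = (\<Sum>K\<in>\<K>. measure lebesgue K)"
        unfolding D_def sum.reindex[OF inj] using \<K>_ivl by (intro sum.cong) fastforce+
      also have "\<dots> = measure lebesgue (\<Union>\<K>)"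
        using content_division[OF \<K>_div] .
      also have "\<dots> \<le> measure lebesgue T"
        using \<K>_ivl T by (intro measure_mono_fmeasurable fmeasurableD lmeasurable_division[OF \<K>_div]) auto
      finally have small: "(\<Sum>(u, v)\<in>D. v - u) < \<delta>"
        using T by simp
      have "(\<Sum>(u, v)\<in>D. \<bar>f v - f u\<bar>) < \<epsilon>"
      proof (rule \<delta>[OF _ _ _ small])
        show "finite D"
          using \<open>finite \<K>\<close> by (simp add: D_def)
        show "\<forall>(u, v)\<in>D. a \<le> u \<and> u \<le> v \<and> v \<le> b"
          using \<K>_ivl unfolding D_def by fastforce
        show "pairwise (\<lambda>I J. {fst I<..<snd I} \<inter> {fst J<..<snd J} = {}) D"
        proof (rule pairwiseI)
          fix I J assume "I \<in> D" "J \<in> D" "I \<noteq> J"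
          then obtain K L where KL: "K \<in> \<K>" "L \<in> \<K>" "K \<noteq> L"
            and IJ: "I = (Inf K, Sup K)" "J = (Inf L, Sup L)"
            by (auto simp: D_def)
          have "interior K \<inter> interior L = {}"
            using division_ofD(5)[OF \<K>_div KL] .
          moreover obtain u v u' v' where "K = {u..v}" "u \<le> v" "L = {u'..v'}" "u' \<le> v'"
            using \<K>_ivl[OF KL(1)] \<K>_ivl[OF KL(2)] by blast
          ultimately show "{fst I<..<snd I} \<inter> {fst J<..<snd J} = {}"
            by (simp add: IJ)
        qed
      qed
      then show ?thesis
        by (simp add: D_def sum.reindex[OF inj] comp_def g_def)
    qed
    finally have s1: "sum (\<lambda>(x, K). g K) p1 < \<epsilon>" .
    have "sum (\<lambda>(x, K). g K) (p - p1) \<le> sum (\<lambda>(x, K). \<epsilon> * (Sup K - Inf K)) (p - p1)"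
    proof (rule sum_mono, clarify)
      fix x K assume xK: "(x, K) \<in> p" "(x, K) \<notin> p1"
      then have "x \<notin> N"
        by (simp add: p1_def)
      obtain u v where uv: "K = {u..v}" "u \<le> v" "x \<in> {u..v}" "{u..v} \<subseteq> \<gamma> x"
        using K[OF xK(1)] by blast
      then have "u \<in> \<gamma> x" "v \<in> \<gamma> x"
        by auto
      \<comment> \<open>The tag lies between \<open>u\<close> and \<open>v\<close>, so the two
        increments add up to at most \<epsilon> times the length.\<close>
      then have "\<bar>f u - f x\<bar> \<le> \<epsilon> * \<bar>u - x\<bar>" "\<bar>f v - f x\<bar> \<le> \<epsilon> * \<bar>v - x\<bar>"
        using \<open>x \<notin> N\<close> by (auto simp: \<gamma>_def dist_real_def intro!: d)
      then show "g K \<le> \<epsilon> * (Sup K - Inf K)"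
        using uv by (auto simp: g_def algebra_simps abs_le_iff)
    qed
    also have "\<dots> \<le> sum (\<lambda>(x, K). \<epsilon> * (Sup K - Inf K)) p"
      using fin K \<open>0 < \<epsilon>\<close> by (intro sum_mono2) fastforce+
    also have "\<dots> = \<epsilon> * (b - a)"
      using additive_tagged_division_1[OF \<open>a \<le> b\<close> p, of "\<lambda>t. \<epsilon> * t"] by (simp add: algebra_simps)
    finally have s2: "sum (\<lambda>(x, K). g K) (p - p1) \<le> \<epsilon> * (b - a)" .
    have "\<bar>f b - f a\<bar> = \<bar>sum (\<lambda>(x, K). f (Sup K) - f (Inf K)) p\<bar>"
      using additive_tagged_division_1[OF \<open>a \<le> b\<close> p, of f] by simp
    also have "\<dots> \<le> sum (\<lambda>(x, K). g K) p"
      using sum_abs[of "\<lambda>(x, K). f (Sup K) - f (Inf K)" p] by (simp add: g_def case_prod_unfold)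
    also have "\<dots> = sum (\<lambda>(x, K). g K) (p - p1) + sum (\<lambda>(x, K). g K) p1"
      using fin p1 by (rule sum.subset_diff[rotated])
    finally show ?thesis
      using s1 s2 by (simp add: algebra_simps)
  qed
  then have "\<bar>f b - f a\<bar> \<le> 0"
  proof -
    assume *: "\<And>\<epsilon>. 0 < \<epsilon> \<Longrightarrow> \<bar>f b - f a\<bar> \<le> \<epsilon> * (b - a + 1)"
    show ?thesis
    proof (rule field_le_epsilon)
      fix e :: real assume "0 < e"
      then show "\<bar>f b - f a\<bar> \<le> 0 + e"
        using *[of "e / (b - a + 1)"] \<open>a \<le> b\<close> by simp
    qed
  qed
  then show ?thesis
    by simp
qed

section \<open>Primitives of essentially bounded functions\<close>

lemma Linf_set_integrable:
  assumes "q \<in> Linf"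
  shows "set_integrable lebesgue {a..b} q"
proof -
  have meas: "q \<in> borel_measurable lebesgue"
    using assms by (simp add: Linf_def)
  obtain C where C: "AE t in lebesgue. \<bar>q t\<bar> \<le> C"
    using assms by (auto simp: Linf_def)
  have "set_integrable lebesgue {a..b} (\<lambda>_. C)"
    by (intro absolutely_integrable_continuous_real continuous_on_const)
  then show ?thesis
    unfolding set_integrable_def
  proof (rule Bochner_Integration.integrable_bound)
    show "(\<lambda>x. indicat_real {a..b} x *\<^sub>R q x) \<in> borel_measurable lebesgue"
      using meas by (intro borel_measurable_scaleR borel_measurable_indicator) auto
    show "AE x in lebesgue. norm (indicat_real {a..b} x *\<^sub>R q x) \<le> norm (indicat_real {a..b} x *\<^sub>R C)"
      using C by eventually_elim (auto simp: indicator_def)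
  qed
qed

lemma Linf_integrable_on: "q \<in> Linf \<Longrightarrow> q integrable_on {a..b}"
  using set_lebesgue_integral_eq_integral(1)[OF Linf_set_integrable] .

lemma Linf_diff: "f \<in> Linf \<Longrightarrow> g \<in> Linf \<Longrightarrow> (\<lambda>t. f t - g t) \<in> Linf"
proof -
  assume f: "f \<in> Linf" and g: "g \<in> Linf"
  obtain C C' where C: "AE t in lebesgue. \<bar>f t\<bar> \<le> C" "AE t in lebesgue. \<bar>g t\<bar> \<le> C'"
    using f g by (auto simp: Linf_def)
  from C have "AE t in lebesgue. \<bar>f t - g t\<bar> \<le> C + C'"
    by eventually_elim auto
  moreover have "(\<lambda>t. f t - g t) \<in> borel_measurable lebesgue"
    using f g by (auto simp: Linf_def intro: borel_measurable_diff)
  ultimately show ?thesis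
    by (auto simp: Linf_def)
qed

lemma seminorm_int_eq: "f \<in> Linf \<Longrightarrow> seminorm_int a b f = \<bar>integral {a..b} f\<bar>"
  unfolding seminorm_int_def by (simp add: set_lebesgue_integral_eq_integral(2)[OF Linf_set_integrable])

lemma Linf_primitive_lipschitz:
  assumes q: "q \<in> Linf"
  obtains C where "0 \<le> C" "\<And>s t. s \<le> t \<Longrightarrow> \<bar>primitive 0 q t - primitive 0 q s\<bar> \<le> C * (t - s)"
proof -
  obtain C where C: "AE t in lebesgue. \<bar>q t\<bar> \<le> C"
    using q by (auto simp: Linf_def)
  have "\<bar>primitive 0 q t - primitive 0 q s\<bar> \<le> max C 0 * (t - s)" if "s \<le> t" for s t
  proof -
    have int: "integrable lebesgue (\<lambda>x. indicat_real {s..t} x *\<^sub>R q x)"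
      using Linf_set_integrable[OF q] by (simp add: set_integrable_def)
    have "set_integrable lebesgue {s..t} (\<lambda>_. max C 0)"
      by (intro absolutely_integrable_continuous_real continuous_on_const)
    then have int': "integrable lebesgue (\<lambda>x. indicat_real {s..t} x *\<^sub>R max C 0)"
      and eq: "(LINT x:{s..t}|lebesgue. max C 0) = integral {s..t} (\<lambda>_. max C 0)"
      by (auto simp: set_integrable_def set_lebesgue_integral_eq_integral)
    have "\<bar>integral {s..t} q\<bar> = norm (LINT x|lebesgue. indicat_real {s..t} x *\<^sub>R q x)"
      using set_lebesgue_integral_eq_integral(2)[OF Linf_set_integrable[OF q], of s t]
      by (simp add: set_lebesgue_integral_def)
    also have "\<dots> \<le> (LINT x|lebesgue. norm (indicat_real {s..t} x *\<^sub>R q x))"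
      by (rule integral_norm_bound)
    also have "\<dots> \<le> (LINT x|lebesgue. indicat_real {s..t} x *\<^sub>R max C 0)"
    proof (rule integral_mono_AE)
      show "AE x in lebesgue. norm (indicat_real {s..t} x *\<^sub>R q x) \<le> indicat_real {s..t} x *\<^sub>R max C 0"
        using C by eventually_elim (auto simp: indicator_def)
    qed (use int int' in auto)
    also have "\<dots> = max C 0 * (t - s)"
      using eq that by (simp add: set_lebesgue_integral_def mult.commute)
    finally have "\<bar>integral {s..t} q\<bar> \<le> max C 0 * (t - s)" .
    then show ?thesis
      using primitive_diff[OF Linf_integrable_on[OF q] that, of 0] that by simp
  qed
  then show thesis
    by (intro that[of "max C 0"]) auto
qed

text \<open>Lebesgue's theorem is applied in its one-sided form: right difference quotients come
  from \<open>q\<close>, left ones from the reflected function, and the exceptional sets are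
  united.\<close>

lemma primitive_DERIV_AE:
  assumes int: "\<And>a b. q integrable_on {a..b}"
  obtains N where "negligible N" "\<And>t. t \<notin> N \<Longrightarrow> (primitive 0 q has_real_derivative q t) (at t)"
proof -
  define F where "F = primitive 0 q"
  define q' where "q' t = q (- t)" for t
  have int': "q' integrable_on {a..b}" for a b
    using int Henstock_Kurzweil_Integration.integrable_reflect_real[of q "- a" "- b"] by (simp add: q'_def[abs_def])
  obtain N1 where N1: "negligible N1" "\<And>x e. \<lbrakk>x \<notin> N1; 0 < e\<rbrakk> \<Longrightarrow>
      \<exists>d>0. \<forall>h. 0 < h \<and> h < d \<longrightarrow> norm (integral {x..x + h} q /\<^sub>R h - q x) < e"
    using integrable_ccontinuous_explicit[of q] int by auto
  obtain N2 where N2: "negligible N2" "\<And>x e. \<lbrakk>x \<notin> N2; 0 < e\<rbrakk> \<Longrightarrow>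
      \<exists>d>0. \<forall>h. 0 < h \<and> h < d \<longrightarrow> norm (integral {x..x + h} q' /\<^sub>R h - q' x) < e"
    using integrable_ccontinuous_explicit[of q'] int' by auto
  show thesis
  proof (rule that[of "N1 \<union> uminus ` N2"])
    show "negligible (N1 \<union> uminus ` N2)"
      using N1 N2 by (intro negligible_Un negligible_differentiable_image_negligible)
        (auto simp: differentiable_on_def)
    fix t assume t: "t \<notin> N1 \<union> uminus ` N2"
    then have "t \<notin> N1" "- t \<notin> N2"
      by (auto simp: image_iff)
    show "(primitive 0 q has_real_derivative q t) (at t)"
      unfolding DERIV_def LIM_def F_def[symmetric]
    proof (intro allI impI)
      fix e :: real assume "0 < e"
      obtain d1 where d1: "0 < d1" "\<And>h. 0 < h \<Longrightarrow> h < d1 \<Longrightarrow> norm (integral {t..t + h} q /\<^sub>R h - q t) < e"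
        using N1(2)[OF \<open>t \<notin> N1\<close> \<open>0 < e\<close>] by auto
      obtain d2 where d2: "0 < d2" "\<And>h. 0 < h \<Longrightarrow> h < d2 \<Longrightarrow> norm (integral {- t..- t + h} q' /\<^sub>R h - q' (- t)) < e"
        using N2(2)[OF \<open>- t \<notin> N2\<close> \<open>0 < e\<close>] by auto
      show "\<exists>s>0. \<forall>h. h \<noteq> 0 \<and> dist h 0 < s \<longrightarrow> dist ((F (t + h) - F t) / h) (q t) < e"
      proof (intro exI[of _ "min d1 d2"] conjI allI impI)
        show "0 < min d1 d2"
          using d1 d2 by simp
        fix h :: real assume h: "h \<noteq> 0 \<and> dist h 0 < min d1 d2"
        show "dist ((F (t + h) - F t) / h) (q t) < e"
        proof (cases "0 < h")
          case True
          have "F (t + h) - F t = integral {t..t + h} q"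
            unfolding F_def using True by (intro primitive_diff int) auto
          then show ?thesis
            using d1(2)[of h] True h by (simp add: dist_real_def divide_inverse mult.commute)
        next
          case False
          have "F t - F (t + h) = integral {t + h..t} q"
            unfolding F_def using False by (intro primitive_diff int) auto
          also have "\<dots> = integral {- t..- t + (- h)} q'"
            using Henstock_Kurzweil_Integration.integral_reflect_real[of t "t + h" q] by (simp add: q'_def[abs_def])
          finally show ?thesis
            using d2(2)[of "- h"] False h
            by (simp add: dist_real_def q'_def) (smt (verit) divide_inverse mult.commute minus_divide_left)
        qed
      qed
    qed
  qed
qed

subsection \<open>The threshold parameter\<close>

locale bounded_guide =
  fixes \<Gamma> :: "real \<Rightarrow> real" and B :: real
  assumes \<Gamma>_continuous: "continuous_on UNIV \<Gamma>"
    and \<Gamma>_bound: "\<bar>\<Gamma> t\<bar> \<le> B"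

text \<open>The essential bound expressed through integrals. In this form it passes to limits in the
  seminorm topology, so one constant for \<open>p\<close> serves the whole hull.\<close>

definition drift_bounded :: "real \<Rightarrow> (real \<Rightarrow> real) \<Rightarrow> bool" where
  "drift_bounded C q \<longleftrightarrow> q \<in> Linf \<and>
     (\<forall>s t. s \<le> t \<longrightarrow> \<bar>primitive 0 q t - primitive 0 q s\<bar> \<le> C * (t - s))"

lemma drift_boundedD:
  assumes "drift_bounded C q"
  shows "q \<in> Linf" "0 \<le> C" "\<bar>primitive 0 q t - primitive 0 q s\<bar> \<le> C * \<bar>t - s\<bar>"
    "continuous_on S (primitive 0 q)"
proof -
  show "q \<in> Linf"
    using assms by (simp add: drift_bounded_def)
  have "0 \<le> \<bar>primitive 0 q 1 - primitive 0 q 0\<bar>"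
    by simp
  also have "\<dots> \<le> C * (1 - 0)"
    using assms unfolding drift_bounded_def by (meson zero_le_one)
  finally show C: "0 \<le> C"
    by simp
  show lip: "\<bar>primitive 0 q t - primitive 0 q s\<bar> \<le> C * \<bar>t - s\<bar>" for s t
  proof (cases "s \<le> t")
    case True
    then show ?thesis
      using assms by (simp add: drift_bounded_def)
  next
    case False
    then have "\<bar>primitive 0 q s - primitive 0 q t\<bar> \<le> C * (s - t)"
      using assms by (simp add: drift_bounded_def)
    with False show ?thesis
      by (simp add: abs_minus_commute)
  qed
  have "C-lipschitz_on S (primitive 0 q)"
    using lip C by (intro lipschitz_onI) (auto simp: dist_real_def)
  then show "continuous_on S (primitive 0 q)"
    by (rule lipschitz_on_continuous_on)
qed

lemma Linf_drift_bounded: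
  assumes "q \<in> Linf"
  obtains C where "drift_bounded C q"
  using Linf_primitive_lipschitz[OF assms] assms unfolding drift_bounded_def by metis

context bounded_guide
begin

abbreviation potential :: "(real \<Rightarrow> real) \<Rightarrow> real \<Rightarrow> real" where
  "potential q \<equiv> \<lambda>t. \<Gamma> t - primitive 0 q t"

lemma bound_nonneg: "0 \<le> B"
  using \<Gamma>_bound[of 0] by linarith

lemma coarse_lipschitz_potential_shift:
  assumes "drift_bounded C q"
  shows "coarse_lipschitz (2 * B + C) (\<lambda>t. \<Gamma> (t - s) - primitive 0 q t)"
  unfolding coarse_lipschitz_def
proof (intro conjI allI)
  show "0 \<le> 2 * B + C"
    using bound_nonneg drift_boundedD(2)[OF assms] by simp
  show "continuous_on UNIV (\<lambda>t. \<Gamma> (t - s) - primitive 0 q t)"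
    by (intro continuous_intros drift_boundedD(4)[OF assms] continuous_on_compose2[OF \<Gamma>_continuous]) auto
  fix r t
  have "\<bar>\<Gamma> (t - s) - \<Gamma> (r - s)\<bar> \<le> 2 * B"
    using \<Gamma>_bound[of "t - s"] \<Gamma>_bound[of "r - s"] by linarith
  moreover have "0 \<le> 2 * B * \<bar>t - r\<bar>"
    using bound_nonneg by simp
  ultimately show "\<bar>\<Gamma> (t - s) - primitive 0 q t - (\<Gamma> (r - s) - primitive 0 q r)\<bar>
      \<le> (2 * B + C) * (1 + \<bar>t - r\<bar>)"
    using drift_boundedD(3)[OF assms, of t r] drift_boundedD(2)[OF assms]
    unfolding distrib_left distrib_right mult_1_right by linarith
qed

lemma coarse_lipschitz_potential: "drift_bounded C q \<Longrightarrow> coarse_lipschitz (2 * B + C) (potential q)"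
  using coarse_lipschitz_potential_shift[of C q 0] by simp

text \<open>
  Subtracting a primitive of the forcing turns the Caratheodory equation into an equation with
  continuous right-hand side.
\<close>

lemma bounded_solution_iff_riccati:
  assumes q: "drift_bounded C q"
  shows "bounded_solution \<Gamma> (\<lambda>t. q t + l) x \<longleftrightarrow>
    riccati_bounded_solution (potential q) l (\<lambda>t. x t - primitive 0 q t)"
proof -
  define Q where "Q = primitive 0 q"
  define h where "h t = l - (x t - \<Gamma> t)\<^sup>2" for t
  obtain N where N: "negligible N" and Q_deriv: "\<And>t. t \<notin> N \<Longrightarrow> (Q has_real_derivative q t) (at t)"
    using primitive_DERIV_AE[of q] Linf_integrable_on[OF drift_boundedD(1)[OF q]] unfolding Q_def by blast
  have bounded_iff: "bounded (range x) \<longleftrightarrow> bounded (range (\<lambda>t. x t - \<Gamma> t))"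
  proof
    assume "bounded (range x)"
    then obtain D where "\<And>t. \<bar>x t\<bar> \<le> D"
      by (auto simp: bounded_iff)
    then have "\<bar>x t - \<Gamma> t\<bar> \<le> D + B" for t
      using \<Gamma>_bound[of t] by (smt (verit))
    then show "bounded (range (\<lambda>t. x t - \<Gamma> t))"
      by (auto simp: Elementary_Metric_Spaces.bounded_iff)
  next
    assume "bounded (range (\<lambda>t. x t - \<Gamma> t))"
    then obtain D where "\<And>t. \<bar>x t - \<Gamma> t\<bar> \<le> D"
      by (auto simp: bounded_iff)
    then have "\<bar>x t\<bar> \<le> D + B" for t
      using \<Gamma>_bound[of t] by (smt (verit))
    then show "bounded (range x)"
      by (auto simp: Elementary_Metric_Spaces.bounded_iff)
  qed
  have h_bd: "\<exists>M. 0 \<le> M \<and> (\<forall>t. \<bar>h t\<bar> \<le> M)" if bd: "bounded (range (\<lambda>t. x t - \<Gamma> t))"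
  proof -
    obtain D where D: "\<And>t. \<bar>x t - \<Gamma> t\<bar> \<le> D"
      using bd by (auto simp: Elementary_Metric_Spaces.bounded_iff)
    have "\<bar>h t\<bar> \<le> \<bar>l\<bar> + D\<^sup>2" for t
    proof -
      have "(x t - \<Gamma> t)\<^sup>2 \<le> D\<^sup>2"
        using D[of t] by (simp add: abs_le_square_iff[symmetric])
      then show ?thesis
        using zero_le_power2[of "x t - \<Gamma> t"] unfolding h_def by linarith
    qed
    then show ?thesis
      by (intro exI[of _ "\<bar>l\<bar> + D\<^sup>2"]) auto
  qed
  have has_integral_lip: "\<bar>w t - w s\<bar> \<le> M * (t - s)"
    if "0 \<le> M" "\<forall>t. \<bar>h t\<bar> \<le> M" "\<And>t. (w has_real_derivative h t) (at t)" "s \<le> t" for w M s t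
  proof -
    have "(h has_integral w t - w s) {s..t}"
      using that by (intro integral_DERIV) auto
    then have "norm (w t - w s) \<le> M * Henstock_Kurzweil_Integration.content {s..t}"
      using that by (intro has_integral_bound_real[where S = "{}"]) auto
    then show ?thesis
      using that by simp
  qed
  have Q_lip: "\<bar>Q t - Q s\<bar> \<le> C * (t - s)" if "s \<le> t" for s t
    using drift_boundedD(3)[OF q, of t s] that by (simp add: Q_def)
  have riccati_iff: "riccati_bounded_solution (potential q) l (\<lambda>t. x t - primitive 0 q t) \<longleftrightarrow>
      (\<forall>t. ((\<lambda>t. x t - Q t) has_real_derivative h t) (at t)) \<and> bounded (range (\<lambda>t. x t - \<Gamma> t))"
    by (simp add: riccati_bounded_solution_def riccati_solution_def Q_def h_def)
  show ?thesis
    unfolding riccati_iff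
  proof
    assume x: "bounded_solution \<Gamma> (\<lambda>t. q t + l) x"
    then have ac: "absolutely_continuous_on_interval x a b" if "a \<le> b" for a b
      using that by (auto simp: bounded_solution_def caratheodory_solution_def)
    have "AE t in lebesgue. (x has_real_derivative - (x t - \<Gamma> t)\<^sup>2 + (q t + l)) (at t)"
      using x by (auto simp: bounded_solution_def caratheodory_solution_def)
    then obtain N' where "N' \<in> null_sets lebesgue"
      and x_deriv: "\<And>t. t \<notin> N' \<Longrightarrow> (x has_real_derivative - (x t - \<Gamma> t)\<^sup>2 + (q t + l)) (at t)"
      by (auto simp: eventually_ae_filter)
    then have N': "negligible N'"
      by (simp add: negligible_iff_null_sets)
    have bd: "bounded (range (\<lambda>t. x t - \<Gamma> t))"
      using x bounded_iff by (simp add: bounded_solution_def)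
    then obtain M where M: "0 \<le> M" "\<forall>t. \<bar>h t\<bar> \<le> M"
      using h_bd by auto
    have h_cont: "continuous_on UNIV h"
      unfolding h_def
      by (intro continuous_intros absolutely_continuous_imp_continuous ac \<Gamma>_continuous)
    define J where "J = primitive 0 h"
    have J: "(J has_real_derivative h t) (at t)" for t
      unfolding J_def by (intro DERIV_primitive h_cont)
    \<comment> \<open>All three terms are absolutely continuous and the derivative of
      \<open>w\<close> vanishes almost everywhere. Hence \<open>x - Q\<close> differs from the
      smooth function \<open>J\<close> by a constant and satisfies its equation at every
      point.\<close>
    define w where "w t = x t - Q t - J t" for t
    have w_const: "w b = w a" if "a \<le> b" for a b
    proof (rule absolutely_continuous_DERIV_zero[OF _ that])
      show "absolutely_continuous_on_interval w a b"
        unfolding w_def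
        by (intro absolutely_continuous_on_interval_diff ac that
            lipschitz_imp_absolutely_continuous[OF Q_lip]
            lipschitz_imp_absolutely_continuous[OF has_integral_lip[OF M J]])
      show "negligible (N \<union> N')"
        using N N' by (rule negligible_Un)
      fix t assume "t \<notin> N \<union> N'"
      then have "(w has_real_derivative (- (x t - \<Gamma> t)\<^sup>2 + (q t + l)) - q t - h t) (at t)"
        unfolding w_def by (intro DERIV_diff x_deriv Q_deriv J) auto
      then show "(w has_real_derivative 0) (at t)"
        by (simp add: h_def)
    qed
    then have "w t = w 0" for t
      by (metis linear)
    then have "(\<lambda>t. x t - Q t) = (\<lambda>t. w 0 + J t)"
      by (auto simp: w_def fun_eq_iff algebra_simps)
    moreover have "((\<lambda>t. w 0 + J t) has_real_derivative h t) (at t)" for t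
      by (auto intro!: derivative_eq_intros J)
    ultimately show "(\<forall>t. ((\<lambda>t. x t - Q t) has_real_derivative h t) (at t)) \<and>
        bounded (range (\<lambda>t. x t - \<Gamma> t))"
      using bd by simp
  next
    assume *: "(\<forall>t. ((\<lambda>t. x t - Q t) has_real_derivative h t) (at t)) \<and>
        bounded (range (\<lambda>t. x t - \<Gamma> t))"
    then obtain M where M: "0 \<le> M" "\<forall>t. \<bar>h t\<bar> \<le> M"
      using h_bd by auto
    have "\<bar>x t - x s\<bar> \<le> (M + C) * (t - s)" if "s \<le> t" for s t
      using has_integral_lip[OF M, of "\<lambda>t. x t - Q t" s t] Q_lip[OF that] * that
      by (simp add: algebra_simps abs_le_iff)
    then have "absolutely_continuous_on_interval x a b" for a b
      by (rule lipschitz_imp_absolutely_continuous)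
    moreover have "AE t in lebesgue. (x has_real_derivative - (x t - \<Gamma> t)\<^sup>2 + (q t + l)) (at t)"
    proof (rule AE_I')
      show "N \<in> null_sets lebesgue"
        using N by (simp add: negligible_iff_null_sets)
      show "{t \<in> space lebesgue. \<not> (x has_real_derivative - (x t - \<Gamma> t)\<^sup>2 + (q t + l)) (at t)} \<subseteq> N"
      proof safe
        fix t assume "\<not> (x has_real_derivative - (x t - \<Gamma> t)\<^sup>2 + (q t + l)) (at t)"
        then show "t \<in> N"
          using DERIV_add[OF spec[OF conjunct1[OF *], of t] Q_deriv[of t]]
          by (auto simp: h_def algebra_simps)
      qed
    qed
    ultimately show "bounded_solution \<Gamma> (\<lambda>t. q t + l) x"
      using * bounded_iff by (simp add: bounded_solution_def caratheodory_solution_def)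
  qed
qed

lemma ex_bounded_solution_iff_riccati:
  assumes q: "drift_bounded C q"
  shows "(\<exists>x. bounded_solution \<Gamma> (\<lambda>t. q t + l) x) \<longleftrightarrow> (\<exists>z. riccati_bounded_solution (potential q) l z)"
proof
  assume "\<exists>z. riccati_bounded_solution (potential q) l z"
  then obtain z where "riccati_bounded_solution (potential q) l z" ..
  then have "bounded_solution \<Gamma> (\<lambda>t. q t + l) (\<lambda>t. z t + primitive 0 q t)"
    by (subst bounded_solution_iff_riccati[OF q]) simp
  then show "\<exists>x. bounded_solution \<Gamma> (\<lambda>t. q t + l) x"
    by blast
qed (auto simp: bounded_solution_iff_riccati[OF q])

text \<open>The zero function in the original variable, which is \<open>- primitive 0 q\<close>
  here, is a subsolution as soon as the parameter exceeds the forcing bound \<open>C\<close> plus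
  \<open>B\<^sup>2\<close>. The lower bound is minus the coarse Lipschitz constant of the
  potential.\<close>

lemma lambda_star_threshold:
  assumes q: "drift_bounded C q"
  shows "- (2 * B + C) \<le> lambda_star \<Gamma> q \<and> lambda_star \<Gamma> q \<le> C + B\<^sup>2 \<and>
    (\<forall>l. lambda_star \<Gamma> q \<le> l \<longleftrightarrow> (\<exists>z. riccati_bounded_solution (potential q) l z))"
proof -
  have sub: "riccati_subsolution (potential q) (C + B\<^sup>2) (\<lambda>t. - primitive 0 q t)"
    unfolding riccati_subsolution_def
  proof safe
    show "continuous_on UNIV (\<lambda>t. - primitive 0 q t)"
      by (intro continuous_intros drift_boundedD(4)[OF q])
    fix s t :: real assume "s \<le> t"
    have "- primitive 0 q t - - primitive 0 q s \<le> C * (t - s)"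
      using drift_boundedD(3)[OF q, of t s] \<open>s \<le> t\<close> by (simp add: abs_le_iff)
    also have "\<dots> = integral {s..t} (\<lambda>x. C)"
      using \<open>s \<le> t\<close> by (simp add: mult.commute)
    also have "\<dots> \<le> integral {s..t} (\<lambda>x. C + B\<^sup>2 - (- primitive 0 q x - potential q x)\<^sup>2)"
    proof (intro integral_le integrable_on_of_continuous_UNIV continuous_intros \<Gamma>_continuous
        drift_boundedD(4)[OF q])
      show "C \<le> C + B\<^sup>2 - (- primitive 0 q x - potential q x)\<^sup>2" for x
        using \<Gamma>_bound[of x] by (simp add: abs_le_square_iff[symmetric])
    qed
    finally show "- primitive 0 q t - - primitive 0 q s
        \<le> integral {s..t} (\<lambda>x. C + B\<^sup>2 - (- primitive 0 q x - potential q x)\<^sup>2)" .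
  qed
  obtain l0 where "- (2 * B + C) \<le> l0" "l0 \<le> C + B\<^sup>2"
    and l0: "\<And>l. (\<exists>z. riccati_bounded_solution (potential q) l z) \<longleftrightarrow> l0 \<le> l"
    by (rule riccati_threshold[OF coarse_lipschitz_potential[OF q] sub, of B]) (use \<Gamma>_bound in auto)
  moreover have "lambda_star \<Gamma> q = l0"
    unfolding lambda_star_def ex_bounded_solution_iff_riccati[OF q] l0
    by (rule the_equality) (auto intro: antisym)
  ultimately show ?thesis
    by simp
qed

lemma lambda_star_le_iff:
  "drift_bounded C q \<Longrightarrow> lambda_star \<Gamma> q \<le> l \<longleftrightarrow> (\<exists>z. riccati_bounded_solution (potential q) l z)"
  using lambda_star_threshold by blast

lemma abs_lambda_star_le:
  assumes "drift_bounded C q"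
  shows "\<bar>lambda_star \<Gamma> q\<bar> \<le> 2 * B + C + B\<^sup>2"
  using lambda_star_threshold[OF assms] bound_nonneg zero_le_power2[of B] by linarith

text \<open>The hypothesis is the integrated form of
  \<open>\<bar>q' - q\<bar> \<le> \<epsilon>\<close>, so the threshold is 1-Lipschitz for the
  uniform distance of forcings. The hypothesis is symmetric, so the reverse inequality follows by
  exchanging the roles.\<close>

lemma lambda_star_drift_le:
  assumes q: "drift_bounded C q" and q': "drift_bounded C' q'"
    and drift: "\<And>s t. s \<le> t \<Longrightarrow>
      \<bar>(primitive 0 q' t - primitive 0 q t) - (primitive 0 q' s - primitive 0 q s)\<bar> \<le> \<epsilon> * (t - s)"
  shows "lambda_star \<Gamma> q' \<le> lambda_star \<Gamma> q + \<epsilon>"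
proof -
  define H where "H t = primitive 0 q' t - primitive 0 q t" for t
  obtain z where z: "riccati_bounded_solution (potential q) (lambda_star \<Gamma> q) z"
    using lambda_star_le_iff[OF q, of "lambda_star \<Gamma> q"] by auto
  have "riccati_subsolution (\<lambda>t. potential q t - H t) (lambda_star \<Gamma> q + \<epsilon>) (\<lambda>t. z t - H t)"
  proof (rule riccati_subsolution_perturb_drift)
    show "riccati_solution (potential q) (lambda_star \<Gamma> q) z"
      using z by (simp add: riccati_bounded_solution_def)
    show "continuous_on UNIV (potential q)" "continuous_on UNIV H"
      unfolding H_def
      by (intro continuous_intros \<Gamma>_continuous drift_boundedD(4)[OF q] drift_boundedD(4)[OF q'])+
    show "H s - H t \<le> \<epsilon> * (t - s)" if "s \<le> t" for s t
      using drift[OF that] by (simp add: H_def abs_le_iff)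
  qed
  moreover have "(\<lambda>t. potential q t - H t) = potential q'"
    by (simp add: H_def)
  ultimately have sub: "riccati_subsolution (potential q') (lambda_star \<Gamma> q + \<epsilon>) (\<lambda>t. z t - H t)"
    by simp
  have "\<bar>z t - H t - potential q' t\<bar> \<le> \<bar>lambda_star \<Gamma> q\<bar> + 2 * (2 * B + C) + 1" for t
    using riccati_bounded_solution_bound[OF coarse_lipschitz_potential[OF q] z, of t]
    by (simp add: H_def algebra_simps)
  then show ?thesis
    unfolding lambda_star_le_iff[OF q']
    using maximal_riccati_bounded_solution[OF coarse_lipschitz_potential[OF q'] sub] by metis
qed

end

section \<open>Translates and continuity of the threshold along them\<close>

lemma Linf_shift: "q \<in> Linf \<Longrightarrow> shift q s \<in> Linf"
proof -
  assume q: "q \<in> Linf"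
  then obtain C where C: "AE t in lebesgue. \<bar>q t\<bar> \<le> C"
    by (auto simp: Linf_def)
  then obtain N where N: "N \<in> null_sets lebesgue" "\<And>t. t \<notin> N \<Longrightarrow> \<bar>q t\<bar> \<le> C"
    by (auto simp: eventually_ae_filter)
  have "negligible ((+) (- s) ` N)"
    using N by (intro negligible_translation) (simp add: negligible_iff_null_sets)
  then have "AE t in lebesgue. \<bar>shift q s t\<bar> \<le> C"
  proof (intro AE_I')
    show "{t \<in> space lebesgue. \<not> \<bar>shift q s t\<bar> \<le> C} \<subseteq> (+) (- s) ` N"
    proof safe
      fix t assume "\<not> \<bar>shift q s t\<bar> \<le> C"
      then have "s + t \<in> N"
        using N(2) by (auto simp: shift_def)
      then show "t \<in> (+) (- s) ` N"
        by (intro image_eqI[of _ _ "s + t"]) auto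
    qed
  qed (simp add: negligible_iff_null_sets)
  moreover have "shift q s \<in> borel_measurable lebesgue"
  proof (rule measurableI)
    fix A :: "real set" assume "A \<in> sets borel"
    then have "q -` A \<inter> space lebesgue \<in> sets lebesgue"
      using q by (intro measurable_sets) (auto simp: Linf_def)
    then have "(+) (- s) ` (q -` A) \<in> sets lebesgue"
      by (intro lebesgue_sets_translation) simp
    moreover have "(+) (- s) ` (q -` A) = shift q s -` A \<inter> space lebesgue"
      by (force simp: shift_def image_iff)
    ultimately show "shift q s -` A \<inter> space lebesgue \<in> sets lebesgue"
      by simp
  qed simp
  ultimately show ?thesis
    by (auto simp: Linf_def)
qed

lemma primitive_shift:
  assumes "q \<in> Linf"
  shows "primitive 0 (shift q s) t = primitive 0 q (s + t) - primitive 0 q s"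
proof -
  have eq: "integral {a..b} (shift q s) = integral {a + s..b + s} q" for a b
    using integral_shift_Icc_real[of a b q s] by (simp add: shift_def comp_def)
  have "primitive 0 q (s + t) - primitive 0 q s = integral {s..s + t} q" if "0 \<le> t"
    using that by (intro primitive_diff Linf_integrable_on assms) auto
  moreover have "primitive 0 q s - primitive 0 q (s + t) = integral {s + t..s} q" if "t \<le> 0"
    using that by (intro primitive_diff Linf_integrable_on assms) auto
  ultimately show ?thesis
    by (cases t "0 :: real" rule: linorder_cases)
       (auto simp: primitive_def[of 0 "shift q s"] eq add.commute)
qed

lemma drift_bounded_shift:
  assumes "drift_bounded C q"
  shows "drift_bounded C (shift q s)"
  unfolding drift_bounded_def
proof safe
  have q: "q \<in> Linf"
    using drift_boundedD(1)[OF assms] .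
  then show "shift q s \<in> Linf"
    by (rule Linf_shift)
  show "\<bar>primitive 0 (shift q s) t - primitive 0 (shift q s) r\<bar> \<le> C * (t - r)" if "r \<le> t" for r t
    using drift_boundedD(3)[OF assms, of "s + t" "s + r"] that by (simp add: primitive_shift[OF q])
qed

lemma riccati_bounded_solution_translate:
  assumes "riccati_bounded_solution G l z"
  shows "riccati_bounded_solution (\<lambda>t. G (s + t) + c) l (\<lambda>t. z (s + t) + c)"
proof -
  have "((\<lambda>t. z (s + t) + c) has_real_derivative l - (z (s + t) + c - (G (s + t) + c))\<^sup>2) (at t)" for t
  proof -
    have "(z has_real_derivative l - (z (s + t) - G (s + t))\<^sup>2) (at (s + t))"
      using assms by (simp add: riccati_bounded_solution_def riccati_solution_def)
    then have "((\<lambda>t. z (s + t)) has_real_derivative l - (z (s + t) - G (s + t))\<^sup>2) (at t)"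
      using DERIV_shift[of z _ t s] by (simp add: add.commute)
    then show ?thesis
      by (auto intro!: derivative_eq_intros)
  qed
  moreover have "bounded (range (\<lambda>t. z (s + t) + c - (G (s + t) + c)))"
    by (rule bounded_subset[of "range (\<lambda>t. z t - G t)"])
       (use assms in \<open>auto simp: riccati_bounded_solution_def\<close>)
  ultimately show ?thesis
    by (simp add: riccati_bounded_solution_def riccati_solution_def)
qed

context bounded_guide
begin

text \<open>Translating time back moves the shift onto \<Gamma>; the constant
  \<open>primitive 0 q s\<close> cancels in \<open>z - G\<close>. Comparing two translates thus
  compares two shifts of \<Gamma> over the same primitive, without any regularity of
  \<open>q\<close>.\<close>

lemma lambda_star_shift_le_iff:
  assumes q: "drift_bounded C q"
  shows "lambda_star \<Gamma> (shift q s) \<le> l \<longleftrightarrow>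
    (\<exists>z. riccati_bounded_solution (\<lambda>t. \<Gamma> (t - s) - primitive 0 q t) l z)"
proof -
  have eq: "primitive 0 (shift q s) t = primitive 0 q (s + t) - primitive 0 q s" for t
    using primitive_shift drift_boundedD(1)[OF q] .
  have "(\<exists>z. riccati_bounded_solution (potential (shift q s)) l z) \<longleftrightarrow>
    (\<exists>z. riccati_bounded_solution (\<lambda>t. \<Gamma> (t - s) - primitive 0 q t) l z)"
  proof safe
    fix z assume "riccati_bounded_solution (potential (shift q s)) l z"
    from riccati_bounded_solution_translate[OF this, of "- s" "- primitive 0 q s"]
    show "\<exists>z. riccati_bounded_solution (\<lambda>t. \<Gamma> (t - s) - primitive 0 q t) l z"
      by (auto simp: eq)
  next
    fix z assume "riccati_bounded_solution (\<lambda>t. \<Gamma> (t - s) - primitive 0 q t) l z"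
    from riccati_bounded_solution_translate[OF this, of s "primitive 0 q s"]
    have "riccati_bounded_solution (potential (shift q s)) l (\<lambda>t. z (s + t) + primitive 0 q s)"
      by (simp add: eq algebra_simps)
    then show "\<exists>z. riccati_bounded_solution (potential (shift q s)) l z"
      by blast
  qed
  then show ?thesis
    using lambda_star_le_iff[OF drift_bounded_shift[OF q]] by simp
qed

text \<open>\<open>R\<close> adds the bound for the threshold to the term \<open>2 * K + 1\<close>
  of the a priori bound, with \<open>K = 2 * B + C\<close>. It is independent of \<open>s\<close>,
  which makes the estimate uniform.\<close>

lemma lambda_star_shift_perturb:
  assumes q: "drift_bounded C q" and \<delta>: "\<And>t. \<bar>\<Gamma> (t - s') - \<Gamma> (t - s)\<bar> \<le> \<delta>"
    and R: "2 * B + C + B\<^sup>2 + 2 * (2 * B + C) + 1 \<le> R"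
  shows "lambda_star \<Gamma> (shift q s') \<le> lambda_star \<Gamma> (shift q s) + \<delta> * (2 * R + \<delta>)"
proof -
  define l where "l = lambda_star \<Gamma> (shift q s)"
  define G where "G s t = \<Gamma> (t - s) - primitive 0 q t" for s t
  have G: "coarse_lipschitz (2 * B + C) (G s)" for s
    unfolding G_def by (rule coarse_lipschitz_potential_shift[OF q])
  obtain z where z: "riccati_bounded_solution (G s) l z"
    using lambda_star_shift_le_iff[OF q, of s l] by (auto simp: l_def G_def[abs_def])
  have bd: "\<bar>z t - G s t\<bar> \<le> R" for t
    using riccati_bounded_solution_bound[OF G z, of t] abs_lambda_star_le[OF drift_bounded_shift[OF q], of s] R
    by (simp add: l_def)
  have close: "\<bar>G s' t - G s t\<bar> \<le> \<delta>" for t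
    using \<delta> by (simp add: G_def)
  have "riccati_subsolution (G s') (l + \<delta> * (2 * R + \<delta>)) z"
  proof (rule riccati_subsolution_perturb_uniform[OF _ _ _ bd close])
    show "riccati_solution (G s) l z"
      using z by (simp add: riccati_bounded_solution_def)
  qed (use G in \<open>auto simp: coarse_lipschitz_def\<close>)
  moreover have "\<bar>z t - G s' t\<bar> \<le> R + \<delta>" for t
    using bd[of t] close[of t] by linarith
  ultimately have "\<exists>z. riccati_bounded_solution (G s') (l + \<delta> * (2 * R + \<delta>)) z"
    using maximal_riccati_bounded_solution[OF G] by metis
  then show ?thesis
    using lambda_star_shift_le_iff[OF q] by (simp add: l_def G_def[abs_def])
qed

lemma uniformly_continuous_lambda_star_shift:
  assumes q: "drift_bounded C q" and uc: "uniformly_continuous_on UNIV \<Gamma>"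
  shows "uniformly_continuous_on UNIV (\<lambda>s. lambda_star \<Gamma> (shift q s))"
  unfolding uniformly_continuous_on_def
proof (intro allI impI)
  fix e :: real assume "0 < e"
  define R where "R = 2 * B + C + B\<^sup>2 + 2 * (2 * B + C) + 1"
  have R: "0 < R"
    using bound_nonneg drift_boundedD(2)[OF q] by (simp add: R_def add_nonneg_pos)
  \<comment> \<open>The cap 1 replaces the quadratic cost
    \<open>\<delta> * (2 * R + \<delta>)\<close> by the linear one
    \<open>\<delta> * (2 * R + 1)\<close>.\<close>
  define \<delta> where "\<delta> = min 1 (e / 2 / (2 * R + 1))"
  have \<delta>: "0 < \<delta>" "\<delta> \<le> 1"
    using \<open>0 < e\<close> R by (auto simp: \<delta>_def)
  have "\<delta> * (2 * R + \<delta>) \<le> (e / 2 / (2 * R + 1)) * (2 * R + 1)"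
    using R \<delta> by (intro mult_mono) (auto simp: \<delta>_def)
  also have "\<dots> = e / 2"
    using R by (subst times_divide_eq_left, subst nonzero_mult_div_cancel_right) auto
  also have "\<dots> < e"
    using \<open>0 < e\<close> by simp
  finally have small: "\<delta> * (2 * R + \<delta>) < e" .
  obtain d where "0 < d" and d: "\<And>x y. dist y x < d \<Longrightarrow> dist (\<Gamma> y) (\<Gamma> x) < \<delta>"
    using uc \<delta>(1) unfolding uniformly_continuous_on_def by auto
  show "\<exists>d>0. \<forall>s\<in>UNIV. \<forall>s'\<in>UNIV. dist s' s < d \<longrightarrow>
      dist (lambda_star \<Gamma> (shift q s')) (lambda_star \<Gamma> (shift q s)) < e"
  proof (intro exI[of _ d] conjI \<open>0 < d\<close> ballI impI)
    fix s s' :: real assume "dist s' s < d"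
    then have "\<bar>\<Gamma> (t - s') - \<Gamma> (t - s)\<bar> \<le> \<delta>" "\<bar>\<Gamma> (t - s) - \<Gamma> (t - s')\<bar> \<le> \<delta>" for t
      using d[of "t - s'" "t - s"] d[of "t - s" "t - s'"] by (auto simp: dist_real_def abs_minus_commute less_imp_le)
    then show "dist (lambda_star \<Gamma> (shift q s')) (lambda_star \<Gamma> (shift q s)) < e"
      using lambda_star_shift_perturb[OF q, of s' s \<delta> R] lambda_star_shift_perturb[OF q, of s s' \<delta> R] small
      by (simp add: R_def dist_real_def abs_less_iff)
  qed
qed

end

subsection \<open>The hull\<close>

lemma topspace_sigma_topology: "topspace sigma_topology = Linf"
proof -
  have "f \<in> \<Union>{{f \<in> Linf. seminorm_int r1 r2 (\<lambda>t. f t - g t) < \<epsilon>} | r1 r2 g \<epsilon>.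
        r1 \<in> \<rat> \<and> r2 \<in> \<rat> \<and> r1 < r2 \<and> g \<in> Linf \<and> 0 < \<epsilon>}" if "f \<in> Linf" for f
  proof -
    have "f \<in> {h \<in> Linf. seminorm_int 0 1 (\<lambda>t. h t - f t) < 1}"
      using that by (simp add: seminorm_int_def)
    moreover have "\<exists>r1 r2 g \<epsilon>. {h \<in> Linf. seminorm_int 0 1 (\<lambda>t. h t - f t) < 1}
        = {h \<in> Linf. seminorm_int r1 r2 (\<lambda>t. h t - g t) < \<epsilon>} \<and>
        r1 \<in> \<rat> \<and> r2 \<in> \<rat> \<and> r1 < r2 \<and> g \<in> Linf \<and> 0 < \<epsilon>"
      using that by (intro exI[of _ 0] exI[of _ 1] exI[of _ f]) auto
    ultimately show ?thesis
      by blast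
  qed
  then show ?thesis
    unfolding sigma_topology_def topology_generated_by_topspace by blast
qed

text \<open>Primitives vanish at the rational point 0, so the seminorm of the interval between 0 and
  \<open>r\<close> measures exactly the difference of the primitives at \<open>r\<close>.\<close>

lemma openin_sigma_primitive_ball:
  assumes g: "g \<in> Linf" and r: "r \<in> \<rat>" and \<epsilon>: "0 < \<epsilon>"
  shows "openin sigma_topology {f \<in> Linf. \<bar>primitive 0 f r - primitive 0 g r\<bar> < \<epsilon>}"
proof -
  have eq: "seminorm_int r1 r2 (\<lambda>t. f t - g t)
      = \<bar>(primitive 0 f r2 - primitive 0 g r2) - (primitive 0 f r1 - primitive 0 g r1)\<bar>"
    if "f \<in> Linf" "r1 \<le> r2" for f r1 r2
    using that g
    by (simp add: seminorm_int_eq[OF Linf_diff] integral_diff Linf_integrable_on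
        flip: primitive_diff[OF Linf_integrable_on, of _ r1 r2 0])
  have basic: "openin sigma_topology {f \<in> Linf. seminorm_int r1 r2 (\<lambda>t. f t - g t) < \<epsilon>}"
    if "r1 \<in> \<rat>" "r2 \<in> \<rat>" "r1 < r2" for r1 r2
    unfolding sigma_topology_def using that g \<epsilon> by (intro topology_generated_by_Basis) blast
  show ?thesis
  proof (cases r "0 :: real" rule: linorder_cases)
    case less
    then have "{f \<in> Linf. seminorm_int r 0 (\<lambda>t. f t - g t) < \<epsilon>}
        = {f \<in> Linf. \<bar>primitive 0 f r - primitive 0 g r\<bar> < \<epsilon>}"
      by (auto simp: eq abs_minus_commute)
    with basic[of r 0] r less show ?thesis
      by simp
  next
    case equal
    then show ?thesis
      using openin_topspace[of sigma_topology] \<epsilon> by (simp add: topspace_sigma_topology)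
  next
    case greater
    then have "{f \<in> Linf. seminorm_int 0 r (\<lambda>t. f t - g t) < \<epsilon>}
        = {f \<in> Linf. \<bar>primitive 0 f r - primitive 0 g r\<bar> < \<epsilon>}"
      by (auto simp: eq)
    with basic[of 0 r] r greater show ?thesis
      by simp
  qed
qed

lemma openin_sigma_finite:
  assumes g: "g \<in> Linf" and I: "finite I" "I \<subseteq> \<rat>" and \<epsilon>: "0 < \<epsilon>"
  shows "openin sigma_topology {f \<in> Linf. \<forall>r\<in>I. \<bar>primitive 0 f r - primitive 0 g r\<bar> < \<epsilon>}"
  using I
proof (induction I rule: finite_induct)
  case empty
  then show ?case
    using openin_topspace[of sigma_topology] by (simp add: topspace_sigma_topology)
next
  case (insert r I)
  have "{f \<in> Linf. \<forall>r\<in>insert r I. \<bar>primitive 0 f r - primitive 0 g r\<bar> < \<epsilon>}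
      = {f \<in> Linf. \<bar>primitive 0 f r - primitive 0 g r\<bar> < \<epsilon>}
        \<inter> {f \<in> Linf. \<forall>r\<in>I. \<bar>primitive 0 f r - primitive 0 g r\<bar> < \<epsilon>}"
    by auto
  with insert openin_sigma_primitive_ball[OF g _ \<epsilon>, of r] show ?case
    by (auto intro!: openin_Int)
qed

text \<open>
  On sets with a common drift bound, the seminorm topology makes primitives converge locally
  uniformly: finitely many rational end points suffice on a compact interval.
\<close>

lemma sigma_neighbourhood:
  assumes g: "drift_bounded C g" and \<epsilon>: "0 < \<epsilon>"
  obtains U where "openin sigma_topology U" "g \<in> U"
    "\<And>f t. f \<in> U \<Longrightarrow> drift_bounded C f \<Longrightarrow> \<bar>t\<bar> \<le> N \<Longrightarrow> \<bar>primitive 0 f t - primitive 0 g t\<bar> < \<epsilon>"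
proof -
  have C: "0 \<le> C" and g': "g \<in> Linf"
    using drift_boundedD[OF g] by auto
  \<comment> \<open>Between \<open>t\<close> and its grid point each of the two primitives moves by
    at most \<open>C / m \<le> \<epsilon> / 4\<close>; the other half of \<epsilon> is spent at the
    grid point.\<close>
  obtain m :: nat where m: "4 * C / \<epsilon> < real m" "0 < m"
    using reals_Archimedean2[of "max 1 (4 * C / \<epsilon>)"] by (metis max_less_iff_conj of_nat_0_less_iff zero_less_one less_trans)
  define M where "M = \<lceil>\<bar>N\<bar> * m\<rceil> + 1"
  define I where "I = (\<lambda>k. real_of_int k / real m) ` {-M..M}"
  define U where "U = {f \<in> Linf. \<forall>r\<in>I. \<bar>primitive 0 f r - primitive 0 g r\<bar> < \<epsilon> / 2}"
  show thesis
  proof (rule that[of U])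
    show "openin sigma_topology U"
      unfolding U_def using g' \<epsilon> by (intro openin_sigma_finite) (auto simp: I_def)
    show "g \<in> U"
      using g' \<epsilon> by (simp add: U_def)
    fix f t assume f: "f \<in> U" "drift_bounded C f" and t: "\<bar>t\<bar> \<le> N"
    define k where "k = \<lfloor>t * m\<rfloor>"
    define r where "r = real_of_int k / real m"
    have "\<bar>t * m\<bar> \<le> \<bar>N\<bar> * m"
      using t by (simp add: abs_mult mult_right_mono)
    then have "k \<in> {-M..M}"
      unfolding k_def M_def by (simp add: abs_le_iff) linarith
    then have "\<bar>primitive 0 f r - primitive 0 g r\<bar> < \<epsilon> / 2"
      using f by (auto simp: U_def I_def r_def)
    moreover have "\<bar>t - r\<bar> \<le> 1 / m"
    proof -
      have "\<bar>t * m - k\<bar> \<le> 1"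
        unfolding k_def by linarith
      then have "\<bar>t * m - k\<bar> / m \<le> 1 / m"
        by (intro divide_right_mono) auto
      moreover have "t - r = (t * m - k) / m"
        using m by (simp add: r_def field_simps)
      ultimately show ?thesis
        by simp
    qed
    then have "C * \<bar>t - r\<bar> \<le> C * (1 / m)"
      using C by (intro mult_left_mono)
    moreover have "C * (1 / m) \<le> \<epsilon> / 4"
      using m \<epsilon> by (simp add: field_simps)
    ultimately show "\<bar>primitive 0 f t - primitive 0 g t\<bar> < \<epsilon>"
      using drift_boundedD(3)[OF f(2), of t r] drift_boundedD(3)[OF g, of t r]
      unfolding abs_less_iff abs_le_iff by linarith
  qed
qed

lemma time_hull_subset_Linf: "time_hull p \<subseteq> Linf"
  unfolding time_hull_def topspace_sigma_topology[symmetric] by (rule closure_of_subset_topspace)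

lemma time_hull_meets:
  assumes "q \<in> time_hull p" "openin sigma_topology U" "q \<in> U"
  obtains s where "shift p s \<in> U"
  using assms unfolding time_hull_def in_closure_of by blast

text \<open>Rational times near \<open>s\<close> and \<open>t\<close> allow comparison with a
  translate of \<open>p\<close>, whose constant is \<open>C\<close>. The constant \<open>C'\<close>
  that \<open>q\<close> has as an element of \<open>Linf\<close> multiplies only the error
  \<open>e\<close> and disappears in the limit.\<close>

lemma time_hull_drift_bounded:
  assumes p: "drift_bounded C p" and q: "q \<in> time_hull p"
  shows "drift_bounded C q"
  unfolding drift_bounded_def
proof safe
  show q': "q \<in> Linf"
    using q time_hull_subset_Linf by auto
  then obtain C' where C': "drift_bounded C' q"
    by (rule Linf_drift_bounded)
  fix s t :: real assume "s \<le> t"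
  have C_nonneg: "0 \<le> C" "0 \<le> C'"
    using drift_boundedD(2) p C' by auto
  have le: "\<bar>primitive 0 q t - primitive 0 q s\<bar> \<le> C * (t - s) + (2 * C' + 2 + 2 * C) * e" if "0 < e" for e
  proof -
    obtain a where a: "a \<in> \<rat>" "\<bar>a - s\<bar> < e"
      using Rats_dense_in_real[of "s - e" "s + e"] \<open>0 < e\<close> by (force simp: abs_less_iff)
    obtain b where b: "b \<in> \<rat>" "\<bar>b - t\<bar> < e"
      using Rats_dense_in_real[of "t - e" "t + e"] \<open>0 < e\<close> by (force simp: abs_less_iff)
    define U where "U = {f \<in> Linf. \<forall>r\<in>{a, b}. \<bar>primitive 0 f r - primitive 0 q r\<bar> < e}"
    have "openin sigma_topology U"
      unfolding U_def using q' a b \<open>0 < e\<close> by (intro openin_sigma_finite) auto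
    then obtain \<sigma> where "shift p \<sigma> \<in> U"
      using time_hull_meets[OF q, of U] q' \<open>0 < e\<close> by (auto simp: U_def)
    then have close: "\<bar>primitive 0 (shift p \<sigma>) a - primitive 0 q a\<bar> < e"
      "\<bar>primitive 0 (shift p \<sigma>) b - primitive 0 q b\<bar> < e"
      by (auto simp: U_def)
    have "C' * \<bar>a - s\<bar> \<le> C' * e" "C' * \<bar>b - t\<bar> \<le> C' * e"
      using a b C_nonneg by (auto intro!: mult_left_mono)
    moreover have "C * \<bar>b - a\<bar> \<le> C * (t - s + 2 * e)"
      using a b C_nonneg \<open>s \<le> t\<close> by (intro mult_left_mono) auto
    moreover note drift_boundedD(3)[OF C', of a s] drift_boundedD(3)[OF C', of b t]
      drift_boundedD(3)[OF drift_bounded_shift[OF p], of \<sigma> b a] close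
    ultimately have "\<bar>primitive 0 q t - primitive 0 q s\<bar> \<le> C' * e + C' * e + 2 * e + C * (t - s + 2 * e)"
      unfolding abs_le_iff abs_less_iff by linarith
    then show ?thesis
      by (simp add: algebra_simps)
  qed
  show "\<bar>primitive 0 q t - primitive 0 q s\<bar> \<le> C * (t - s)"
  proof (rule field_le_epsilon)
    fix e :: real assume "0 < e"
    have pos: "0 < 2 * C' + 2 + 2 * C"
      using C_nonneg by simp
    then show "\<bar>primitive 0 q t - primitive 0 q s\<bar> \<le> C * (t - s) + e"
      using le[of "e / (2 * C' + 2 + 2 * C)"] \<open>0 < e\<close> by simp
  qed
qed

lemma time_hull_approx:
  assumes p: "drift_bounded C p" and q: "q \<in> time_hull p" and "0 < \<epsilon>"
  obtains s where "\<And>t. \<bar>t\<bar> \<le> N \<Longrightarrow> \<bar>primitive 0 (shift p s) t - primitive 0 q t\<bar> < \<epsilon>"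
proof -
  obtain U where U: "openin sigma_topology U" "q \<in> U"
    "\<And>f t. f \<in> U \<Longrightarrow> drift_bounded C f \<Longrightarrow> \<bar>t\<bar> \<le> N \<Longrightarrow> \<bar>primitive 0 f t - primitive 0 q t\<bar> < \<epsilon>"
    by (rule sigma_neighbourhood[OF time_hull_drift_bounded[OF p q] \<open>0 < \<epsilon>\<close>, of N]) blast
  obtain s where "shift p s \<in> U"
    by (rule time_hull_meets[OF q U(1,2)])
  then show thesis
    using that[of s] U(3)[OF _ drift_bounded_shift[OF p]] by blast
qed

lemma topspace_hull_topology: "topspace (hull_topology p) = time_hull p"
  unfolding hull_topology_def topspace_subtopology
  using time_hull_subset_Linf by (auto simp: topspace_sigma_topology)

lemma openin_hull_topologyI:
  assumes "S \<subseteq> time_hull p"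
    and "\<And>q. q \<in> S \<Longrightarrow> \<exists>U. openin sigma_topology U \<and> q \<in> U \<and> (\<forall>f\<in>U. f \<in> time_hull p \<longrightarrow> f \<in> S)"
  shows "openin (hull_topology p) S"
proof (subst openin_subopen, safe)
  fix q assume "q \<in> S"
  then obtain U where U: "openin sigma_topology U" "q \<in> U" "\<forall>f\<in>U. f \<in> time_hull p \<longrightarrow> f \<in> S"
    using assms(2) by blast
  show "\<exists>T. openin (hull_topology p) T \<and> q \<in> T \<and> T \<subseteq> S"
    using U \<open>q \<in> S\<close> assms(1)
    by (intro exI[of _ "U \<inter> time_hull p"]) (auto simp: hull_topology_def openin_subtopology)
qed

context bounded_guide
begin

text \<open>If every neighbourhood failed, windows \<open>n\<close> with tolerance
  \<open>1 / (n + 1)\<close> would give forcings with threshold at most \<open>c\<close> and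
  primitives converging pointwise. Compactness would then yield a bounded solution for
  \<open>q\<close> at the parameter \<open>c\<close>.\<close>

lemma lambda_star_lower_neighbourhood:
  assumes q: "drift_bounded C q" and c: "c < lambda_star \<Gamma> q"
  obtains U where "openin sigma_topology U" "q \<in> U"
    "\<And>f. f \<in> U \<Longrightarrow> drift_bounded C f \<Longrightarrow> c < lambda_star \<Gamma> f"
proof (rule ccontr)
  assume neg: "\<not> thesis"
  have "\<exists>f. drift_bounded C f \<and> lambda_star \<Gamma> f \<le> c \<and>
      (\<forall>t. \<bar>t\<bar> \<le> real n \<longrightarrow> \<bar>primitive 0 f t - primitive 0 q t\<bar> < inverse (real (Suc n)))" for n
  proof -
    obtain U where U: "openin sigma_topology U" "q \<in> U"
      "\<And>f t. f \<in> U \<Longrightarrow> drift_bounded C f \<Longrightarrow> \<bar>t\<bar> \<le> real n \<Longrightarrow>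
        \<bar>primitive 0 f t - primitive 0 q t\<bar> < inverse (real (Suc n))"
      by (rule sigma_neighbourhood[OF q, of "inverse (real (Suc n))" "real n"]) auto
    have "\<exists>f\<in>U. drift_bounded C f \<and> \<not> c < lambda_star \<Gamma> f"
    proof (rule ccontr)
      assume "\<not> ?thesis"
      then have "c < lambda_star \<Gamma> f" if "f \<in> U" "drift_bounded C f" for f
        using that by metis
      then show False
        by (rule notE[OF neg that[OF U(1,2)]])
    qed
    then obtain f where "f \<in> U" "drift_bounded C f" "lambda_star \<Gamma> f \<le> c"
      by (auto simp: not_less)
    then show ?thesis
      using U(3) by blast
  qed
  then obtain f where f: "\<And>n. drift_bounded C (f n)" "\<And>n. lambda_star \<Gamma> (f n) \<le> c"
    and close: "\<And>n t. \<bar>t\<bar> \<le> real n \<Longrightarrow> \<bar>primitive 0 (f n) t - primitive 0 q t\<bar> < inverse (real (Suc n))"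
    by metis
  have "\<exists>z. riccati_bounded_solution (potential (f n)) c z" for n
    using f(2)[of n] unfolding lambda_star_le_iff[OF f(1)] .
  then obtain z where z: "\<And>n. riccati_bounded_solution (potential (f n)) c (z n)"
    by metis
  have conv: "(\<lambda>n. potential (f n) t) \<longlonglongrightarrow> potential q t" for t
  proof -
    have "(\<lambda>n. primitive 0 (f n) t - primitive 0 q t) \<longlonglongrightarrow> 0"
    proof (rule Lim_null_comparison[OF _ LIMSEQ_inverse_real_of_nat])
      have "\<forall>\<^sub>F n in sequentially. n \<ge> nat \<lceil>\<bar>t\<bar>\<rceil>"
        by (rule eventually_ge_at_top)
      then show "\<forall>\<^sub>F n in sequentially. norm (primitive 0 (f n) t - primitive 0 q t) \<le> inverse (real (Suc n))"
      proof eventually_elim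
        case (elim n)
        then have "\<bar>t\<bar> \<le> real n"
          by linarith
        from close[OF this] show ?case
          by simp
      qed
    qed
    then have "(\<lambda>n. primitive 0 (f n) t) \<longlonglongrightarrow> primitive 0 q t"
      by (simp add: LIM_zero_iff)
    then show ?thesis
      by (intro tendsto_intros)
  qed
  have cont: "continuous_on UNIV (potential q)"
    using coarse_lipschitz_potential[OF q] by (simp add: coarse_lipschitz_def)
  have deriv: "(z n has_real_derivative c - (z n t - potential (f n) t)\<^sup>2) (at t)" for n t
    using z by (simp add: riccati_bounded_solution_def riccati_solution_def)
  obtain w where "riccati_bounded_solution (potential q) c w"
    by (rule riccati_compactness[OF conv cont tendsto_const deriv
        riccati_bounded_solution_bound[OF coarse_lipschitz_potential[OF f(1)] z]])
  then show False
    using lambda_star_le_iff[OF q, of c] c by auto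
qed

text \<open>Neighbourhoods of \<open>q\<close> contain translates of \<open>p\<close>, but not a
  prescribed one, so semicontinuity gives the supremum over translates. Its boundedness is recorded
  because a real supremum is meaningful only then.\<close>

lemma lambda_star_le_SUP:
  assumes p: "drift_bounded C p"
  shows "bdd_above (range (\<lambda>s. lambda_star \<Gamma> (shift p s)))"
    and "q \<in> time_hull p \<Longrightarrow> lambda_star \<Gamma> q \<le> (SUP s. lambda_star \<Gamma> (shift p s))"
proof -
  have "lambda_star \<Gamma> (shift p s) \<le> 2 * B + C + B\<^sup>2" for s
    using abs_lambda_star_le[OF drift_bounded_shift[OF p], of s] by linarith
  then show bdd: "bdd_above (range (\<lambda>s. lambda_star \<Gamma> (shift p s)))"
    by (auto intro!: bdd_aboveI)
  assume q: "q \<in> time_hull p"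
  show "lambda_star \<Gamma> q \<le> (SUP s. lambda_star \<Gamma> (shift p s))"
  proof (rule ccontr)
    assume "\<not> ?thesis"
    then obtain U where U: "openin sigma_topology U" "q \<in> U"
      "\<And>f. f \<in> U \<Longrightarrow> drift_bounded C f \<Longrightarrow> (SUP s. lambda_star \<Gamma> (shift p s)) < lambda_star \<Gamma> f"
      by (auto simp: not_le elim: lambda_star_lower_neighbourhood[OF time_hull_drift_bounded[OF p q]])
    obtain s where "shift p s \<in> U"
      using time_hull_meets[OF q U(1,2)] .
    then have "(SUP s. lambda_star \<Gamma> (shift p s)) < lambda_star \<Gamma> (shift p s)"
      using U(3) drift_bounded_shift[OF p] by blast
    moreover have "lambda_star \<Gamma> (shift p s) \<le> (SUP s. lambda_star \<Gamma> (shift p s))"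
      by (rule cSUP_upper[OF UNIV_I bdd])
    ultimately show False
      by linarith
  qed
qed

lemma lower_semicontinuous_lambda_star:
  assumes p: "drift_bounded C p"
  shows "lower_semicontinuous_map (hull_topology p) (lambda_star \<Gamma>)"
  unfolding lower_semicontinuous_map_def topspace_hull_topology
proof (intro allI openin_hull_topologyI)
  fix c q assume "q \<in> {x \<in> time_hull p. c < lambda_star \<Gamma> x}"
  then have q: "q \<in> time_hull p" "c < lambda_star \<Gamma> q"
    by auto
  obtain U where "openin sigma_topology U" "q \<in> U"
    "\<And>f. f \<in> U \<Longrightarrow> drift_bounded C f \<Longrightarrow> c < lambda_star \<Gamma> f"
    by (rule lambda_star_lower_neighbourhood[OF time_hull_drift_bounded[OF p q(1)] q(2)]) blast
  then show "\<exists>U. openin sigma_topology U \<and> q \<in> U \<and>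
      (\<forall>f\<in>U. f \<in> time_hull p \<longrightarrow> f \<in> {x \<in> time_hull p. c < lambda_star \<Gamma> x})"
    using time_hull_drift_bounded[OF p] by blast
qed auto

text \<open>A bounded solution \<open>x\<close> for the parameter \<open>- \<rho>\<close> is a
  subsolution for 0 and, after reflection, again one. It therefore lies between the extremal
  solutions, and both gaps receive the source term \<rho> that yields the rate
  \<open>2 * sqrt \<rho>\<close>.\<close>

lemma attractor_repeller_pair_exists:
  assumes q: "drift_bounded C q" and \<rho>: "0 < \<rho>" "lambda_star \<Gamma> q \<le> - \<rho>"
  shows "\<exists>a r. attractor_repeller_pair \<Gamma> q a r"
proof -
  define Q G where "Q = primitive 0 q" and "G = potential q"
  have G: "coarse_lipschitz (2 * B + C) G"
    unfolding G_def by (rule coarse_lipschitz_potential[OF q])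
  have G_cont: "continuous_on S G" for S
    using G by (auto simp: coarse_lipschitz_def intro: continuous_on_subset)
  obtain x where x: "riccati_bounded_solution G (0 - \<rho>) x"
    using lambda_star_le_iff[OF q] \<rho> by (auto simp: G_def)
  have sub: "riccati_subsolution G 0 x"
    using x \<rho> G_cont by (intro riccati_solution_imp_subsolution[of G "0 - \<rho>"])
      (auto simp: riccati_bounded_solution_def)
  obtain a where a: "riccati_bounded_solution G 0 a" and xa: "\<And>t. x t \<le> a t"
    and a_max: "\<And>z t. riccati_bounded_solution G 0 z \<Longrightarrow> z t \<le> a t"
    by (rule maximal_riccati_bounded_solution[OF G sub riccati_bounded_solution_bound[OF G x]]) blast
  define G' where "G' t = - G (- t)" for t
  have G': "coarse_lipschitz (2 * B + C) G'"
    unfolding G'_def by (rule coarse_lipschitz_reflect[OF G])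
  have x': "riccati_bounded_solution G' (0 - \<rho>) (\<lambda>t. - x (- t))"
    unfolding G'_def by (rule riccati_bounded_solution_reflect[OF x])
  have sub': "riccati_subsolution G' 0 (\<lambda>t. - x (- t))"
    using x' \<rho> G' by (intro riccati_solution_imp_subsolution[of G' "0 - \<rho>"])
      (auto simp: riccati_bounded_solution_def coarse_lipschitz_def)
  obtain r' where r': "riccati_bounded_solution G' 0 r'" and xr': "\<And>t. - x (- t) \<le> r' t"
    and r'_max: "\<And>z t. riccati_bounded_solution G' 0 z \<Longrightarrow> z t \<le> r' t"
    by (rule maximal_riccati_bounded_solution[OF G' sub' riccati_bounded_solution_bound[OF G' x']]) blast
  define r where "r t = - r' (- t)" for t
  have r: "riccati_bounded_solution G 0 r"
    using riccati_bounded_solution_reflect[OF r'] by (simp add: G'_def r_def[abs_def])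
  have rx: "r t \<le> x t" for t
    using xr'[of "- t"] by (simp add: r_def)
  have r_min: "r t \<le> z t" if "riccati_bounded_solution G 0 z" for z t
    using r'_max[of "\<lambda>t. - z (- t)" "- t"] riccati_bounded_solution_reflect[OF that]
    by (simp add: G'_def[abs_def] r_def)
  have bounded_iff: "bounded_solution \<Gamma> q y \<longleftrightarrow> riccati_bounded_solution G 0 (\<lambda>t. y t - Q t)" for y
    using bounded_solution_iff_riccati[OF q, of 0 y] by (simp add: G_def Q_def)
  have cont: "continuous_on S (\<lambda>t. - 2 * (z t - G t))" if "riccati_bounded_solution G 0 z" for z S
  proof -
    have "riccati_solution G 0 z"
      using that by (simp add: riccati_bounded_solution_def)
    then have "continuous_on S z"
      by (rule riccati_solution_continuous)
    then show ?thesis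
      by (intro continuous_intros G_cont)
  qed
  \<comment> \<open>The fundamental theorem for oriented integrals holds in either order of
    \<open>s\<close> and \<open>t\<close>, so one identity serves the forward estimate for
    \<open>a\<close> and the backward one for \<open>r\<close>.\<close>
  have lbint: "(LBINT l=ereal s..ereal t. - 2 * (z l + Q l - \<Gamma> l))
      = primitive 0 (\<lambda>t. - 2 * (z t - G t)) t - primitive 0 (\<lambda>t. - 2 * (z t - G t)) s"
    if "riccati_bounded_solution G 0 z" for z s t
  proof -
    have "(LBINT l=ereal s..ereal t. - 2 * (z l - G l))
      = primitive 0 (\<lambda>t. - 2 * (z t - G t)) t - primitive 0 (\<lambda>t. - 2 * (z t - G t)) s"
    proof (rule interval_integral_FTC_finite)
      show "continuous_on {min s t..max s t} (\<lambda>l. - 2 * (z l - G l))"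
        by (rule cont[OF that])
      fix x
      have "(primitive 0 (\<lambda>t. - 2 * (z t - G t)) has_real_derivative - 2 * (z x - G x)) (at x)"
        by (rule DERIV_primitive[OF cont[OF that]])
      then show "(primitive 0 (\<lambda>t. - 2 * (z t - G t)) has_vector_derivative - 2 * (z x - G x))
          (at x within {min s t..max s t})"
        unfolding has_real_derivative_iff_has_vector_derivative
        by (rule has_vector_derivative_at_within)
    qed
    moreover have "z l + Q l - \<Gamma> l = z l - G l" for l
      by (simp add: G_def Q_def)
    ultimately show ?thesis
      by (simp only:)
  qed
  have prim: "(primitive 0 (\<lambda>t. - 2 * (z t - G t)) has_real_derivative - 2 * (z t - G t)) (at t)"
    if "riccati_bounded_solution G 0 z" for z t
    by (intro DERIV_primitive cont that)
  obtain k1 where k1: "1 \<le> k1" and attr: "\<And>s t. s \<le> t \<Longrightarrow>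
      exp (primitive 0 (\<lambda>t. - 2 * (a t - G t)) t - primitive 0 (\<lambda>t. - 2 * (a t - G t)) s)
        \<le> k1 * exp (- (2 * sqrt \<rho>) * (t - s))"
    by (rule riccati_attractor_hyperbolic[OF \<rho>(1) x a xa prim[OF a]]) blast
  obtain k2 where k2: "1 \<le> k2" and rep: "\<And>s t. t \<le> s \<Longrightarrow>
      exp (primitive 0 (\<lambda>t. - 2 * (r t - G t)) t - primitive 0 (\<lambda>t. - 2 * (r t - G t)) s)
        \<le> k2 * exp ((2 * sqrt \<rho>) * (t - s))"
    by (rule riccati_repeller_hyperbolic[OF \<rho>(1) x r rx prim[OF r]]) blast
  have "attractor_repeller_pair \<Gamma> q (\<lambda>t. a t + Q t) (\<lambda>t. r t + Q t)"
    unfolding attractor_repeller_pair_def bounded_iff lbint[OF a] lbint[OF r]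
  proof (intro conjI allI impI)
    fix y t assume "riccati_bounded_solution G 0 (\<lambda>t. y t - Q t)"
    from r_min[OF this, of t] a_max[OF this, of t]
    show "r t + Q t \<le> y t" "y t \<le> a t + Q t"
      by auto
  next
    show "\<exists>k \<beta>. 1 \<le> k \<and> 0 < \<beta> \<and>
      (\<forall>s t. s \<le> t \<longrightarrow> exp (primitive 0 (\<lambda>t. - 2 * (a t - G t)) t - primitive 0 (\<lambda>t. - 2 * (a t - G t)) s)
        \<le> k * exp (- \<beta> * (t - s))) \<and>
      (\<forall>s t. t \<le> s \<longrightarrow> exp (primitive 0 (\<lambda>t. - 2 * (r t - G t)) t - primitive 0 (\<lambda>t. - 2 * (r t - G t)) s)
        \<le> k * exp (\<beta> * (t - s)))"
    proof (rule exI[of _ "max k1 k2"], rule exI[of _ "2 * sqrt \<rho>"], intro conjI allI impI)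
      fix s t :: real assume "s \<le> t"
      from attr[OF this]
      show "exp (primitive 0 (\<lambda>t. - 2 * (a t - G t)) t - primitive 0 (\<lambda>t. - 2 * (a t - G t)) s)
          \<le> max k1 k2 * exp (- (2 * sqrt \<rho>) * (t - s))"
        by (rule order_trans) (intro mult_right_mono, auto)
    next
      fix s t :: real assume "t \<le> s"
      from rep[OF this]
      show "exp (primitive 0 (\<lambda>t. - 2 * (r t - G t)) t - primitive 0 (\<lambda>t. - 2 * (r t - G t)) s)
          \<le> max k1 k2 * exp (2 * sqrt \<rho> * (t - s))"
        by (rule order_trans) (intro mult_right_mono, auto)
    qed (use k1 \<rho> in auto)
  qed (use a r in auto)
  then show ?thesis
    by blast
qed

end

subsection \<open>Almost periodic forcing\<close>

lemma uniformly_continuous_of_limits: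
  fixes f :: "real \<Rightarrow> real"
  assumes cont: "continuous_on UNIV f" and top: "(f \<longlongrightarrow> a) at_top" and bot: "(f \<longlongrightarrow> b) at_bot"
  shows "uniformly_continuous_on UNIV f"
  unfolding uniformly_continuous_on_def
proof (intro allI impI)
  fix e :: real assume "0 < e"
  then have e: "0 < e / 2"
    by simp
  obtain M1 where M1: "\<And>x. M1 \<le> x \<Longrightarrow> dist (f x) a < e / 2"
    using tendstoD[OF top e] by (auto simp: eventually_at_top_linorder)
  obtain M2 where M2: "\<And>x. x \<le> M2 \<Longrightarrow> dist (f x) b < e / 2"
    using tendstoD[OF bot e] by (auto simp: eventually_at_bot_linorder)
  have "uniformly_continuous_on {M2 - 1..M1 + 1} f"
    using cont by (intro compact_uniformly_continuous) (auto intro: continuous_on_subset)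
  then obtain d where "0 < d"
    and d: "\<And>x y. x \<in> {M2 - 1..M1 + 1} \<Longrightarrow> y \<in> {M2 - 1..M1 + 1} \<Longrightarrow> dist y x < d \<Longrightarrow> dist (f y) (f x) < e"
    using \<open>0 < e\<close> unfolding uniformly_continuous_on_def by metis
  show "\<exists>d>0. \<forall>x\<in>UNIV. \<forall>y\<in>UNIV. dist y x < d \<longrightarrow> dist (f y) (f x) < e"
  proof (intro exI[of _ "min d 1"] conjI ballI impI)
    fix x y :: real assume xy: "dist y x < min d 1"
    then have close: "\<bar>y - x\<bar> < 1" "dist y x < d"
      by (auto simp: dist_real_def)
    \<comment> \<open>The middle window overlaps each tail by length 1, so two points closer than 1
      always share a region.\<close>
    consider "M1 \<le> x" "M1 \<le> y" | "x \<le> M2" "y \<le> M2" | "x \<in> {M2 - 1..M1 + 1}" "y \<in> {M2 - 1..M1 + 1}"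
      using close(1) by force
    then show "dist (f y) (f x) < e"
    proof cases
      case 1
      then show ?thesis
        using M1 dist_triangle_half_r[of a "f y" e "f x"] by (simp add: dist_commute)
    next
      case 2
      then show ?thesis
        using M2 dist_triangle_half_r[of b "f y" e "f x"] by (simp add: dist_commute)
    next
      case 3
      then show ?thesis
        using d close(2) by blast
    qed
  qed (use \<open>0 < d\<close> in auto)
qed

lemma almost_periodicD:
  assumes "almost_periodic p" "0 < \<epsilon>"
  obtains L where "0 < L" "\<And>c. \<exists>\<tau>\<in>{c..c + L}. \<forall>t. \<bar>p (t + \<tau>) - p t\<bar> \<le> \<epsilon>"
  using assms unfolding almost_periodic_def by metis

text \<open>A common almost period carries both points into one compact window, where uniform
  continuity is available; two thirds of \<epsilon> pay for the translation.\<close>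

lemma almost_periodic_uniformly_continuous:
  assumes p: "almost_periodic p" and "0 < \<epsilon>"
  obtains \<delta> where "0 < \<delta>" "\<And>x y. \<bar>y - x\<bar> \<le> \<delta> \<Longrightarrow> \<bar>p y - p x\<bar> \<le> \<epsilon>"
proof -
  have "0 < \<epsilon> / 3"
    using \<open>0 < \<epsilon>\<close> by simp
  obtain L where "0 < L" and L: "\<And>c. \<exists>\<tau>\<in>{c..c + L}. \<forall>t. \<bar>p (t + \<tau>) - p t\<bar> \<le> \<epsilon> / 3"
    by (rule almost_periodicD[OF p \<open>0 < \<epsilon> / 3\<close>]) blast
  have "uniformly_continuous_on {-1..L + 1} p"
    using p by (intro compact_uniformly_continuous)
      (auto simp: almost_periodic_def intro: continuous_on_subset)
  then obtain d where "0 < d"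
    and d: "\<And>x y. x \<in> {-1..L + 1} \<Longrightarrow> y \<in> {-1..L + 1} \<Longrightarrow> dist y x < d \<Longrightarrow> dist (p y) (p x) < \<epsilon> / 3"
    using \<open>0 < \<epsilon> / 3\<close> unfolding uniformly_continuous_on_def by metis
  show thesis
  proof (rule that[of "min (d / 2) 1"])
    show "0 < min (d / 2) 1"
      using \<open>0 < d\<close> by simp
    fix x y assume xy: "\<bar>y - x\<bar> \<le> min (d / 2) 1"
    obtain \<tau> where "\<tau> \<in> {- x..- x + L}" and \<tau>: "\<And>t. \<bar>p (t + \<tau>) - p t\<bar> \<le> \<epsilon> / 3"
      using L[of "- x"] by auto
    then have "x + \<tau> \<in> {-1..L + 1}" "y + \<tau> \<in> {-1..L + 1}" "dist (y + \<tau>) (x + \<tau>) < d"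
      using xy \<open>0 < d\<close> by (auto simp: dist_real_def)
    from d[OF this] have "\<bar>p (y + \<tau>) - p (x + \<tau>)\<bar> < \<epsilon> / 3"
      by (simp add: dist_real_def)
    then show "\<bar>p y - p x\<bar> \<le> \<epsilon>"
      using \<tau>[of x] \<tau>[of y] by linarith
  qed
qed

lemma DERIV_primitive_shift_diff:
  assumes "continuous_on UNIV p"
  shows "((\<lambda>t. primitive 0 (shift p s') t - primitive 0 (shift p s) t)
    has_real_derivative p (s' + t) - p (s + t)) (at t)"
proof -
  have "continuous_on UNIV (shift p s)" for s
    unfolding shift_def by (intro continuous_on_compose2[OF assms] continuous_intros) auto
  from DERIV_diff[OF DERIV_primitive[OF this, of 0 s'] DERIV_primitive[OF this, of 0 s]]
  show ?thesis
    by (simp add: shift_def)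
qed

lemma primitive_shift_diff_le:
  assumes p: "continuous_on UNIV p" and le: "\<And>t. \<bar>p (s' + t) - p (s + t)\<bar> \<le> \<epsilon>" and "a \<le> b"
  shows "\<bar>(primitive 0 (shift p s') b - primitive 0 (shift p s) b) -
    (primitive 0 (shift p s') a - primitive 0 (shift p s) a)\<bar> \<le> \<epsilon> * (b - a)"
proof (cases "a = b")
  case False
  with \<open>a \<le> b\<close> have "a < b"
    by simp
  obtain x where "primitive 0 (shift p s') b - primitive 0 (shift p s) b -
      (primitive 0 (shift p s') a - primitive 0 (shift p s) a) = (b - a) * (p (s' + x) - p (s + x))"
    using MVT2[OF \<open>a < b\<close> DERIV_primitive_shift_diff[OF p]] by blast
  moreover have "(b - a) * \<bar>p (s' + x) - p (s + x)\<bar> \<le> (b - a) * \<epsilon>"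
    using le \<open>a < b\<close> by (intro mult_left_mono) auto
  ultimately show ?thesis
    using \<open>a < b\<close> by (simp add: abs_mult mult.commute)
qed simp

text \<open>On the window \<open>[0, L]\<close> close primitives and uniform continuity give
  pointwise distance at most \<open>3 * \<epsilon>\<close>. An almost period moves any
  \<open>t\<close> into that window for both translates at once, at the cost of \<epsilon> each.
  Thus finite information controls the whole line.\<close>

lemma almost_periodic_close_translates:
  assumes p: "almost_periodic p" and \<epsilon>: "0 < \<epsilon>"
  obtains N \<eta> where "0 < \<eta>" "\<And>s s' t. (\<And>t. \<bar>t\<bar> \<le> N \<Longrightarrow>
    \<bar>primitive 0 (shift p s') t - primitive 0 (shift p s) t\<bar> < \<eta>) \<Longrightarrow> \<bar>p (s' + t) - p (s + t)\<bar> \<le> 5 * \<epsilon>"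
proof -
  have p_cont: "continuous_on UNIV p"
    using p by (simp add: almost_periodic_def)
  obtain L where "0 < L" and L: "\<And>c. \<exists>\<tau>\<in>{c..c + L}. \<forall>t. \<bar>p (t + \<tau>) - p t\<bar> \<le> \<epsilon>"
    by (rule almost_periodicD[OF p \<epsilon>]) blast
  obtain \<delta> where "0 < \<delta>" and \<delta>: "\<And>x y. \<bar>y - x\<bar> \<le> \<delta> \<Longrightarrow> \<bar>p y - p x\<bar> \<le> \<epsilon>"
    by (rule almost_periodic_uniformly_continuous[OF p \<epsilon>]) blast
  show thesis
  \<comment> \<open>A distance above \<open>3 * \<epsilon>\<close> at \<open>r\<close> stays above
    \<epsilon> on \<open>[r, r + \<delta>]\<close>, so the primitives would separate by more than
    \<open>\<epsilon> * \<delta>\<close>, twice the allowed error. The window is lengthened by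
    \<delta> to contain \<open>r + \<delta>\<close>.\<close>
  proof (rule that[of "\<epsilon> * \<delta> / 2" "L + \<delta>"])
    show "0 < \<epsilon> * \<delta> / 2"
      using \<epsilon> \<open>0 < \<delta>\<close> by simp
    fix s s' t
    assume close: "\<And>t. \<bar>t\<bar> \<le> L + \<delta> \<Longrightarrow>
      \<bar>primitive 0 (shift p s') t - primitive 0 (shift p s) t\<bar> < \<epsilon> * \<delta> / 2"
    define D where "D t = primitive 0 (shift p s') t - primitive 0 (shift p s) t" for t
    have window: "\<bar>p (s' + r) - p (s + r)\<bar> \<le> 3 * \<epsilon>" if r: "0 \<le> r" "r \<le> L" for r
    proof (rule ccontr)
      assume large: "\<not> \<bar>p (s' + r) - p (s + r)\<bar> \<le> 3 * \<epsilon>"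
      obtain x where x: "r < x" "x < r + \<delta>"
        and "D (r + \<delta>) - D r = (r + \<delta> - r) * (p (s' + x) - p (s + x))"
        using MVT2[of r "r + \<delta>", OF _ DERIV_primitive_shift_diff[OF p_cont, of s' s]] \<open>0 < \<delta>\<close>
        unfolding D_def by auto
      then have "\<bar>D (r + \<delta>) - D r\<bar> = \<delta> * \<bar>p (s' + x) - p (s + x)\<bar>"
        using \<open>0 < \<delta>\<close> by (simp add: abs_mult)
      moreover have "\<epsilon> < \<bar>p (s' + x) - p (s + x)\<bar>"
        using \<delta>[of "s' + x" "s' + r"] \<delta>[of "s + x" "s + r"] x large by (auto simp: abs_le_iff)
      then have "\<delta> * \<epsilon> < \<delta> * \<bar>p (s' + x) - p (s + x)\<bar>"
        using \<open>0 < \<delta>\<close> by simp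
      moreover have "\<bar>D (r + \<delta>)\<bar> < \<epsilon> * \<delta> / 2" "\<bar>D r\<bar> < \<epsilon> * \<delta> / 2"
        using close[of "r + \<delta>"] close[of r] r \<open>0 < \<delta>\<close> by (auto simp: D_def)
      ultimately show False
        by (simp add: mult.commute)
    qed
    obtain \<tau> where "\<tau> \<in> {- t..- t + L}" and \<tau>: "\<And>t. \<bar>p (t + \<tau>) - p t\<bar> \<le> \<epsilon>"
      using L[of "- t"] by auto
    then have "\<bar>p (s' + (t + \<tau>)) - p (s + (t + \<tau>))\<bar> \<le> 3 * \<epsilon>"
      by (intro window) auto
    then show "\<bar>p (s' + t) - p (s + t)\<bar> \<le> 5 * \<epsilon>"
      using \<tau>[of "s' + t"] \<tau>[of "s + t"] unfolding add.assoc by linarith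
  qed
qed

text \<open>
  Uniform closeness is expressed through primitives because that form of it survives the passage
  from translates to the closure.
\<close>

lemma almost_periodic_hull_uniform:
  assumes p: "almost_periodic p" and C: "drift_bounded C p" and \<epsilon>: "0 < \<epsilon>"
  obtains N \<eta> where "0 < \<eta>"
    "\<And>f g a b. f \<in> time_hull p \<Longrightarrow> g \<in> time_hull p \<Longrightarrow>
      (\<And>t. \<bar>t\<bar> \<le> N \<Longrightarrow> \<bar>primitive 0 f t - primitive 0 g t\<bar> < \<eta>) \<Longrightarrow> a \<le> b \<Longrightarrow>
      \<bar>(primitive 0 f b - primitive 0 g b) - (primitive 0 f a - primitive 0 g a)\<bar> \<le> \<epsilon> * (b - a)"
proof -
  have p_cont: "continuous_on UNIV p"
    using p by (simp add: almost_periodic_def)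
  have "0 < \<epsilon> / 5"
    using \<epsilon> by simp
  obtain \<eta> N where "0 < \<eta>" and \<eta>: "\<And>s s' t. (\<And>t. \<bar>t\<bar> \<le> N \<Longrightarrow>
    \<bar>primitive 0 (shift p s') t - primitive 0 (shift p s) t\<bar> < \<eta>) \<Longrightarrow>
    \<bar>p (s' + t) - p (s + t)\<bar> \<le> 5 * (\<epsilon> / 5)"
    by (rule almost_periodic_close_translates[OF p \<open>0 < \<epsilon> / 5\<close>]) blast
  show thesis
  proof (rule that[of "\<eta> / 2" N])
    show "0 < \<eta> / 2"
      using \<open>0 < \<eta>\<close> by simp
    fix f g and a b :: real
    assume f: "f \<in> time_hull p" and g: "g \<in> time_hull p" and "a \<le> b"
      and close: "\<And>t. \<bar>t\<bar> \<le> N \<Longrightarrow> \<bar>primitive 0 f t - primitive 0 g t\<bar> < \<eta> / 2"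
    define N' where "N' = max N (max \<bar>a\<bar> \<bar>b\<bar>)"
    show "\<bar>(primitive 0 f b - primitive 0 g b) - (primitive 0 f a - primitive 0 g a)\<bar> \<le> \<epsilon> * (b - a)"
    proof (rule field_le_epsilon)
      fix e' :: real assume "0 < e'"
      \<comment> \<open>Two errors \<open>e \<le> \<eta> / 4\<close> added to
        \<open>\<eta> / 2\<close> stay below \<eta>, which triggers the estimate for translates; the
        four errors at \<open>a\<close> and \<open>b\<close> sum to at most
        \<open>e'\<close>.\<close>
      define e where "e = min (\<eta> / 4) (e' / 4)"
      have e: "0 < e" "e \<le> \<eta> / 4" "4 * e \<le> e'"
        using \<open>0 < \<eta>\<close> \<open>0 < e'\<close> by (auto simp: e_def)
      obtain s' where s': "\<And>t. \<bar>t\<bar> \<le> N' \<Longrightarrow> \<bar>primitive 0 (shift p s') t - primitive 0 f t\<bar> < e"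
        by (rule time_hull_approx[OF C f e(1), of N']) blast
      obtain s where s: "\<And>t. \<bar>t\<bar> \<le> N' \<Longrightarrow> \<bar>primitive 0 (shift p s) t - primitive 0 g t\<bar> < e"
        by (rule time_hull_approx[OF C g e(1), of N']) blast
      have "\<bar>p (s' + t) - p (s + t)\<bar> \<le> 5 * (\<epsilon> / 5)" for t
      proof (rule \<eta>)
        fix t assume "\<bar>t\<bar> \<le> N"
        then have "\<bar>t\<bar> \<le> N'"
          by (simp add: N'_def)
        then show "\<bar>primitive 0 (shift p s') t - primitive 0 (shift p s) t\<bar> < \<eta>"
          using s'[of t] s[of t] close[OF \<open>\<bar>t\<bar> \<le> N\<close>] e(2) by linarith
      qed
      then have "\<bar>(primitive 0 (shift p s') b - primitive 0 (shift p s) b) -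
          (primitive 0 (shift p s') a - primitive 0 (shift p s) a)\<bar> \<le> \<epsilon> * (b - a)"
        using primitive_shift_diff_le[OF p_cont _ \<open>a \<le> b\<close>, of s' s \<epsilon>] by simp
      moreover have "\<bar>a\<bar> \<le> N'" "\<bar>b\<bar> \<le> N'"
        by (auto simp: N'_def)
      ultimately show "\<bar>(primitive 0 f b - primitive 0 g b) - (primitive 0 f a - primitive 0 g a)\<bar>
          \<le> \<epsilon> * (b - a) + e'"
        using s'[of a] s'[of b] s[of a] s[of b] e(3) by linarith
    qed
  qed
qed

text \<open>Each new term is chosen beyond the previous one and beyond its index; the former gives
  the interlacing, the latter the divergence.\<close>

lemma alternating_sequences:
  fixes P Q :: "real \<Rightarrow> bool"
  assumes P: "\<And>N. \<exists>s\<ge>N. P s" and Q: "\<And>N. \<exists>s\<ge>N. Q s"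
  obtains u v :: "nat \<Rightarrow> real" where "filterlim u at_top sequentially" "filterlim v at_top sequentially"
    "\<And>n. u n \<le> v n" "\<And>n. v n \<le> u (Suc n)" "\<And>n. P (u n)" "\<And>n. Q (v n)"
proof -
  obtain g where g: "\<And>N. N \<le> g N" "\<And>N. P (g N)"
    using P by metis
  obtain h where h: "\<And>N. N \<le> h N" "\<And>N. Q (h N)"
    using Q by metis
  define u where "u = rec_nat (g 0) (\<lambda>n x. g (max (h x) (real (Suc n))))"
  have u_Suc: "u (Suc n) = g (max (h (u n)) (real (Suc n)))" for n
    by (simp add: u_def)
  have u_ge: "real n \<le> u n" for n
  proof (cases n)
    case 0
    then show ?thesis
      using g(1)[of 0] by (simp add: u_def)
  next
    case (Suc m)
    then show ?thesis
      using g(1)[of "max (h (u m)) (real (Suc m))"] by (simp only: u_Suc)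
  qed
  show thesis
  proof (rule that[of u "\<lambda>n. h (u n)"])
    show "filterlim u at_top sequentially"
      by (rule filterlim_at_top_mono[OF filterlim_real_sequentially]) (simp add: u_ge)
    show "filterlim (\<lambda>n. h (u n)) at_top sequentially"
      by (rule filterlim_at_top_mono[OF filterlim_real_sequentially])
         (intro always_eventually allI order_trans[OF u_ge h(1)])
    show "h (u n) \<le> u (Suc n)" for n
      using g(1)[of "max (h (u n)) (real (Suc n))"] by (simp add: u_Suc)
    show "P (u n)" for n
      by (cases n) (simp add: u_def g(2), simp only: u_Suc g(2))
  qed (use h in auto)
qed

context bounded_guide
begin

text \<open>A neighbourhood fixes primitives only on a window; almost periodicity turns this into a
  small drift for all times, and the drift comparison applies in both directions.\<close>

lemma continuous_lambda_star_almost_periodic: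
  assumes p: "almost_periodic p" and C: "drift_bounded C p"
  shows "continuous_map (hull_topology p) euclideanreal (lambda_star \<Gamma>)"
  unfolding continuous_map_def topspace_hull_topology
proof (intro conjI allI impI openin_hull_topologyI)
  fix V :: "real set" and q assume V: "openin euclideanreal V" and "q \<in> {x \<in> time_hull p. lambda_star \<Gamma> x \<in> V}"
  then have q: "q \<in> time_hull p" "lambda_star \<Gamma> q \<in> V"
    by auto
  have "open V"
    using V open_openin by blast
  then have "\<exists>e>0. \<forall>x. dist x (lambda_star \<Gamma> q) < e \<longrightarrow> x \<in> V"
    using q(2) unfolding open_dist by (rule bspec)
  then obtain e where "0 < e" and e: "\<And>x. dist x (lambda_star \<Gamma> q) < e \<Longrightarrow> x \<in> V"
    by blast
  then have "0 < e / 2"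
    by simp
  obtain \<eta> N where "0 < \<eta>" and \<eta>: "\<And>f g a b. f \<in> time_hull p \<Longrightarrow> g \<in> time_hull p \<Longrightarrow>
      (\<And>t. \<bar>t\<bar> \<le> N \<Longrightarrow> \<bar>primitive 0 f t - primitive 0 g t\<bar> < \<eta>) \<Longrightarrow> a \<le> b \<Longrightarrow>
      \<bar>(primitive 0 f b - primitive 0 g b) - (primitive 0 f a - primitive 0 g a)\<bar> \<le> e / 2 * (b - a)"
    by (rule almost_periodic_hull_uniform[OF p C \<open>0 < e / 2\<close>]) blast
  note q_drift = time_hull_drift_bounded[OF C q(1)]
  obtain U where U: "openin sigma_topology U" "q \<in> U"
    and U_close: "\<And>f t. f \<in> U \<Longrightarrow> drift_bounded C f \<Longrightarrow> \<bar>t\<bar> \<le> N \<Longrightarrow> \<bar>primitive 0 f t - primitive 0 q t\<bar> < \<eta>"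
    by (rule sigma_neighbourhood[OF q_drift \<open>0 < \<eta>\<close>, of N]) blast
  have "f \<in> {x \<in> time_hull p. lambda_star \<Gamma> x \<in> V}" if f: "f \<in> U" "f \<in> time_hull p" for f
  proof -
    note f_drift = time_hull_drift_bounded[OF C f(2)]
    have close: "\<bar>primitive 0 f t - primitive 0 q t\<bar> < \<eta>" "\<bar>primitive 0 q t - primitive 0 f t\<bar> < \<eta>"
      if "\<bar>t\<bar> \<le> N" for t
      using U_close[OF f(1) f_drift that] by (auto simp: abs_minus_commute)
    have "lambda_star \<Gamma> f \<le> lambda_star \<Gamma> q + e / 2"
      by (rule lambda_star_drift_le[OF q_drift f_drift \<eta>[OF f(2) q(1) close(1)]])
    moreover have "lambda_star \<Gamma> q \<le> lambda_star \<Gamma> f + e / 2"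
      by (rule lambda_star_drift_le[OF f_drift q_drift \<eta>[OF q(1) f(2) close(2)]])
    ultimately have "dist (lambda_star \<Gamma> f) (lambda_star \<Gamma> q) < e"
      using \<open>0 < e\<close> by (simp add: dist_real_def abs_less_iff)
    then show ?thesis
      using e f(2) by simp
  qed
  then show "\<exists>U. openin sigma_topology U \<and> q \<in> U \<and>
      (\<forall>f\<in>U. f \<in> time_hull p \<longrightarrow> f \<in> {x \<in> time_hull p. lambda_star \<Gamma> x \<in> V})"
    using U by blast
qed auto

text \<open>Translation by \<tau> changes the forcing by at most \<epsilon> at every time while
  \<Gamma> stays fixed, so the threshold along translates inherits the almost periods of
  \<open>p\<close>, and with them recurrence.\<close>

lemma lambda_star_almost_period:
  assumes p: "continuous_on UNIV p" and C: "drift_bounded C p"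
    and \<tau>: "\<And>t. \<bar>p (t + \<tau>) - p t\<bar> \<le> \<epsilon>"
  shows "\<bar>lambda_star \<Gamma> (shift p (s + \<tau>)) - lambda_star \<Gamma> (shift p s)\<bar> \<le> \<epsilon>"
proof -
  have le: "\<bar>p (s + \<tau> + t) - p (s + t)\<bar> \<le> \<epsilon>" "\<bar>p (s + t) - p (s + \<tau> + t)\<bar> \<le> \<epsilon>" for t
    using \<tau>[of "s + t"] by (auto simp: algebra_simps abs_minus_commute)
  note drift = drift_bounded_shift[OF C]
  have "lambda_star \<Gamma> (shift p (s + \<tau>)) \<le> lambda_star \<Gamma> (shift p s) + \<epsilon>"
    by (rule lambda_star_drift_le[OF drift drift primitive_shift_diff_le[OF p le(1)]])
  moreover have "lambda_star \<Gamma> (shift p s) \<le> lambda_star \<Gamma> (shift p (s + \<tau>)) + \<epsilon>"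
    by (rule lambda_star_drift_le[OF drift drift primitive_shift_diff_le[OF p le(2)]])
  ultimately show ?thesis
    by (simp add: abs_le_iff)
qed

lemma lambda_star_recurrence:
  assumes p: "almost_periodic p" and C: "drift_bounded C p" and "0 < \<epsilon>"
  shows "\<exists>s'\<ge>N. \<bar>lambda_star \<Gamma> (shift p s') - lambda_star \<Gamma> (shift p s)\<bar> \<le> \<epsilon>"
    and "\<exists>s'\<le>N. \<bar>lambda_star \<Gamma> (shift p s') - lambda_star \<Gamma> (shift p s)\<bar> \<le> \<epsilon>"
proof -
  have cont: "continuous_on UNIV p"
    using p by (simp add: almost_periodic_def)
  obtain L where "0 < L" and L: "\<And>c. \<exists>\<tau>\<in>{c..c + L}. \<forall>t. \<bar>p (t + \<tau>) - p t\<bar> \<le> \<epsilon>"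
    by (rule almost_periodicD[OF p \<open>0 < \<epsilon>\<close>]) blast
  obtain \<tau> where "\<tau> \<in> {N - s..N - s + L}" "\<And>t. \<bar>p (t + \<tau>) - p t\<bar> \<le> \<epsilon>"
    using L[of "N - s"] by auto
  then show "\<exists>s'\<ge>N. \<bar>lambda_star \<Gamma> (shift p s') - lambda_star \<Gamma> (shift p s)\<bar> \<le> \<epsilon>"
    using lambda_star_almost_period[OF cont C, of \<tau> \<epsilon> s] by (intro exI[of _ "s + \<tau>"]) auto
  \<comment> \<open>The window is placed to end at \<open>N - s\<close>, so that
    \<open>s + \<sigma>\<close> cannot exceed \<open>N\<close>.\<close>
  obtain \<sigma> where "\<sigma> \<in> {N - s - L..N - s - L + L}" "\<And>t. \<bar>p (t + \<sigma>) - p t\<bar> \<le> \<epsilon>"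
    using L[of "N - s - L"] by auto
  then show "\<exists>s'\<le>N. \<bar>lambda_star \<Gamma> (shift p s') - lambda_star \<Gamma> (shift p s)\<bar> \<le> \<epsilon>"
    using lambda_star_almost_period[OF cont C, of \<sigma> \<epsilon> s] by (intro exI[of _ "s + \<sigma>"]) auto
qed

lemma lambda_star_sign_changes:
  assumes p: "almost_periodic p" and C: "drift_bounded C p"
    and s1: "lambda_star \<Gamma> (shift p s1) < 0" and s2: "0 < lambda_star \<Gamma> (shift p s2)"
  shows "\<exists>s1p s2p s1m s2m :: nat \<Rightarrow> real.
         filterlim s1p at_top sequentially \<and> filterlim s2p at_top sequentially \<and>
         filterlim s1m at_bot sequentially \<and> filterlim s2m at_bot sequentially \<and>
         (\<forall>n. s1p n \<le> s2p n \<and> s2p n \<le> s1p (Suc n)) \<and>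
         (\<forall>n. - s1m n \<le> - s2m n \<and> - s2m n \<le> - s1m (Suc n)) \<and>
         (\<forall>n. lambda_star \<Gamma> (shift p (s1p n)) < 0 \<and> 0 < lambda_star \<Gamma> (shift p (s2p n))) \<and>
         (\<forall>n. lambda_star \<Gamma> (shift p (s1m n)) < 0 \<and> 0 < lambda_star \<Gamma> (shift p (s2m n)))"
proof -
  \<comment> \<open>Half the smaller distance of the two given thresholds from 0, so recurrence up
    to \<epsilon> preserves both signs.\<close>
  define \<epsilon> where "\<epsilon> = min (- lambda_star \<Gamma> (shift p s1)) (lambda_star \<Gamma> (shift p s2)) / 2"
  have \<epsilon>: "0 < \<epsilon>"
    using s1 s2 by (simp add: \<epsilon>_def)
  have \<epsilon>_le: "\<epsilon> \<le> - lambda_star \<Gamma> (shift p s1) / 2" "\<epsilon> \<le> lambda_star \<Gamma> (shift p s2) / 2"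
    by (auto simp: \<epsilon>_def)
  have neg: "lambda_star \<Gamma> (shift p s) < 0"
    if "\<bar>lambda_star \<Gamma> (shift p s) - lambda_star \<Gamma> (shift p s1)\<bar> \<le> \<epsilon>" for s
    using that s1 \<epsilon>_le by linarith
  have pos: "0 < lambda_star \<Gamma> (shift p s)"
    if "\<bar>lambda_star \<Gamma> (shift p s) - lambda_star \<Gamma> (shift p s2)\<bar> \<le> \<epsilon>" for s
    using that s2 \<epsilon>_le by linarith
  have up: "\<exists>s\<ge>N. lambda_star \<Gamma> (shift p s) < 0" "\<exists>s\<ge>N. 0 < lambda_star \<Gamma> (shift p s)" for N
    using lambda_star_recurrence(1)[OF p C \<epsilon>, of N] neg pos by blast+
  have down: "\<exists>s\<ge>N. lambda_star \<Gamma> (shift p (- s)) < 0" "\<exists>s\<ge>N. 0 < lambda_star \<Gamma> (shift p (- s))" for N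
  proof -
    obtain s where "s \<le> - N" "lambda_star \<Gamma> (shift p s) < 0"
      using lambda_star_recurrence(2)[OF p C \<epsilon>, of "- N" s1] neg by blast
    then show "\<exists>s\<ge>N. lambda_star \<Gamma> (shift p (- s)) < 0"
      by (intro exI[of _ "- s"]) auto
    obtain s where "s \<le> - N" "0 < lambda_star \<Gamma> (shift p s)"
      using lambda_star_recurrence(2)[OF p C \<epsilon>, of "- N" s2] pos by blast
    then show "\<exists>s\<ge>N. 0 < lambda_star \<Gamma> (shift p (- s))"
      by (intro exI[of _ "- s"]) auto
  qed
  obtain u v :: "nat \<Rightarrow> real" where uv: "filterlim u at_top sequentially" "filterlim v at_top sequentially"
    "\<And>n. u n \<le> v n" "\<And>n. v n \<le> u (Suc n)" "\<And>n. lambda_star \<Gamma> (shift p (u n)) < 0"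
    "\<And>n. 0 < lambda_star \<Gamma> (shift p (v n))"
    by (rule alternating_sequences[OF up]) blast
  obtain u' v' :: "nat \<Rightarrow> real" where uv': "filterlim u' at_top sequentially" "filterlim v' at_top sequentially"
    "\<And>n. u' n \<le> v' n" "\<And>n. v' n \<le> u' (Suc n)" "\<And>n. lambda_star \<Gamma> (shift p (- u' n)) < 0"
    "\<And>n. 0 < lambda_star \<Gamma> (shift p (- v' n))"
    by (rule alternating_sequences[OF down]) blast
  show ?thesis
    by (rule exI[of _ u], rule exI[of _ v], rule exI[of _ "\<lambda>n. - u' n"], rule exI[of _ "\<lambda>n. - v' n"])
       (use uv uv' in \<open>auto simp: filterlim_uminus_at_bot\<close>)
qed

end

theorem theorem6p2:
  fixes p \<Gamma> :: "real \<Rightarrow> real"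
  assumes p: "p \<in> Linf"
    and \<Gamma>_cont: "continuous_on UNIV \<Gamma>"
    and \<Gamma>_bdd: "bounded (range \<Gamma>)"
    and \<Gamma>_top: "\<exists>L. (\<Gamma> \<longlongrightarrow> L) at_top"
    and \<Gamma>_bot: "\<exists>L. (\<Gamma> \<longlongrightarrow> L) at_bot"
  shows
    "(\<forall>q\<in>time_hull p. uniformly_continuous_on UNIV (\<lambda>s. lambda_star \<Gamma> (shift q s)))
   \<and> (lower_semicontinuous_map (hull_topology p) (lambda_star \<Gamma>) \<and>
      bdd_above (range (\<lambda>s. lambda_star \<Gamma> (shift p s))) \<and>
      (\<forall>q\<in>time_hull p. lambda_star \<Gamma> q \<le> (SUP s. lambda_star \<Gamma> (shift p s))))
   \<and> ((\<exists>\<rho>>0. \<forall>s. lambda_star \<Gamma> (shift p s) \<le> - \<rho>) \<longrightarrow>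
      (\<forall>q\<in>time_hull p. \<exists>a r. attractor_repeller_pair \<Gamma> q a r))
   \<and> (almost_periodic p \<longrightarrow>
      continuous_map (hull_topology p) euclideanreal (lambda_star \<Gamma>))
   \<and> (almost_periodic p \<and>
      (\<exists>s1 s2. lambda_star \<Gamma> (shift p s1) < 0 \<and> 0 < lambda_star \<Gamma> (shift p s2)) \<longrightarrow>
      (\<exists>s1p s2p s1m s2m :: nat \<Rightarrow> real.
         filterlim s1p at_top sequentially \<and> filterlim s2p at_top sequentially \<and>
         filterlim s1m at_bot sequentially \<and> filterlim s2m at_bot sequentially \<and>
         (\<forall>n. s1p n \<le> s2p n \<and> s2p n \<le> s1p (Suc n)) \<and>
         (\<forall>n. - s1m n \<le> - s2m n \<and> - s2m n \<le> - s1m (Suc n)) \<and>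
         (\<forall>n. lambda_star \<Gamma> (shift p (s1p n)) < 0 \<and> 0 < lambda_star \<Gamma> (shift p (s2p n))) \<and>
         (\<forall>n. lambda_star \<Gamma> (shift p (s1m n)) < 0 \<and> 0 < lambda_star \<Gamma> (shift p (s2m n)))))"
proof -
  obtain B where "\<And>t. \<bar>\<Gamma> t\<bar> \<le> B"
    using \<Gamma>_bdd by (auto simp: bounded_iff)
  with \<Gamma>_cont interpret bounded_guide \<Gamma> B
    by unfold_locales
  obtain C where C: "drift_bounded C p"
    by (rule Linf_drift_bounded[OF p])
  have uc: "uniformly_continuous_on UNIV \<Gamma>"
    using \<Gamma>_cont \<Gamma>_top \<Gamma>_bot uniformly_continuous_of_limits by blast
  have part1: "\<forall>q\<in>time_hull p. uniformly_continuous_on UNIV (\<lambda>s. lambda_star \<Gamma> (shift q s))"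
    using uniformly_continuous_lambda_star_shift[OF time_hull_drift_bounded[OF C] uc] by blast
  have part3: "\<exists>a r. attractor_repeller_pair \<Gamma> q a r"
    if "0 < \<rho>" "\<forall>s. lambda_star \<Gamma> (shift p s) \<le> - \<rho>" "q \<in> time_hull p" for \<rho> q
  proof (rule attractor_repeller_pair_exists[OF time_hull_drift_bounded[OF C] \<open>0 < \<rho>\<close>])
    \<comment> \<open>The gap uniform over translates becomes a bound for their supremum, and hence
      for the whole hull.\<close>
    have "(SUP s. lambda_star \<Gamma> (shift p s)) \<le> - \<rho>"
      using that(2) by (intro cSUP_least) auto
    then show "lambda_star \<Gamma> q \<le> - \<rho>"
      using lambda_star_le_SUP(2)[OF C that(3)] by linarith
  qed (rule that)
  show ?thesis
    using part1 lower_semicontinuous_lambda_star[OF C] lambda_star_le_SUP[OF C] part3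
      continuous_lambda_star_almost_periodic[OF _ C] lambda_star_sign_changes[OF _ C]
    by (intro conjI impI ballI) blast+
qed

end
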